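(* Let $k$ be a field and $G$ a group, and assume that either $k$ is algebraically closed, or $G$ is perfect and $k$ is finite. Let $V$ be a non-zero finite-dimensional $k$-vector space and let $\rho: G \to \mathrm{Aut}_k(V)$ be a linear representation of $G$ over $k$. Then the $G$-module $V$ is very simple if and only if all the following conditions hold: (i) the $G$-module $V$ is absolutely simple; (ii) the $G$-module $V$ does not admit a projective absolutely simple splitting; (iii) the $G$-module $V$ is not induced from a representation of a proper subgroup of finite index in $G$.
   Context: Let $V$ be a non-zero finite-dimensional vector space over a field $k$, $G$ a group (not assumed finite), and $\rho: G\to \mathrm{Aut}_k(V)$ a linear representation. $\mathrm{Id}$ denotes the identity operator on $V$. A group is perfect if it equals its derived subgroup. Normal subalgebra: a $k$-subalgebra $R\subset \mathrm{End}_k(V)$ containing $\mathrm{Id}$ is called normal if $\rho(s)R\rho(s)^{-1}\subset R$ for all $s\in G$. Very simple: the $G$-module $V$ is very simple if every normal subalgebra $R\subset \mathrm{End}_k(V)$ is either $R=k\cdot\mathrm{Id}$ or $R=\mathrm{End}_k(V)$. Splitting: let $1\to C\hookrightarrow X\stackrel{\pi}{\twoheadrightarrow} G\to 1$ be a central extension of $G$ (that is, $\pi$ is a surjective group homomorphism whose kernel $C$ is a central subgroup of $X$). Suppose that the representation $\rho\pi: X\to \mathrm{Aut}_k(V)$ is isomorphic to a tensor product $\rho_1\otimes\rho_2: X\to \mathrm{Aut}_k(V_1\otimes_k V_2)$ of two $k$-linear representations $\rho_1: X\to \mathrm{Aut}_k(V_1)$, $\rho_2: X\to \mathrm{Aut}_k(V_2)$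 with $\dim_k(V_1)>1$ and $\dim_k(V_2)>1$. Then the triple $(X\stackrel{\pi}{\twoheadrightarrow} G;\rho_1,\rho_2)$ is called a splitting of the $G$-module $V$. The splitting is called projective if both images $\rho_1(C)\subset \mathrm{Aut}_k(V_1)$ and $\rho_2(C)\subset \mathrm{Aut}_k(V_2)$ consist of scalars. The splitting is called absolutely simple if both $\rho_1$ and $\rho_2$ are absolutely irreducible representations of $X$. Induced: $V$ is induced from a representation of a proper subgroup of finite index if there exist a subgroup $G'\subset G$ of finite index $m>1$ and a $k[G']$-module $W$ such that the $k[G]$-module $V$ is isomorphic to the module induced from $W$. *)

theory Defs
  imports "HOL-Algebra.Algebraic_Closure_Type" "HOL-Algebra.Generated_Groups"
    "Jordan_Normal_Form.Matrix"
begin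

text \<open>The field is a type \<open>'k\<close> and the module \<open>V\<close> is a type \<open>'v\<close> with scalar multiplication
  \<open>scale\<close>.  Spaces over which one has to quantify inside a formula (the tensor factors, the inducing
  module, the space over the algebraic closure) have no fixed type; they are coordinate spaces
  \<open>carrier_vec n\<close> carrying a matrix representation.\<close>

subsection \<open>Representations\<close>

definition Aut_vs :: "('k::field \<Rightarrow> 'v::ab_group_add \<Rightarrow> 'v) \<Rightarrow> ('v \<Rightarrow> 'v) monoid" where
  "Aut_vs scale =
     \<lparr>carrier = {f. Vector_Spaces.linear scale scale f \<and> bij f}, monoid.mult = (\<circ>), one = id\<rparr>"

definition linear_rep ::
  "('g, 'b) monoid_scheme \<Rightarrow> ('k::field \<Rightarrow> 'v::ab_group_add \<Rightarrow> 'v) \<Rightarrow> ('g \<Rightarrow> 'v \<Rightarrow> 'v) \<Rightarrow> bool" where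
  "linear_rep G scale \<rho> \<longleftrightarrow> \<rho> \<in> hom G (Aut_vs scale)"

abbreviation GL :: "nat \<Rightarrow> 'k::field mat monoid" where
  "GL n \<equiv> units_of (ring_mat TYPE('k) n ())"

definition matrix_rep ::
  "('g, 'b) monoid_scheme \<Rightarrow> nat \<Rightarrow> ('g \<Rightarrow> 'k::field mat) \<Rightarrow> bool" where
  "matrix_rep G n M \<longleftrightarrow> M \<in> hom G (GL n)"

text \<open>Isomorphism of \<open>(V, \<rho>)\<close> with the module \<open>T\<close> on which \<open>g\<close> acts by \<open>\<tau> g\<close>.\<close>

definition rep_isomorphic ::
  "('g, 'b) monoid_scheme \<Rightarrow> ('k::field \<Rightarrow> 'v::ab_group_add \<Rightarrow> 'v) \<Rightarrow> ('g \<Rightarrow> 'v \<Rightarrow> 'v) \<Rightarrow>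
   ('k, 'w, 'c) module_scheme \<Rightarrow> ('g \<Rightarrow> 'w \<Rightarrow> 'w) \<Rightarrow> bool" where
  "rep_isomorphic G scale \<rho> T \<tau> \<longleftrightarrow>
     (\<exists>\<phi>. bij_betw \<phi> UNIV (carrier T) \<and>
          (\<forall>v w. \<phi> (v + w) = \<phi> v \<oplus>\<^bsub>T\<^esub> \<phi> w) \<and>
          (\<forall>c v. \<phi> (scale c v) = c \<odot>\<^bsub>T\<^esub> \<phi> v) \<and>
          (\<forall>g\<in>carrier G. \<forall>v. \<phi> (\<rho> g v) = \<tau> g (\<phi> v)))"

definition affords_matrix_rep ::
  "('g, 'b) monoid_scheme \<Rightarrow> ('k::field \<Rightarrow> 'v::ab_group_add \<Rightarrow> 'v) \<Rightarrow> ('g \<Rightarrow> 'v \<Rightarrow> 'v) \<Rightarrow>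
   nat \<Rightarrow> ('g \<Rightarrow> 'k mat) \<Rightarrow> bool" where
  "affords_matrix_rep G scale \<rho> n M \<longleftrightarrow>
     matrix_rep G n M \<and>
     rep_isomorphic G scale \<rho> (module_vec TYPE('k) n) (\<lambda>g u. M g *\<^sub>v u)"

subsection \<open>Very simple modules\<close>

definition subalgebra_End ::
  "('k::field \<Rightarrow> 'v::ab_group_add \<Rightarrow> 'v) \<Rightarrow> ('v \<Rightarrow> 'v) set \<Rightarrow> bool" where
  "subalgebra_End scale R \<longleftrightarrow>
     R \<subseteq> {f. Vector_Spaces.linear scale scale f} \<and> id \<in> R \<and>
     (\<forall>f\<in>R. \<forall>h\<in>R. (\<lambda>v. f v + h v) \<in> R) \<and>
     (\<forall>c. \<forall>f\<in>R. (\<lambda>v. scale c (f v)) \<in> R) \<and>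
     (\<forall>f\<in>R. \<forall>h\<in>R. f \<circ> h \<in> R)"

definition normal_subalgebra ::
  "('g, 'b) monoid_scheme \<Rightarrow> ('k::field \<Rightarrow> 'v::ab_group_add \<Rightarrow> 'v) \<Rightarrow> ('g \<Rightarrow> 'v \<Rightarrow> 'v) \<Rightarrow>
   ('v \<Rightarrow> 'v) set \<Rightarrow> bool" where
  "normal_subalgebra G scale \<rho> R \<longleftrightarrow>
     subalgebra_End scale R \<and>
     (\<forall>s\<in>carrier G. \<forall>f\<in>R. \<rho> s \<circ> f \<circ> inv\<^bsub>Aut_vs scale\<^esub> (\<rho> s) \<in> R)"

text \<open>\<open>range scale\<close> is the algebra of scalar operators.\<close>

definition very_simple ::
  "('g, 'b) monoid_scheme \<Rightarrow> ('k::field \<Rightarrow> 'v::ab_group_add \<Rightarrow> 'v) \<Rightarrow> ('g \<Rightarrow> 'v \<Rightarrow> 'v) \<Rightarrow> bool" where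
  "very_simple G scale \<rho> \<longleftrightarrow>
     (\<forall>R. normal_subalgebra G scale \<rho> R \<longrightarrow>
          R = range scale \<or> R = {f. Vector_Spaces.linear scale scale f})"

subsection \<open>Absolute simplicity\<close>

definition invariant_subspace ::
  "('g, 'b) monoid_scheme \<Rightarrow> nat \<Rightarrow> ('g \<Rightarrow> 'k::field mat) \<Rightarrow> 'k vec set \<Rightarrow> bool" where
  "invariant_subspace G n M U \<longleftrightarrow>
     U \<subseteq> carrier_vec n \<and> 0\<^sub>v n \<in> U \<and>
     (\<forall>u\<in>U. \<forall>w\<in>U. u + w \<in> U) \<and>
     (\<forall>c. \<forall>u\<in>U. c \<cdot>\<^sub>v u \<in> U) \<and>
     (\<forall>g\<in>carrier G. \<forall>u\<in>U. M g *\<^sub>v u \<in> U)"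

definition irreducible_rep ::
  "('g, 'b) monoid_scheme \<Rightarrow> nat \<Rightarrow> ('g \<Rightarrow> 'k::field mat) \<Rightarrow> bool" where
  "irreducible_rep G n M \<longleftrightarrow>
     n > 0 \<and> (\<forall>U. invariant_subspace G n M U \<longrightarrow> U = {0\<^sub>v n} \<or> U = carrier_vec n)"

text \<open>Extension of scalars to the algebraic closure reads the matrix entries in the larger field.\<close>

definition absolutely_irreducible_rep ::
  "('g, 'b) monoid_scheme \<Rightarrow> nat \<Rightarrow> ('g \<Rightarrow> 'k::field mat) \<Rightarrow> bool" where
  "absolutely_irreducible_rep G n M \<longleftrightarrow> irreducible_rep G n (\<lambda>g. map_mat to_ac (M g))"

text \<open>Choosing another basis of \<open>V\<close> conjugates \<open>M\<close> and does not affect absolute irreducibility.\<close>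

definition absolutely_simple ::
  "('g, 'b) monoid_scheme \<Rightarrow> ('k::field \<Rightarrow> 'v::ab_group_add \<Rightarrow> 'v) \<Rightarrow> ('g \<Rightarrow> 'v \<Rightarrow> 'v) \<Rightarrow> bool" where
  "absolutely_simple G scale \<rho> \<longleftrightarrow>
     (\<exists>n M. affords_matrix_rep G scale \<rho> n M \<and> absolutely_irreducible_rep G n M)"

subsection \<open>Splittings\<close>

text \<open>The Kronecker product \<open>A \<otimes> B\<close> is the matrix of the tensor product of the operators \<open>A\<close> and
  \<open>B\<close>, with \<open>e\<^sub>i \<otimes> e\<^sub>j\<close> at position \<open>i * m + j\<close> where \<open>m\<close> is the size of \<open>B\<close>.\<close>

definition kronecker :: "'k::field mat \<Rightarrow> 'k mat \<Rightarrow> 'k mat" where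
  "kronecker A B =
     mat (dim_row A * dim_row B) (dim_col A * dim_col B)
       (\<lambda>(i, j). A $$ (i div dim_row B, j div dim_col B) * B $$ (i mod dim_row B, j mod dim_col B))"

definition central_extension ::
  "('x, 'a) monoid_scheme \<Rightarrow> ('g, 'b) monoid_scheme \<Rightarrow> ('x \<Rightarrow> 'g) \<Rightarrow> bool" where
  "central_extension E G \<pi> \<longleftrightarrow>
     group E \<and> \<pi> \<in> epi E G \<and>
     (\<forall>c\<in>kernel E G \<pi>. \<forall>x\<in>carrier E. c \<otimes>\<^bsub>E\<^esub> x = x \<otimes>\<^bsub>E\<^esub> c)"

definition splitting ::
  "('g, 'b) monoid_scheme \<Rightarrow> ('k::field \<Rightarrow> 'v::ab_group_add \<Rightarrow> 'v) \<Rightarrow> ('g \<Rightarrow> 'v \<Rightarrow> 'v) \<Rightarrow>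
   ('x, 'a) monoid_scheme \<Rightarrow> ('x \<Rightarrow> 'g) \<Rightarrow>
   nat \<Rightarrow> ('x \<Rightarrow> 'k mat) \<Rightarrow> nat \<Rightarrow> ('x \<Rightarrow> 'k mat) \<Rightarrow> bool" where
  "splitting G scale \<rho> E \<pi> n1 \<rho>1 n2 \<rho>2 \<longleftrightarrow>
     central_extension E G \<pi> \<and>
     n1 > 1 \<and> n2 > 1 \<and> matrix_rep E n1 \<rho>1 \<and> matrix_rep E n2 \<rho>2 \<and>
     affords_matrix_rep E scale (\<rho> \<circ> \<pi>) (n1 * n2) (\<lambda>x. kronecker (\<rho>1 x) (\<rho>2 x))"

definition projective_splitting ::
  "('g, 'b) monoid_scheme \<Rightarrow> ('k::field \<Rightarrow> 'v::ab_group_add \<Rightarrow> 'v) \<Rightarrow> ('g \<Rightarrow> 'v \<Rightarrow> 'v) \<Rightarrow>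
   ('x, 'a) monoid_scheme \<Rightarrow> ('x \<Rightarrow> 'g) \<Rightarrow>
   nat \<Rightarrow> ('x \<Rightarrow> 'k mat) \<Rightarrow> nat \<Rightarrow> ('x \<Rightarrow> 'k mat) \<Rightarrow> bool" where
  "projective_splitting G scale \<rho> E \<pi> n1 \<rho>1 n2 \<rho>2 \<longleftrightarrow>
     splitting G scale \<rho> E \<pi> n1 \<rho>1 n2 \<rho>2 \<and>
     (\<forall>c\<in>kernel E G \<pi>. (\<exists>a. \<rho>1 c = a \<cdot>\<^sub>m 1\<^sub>m n1) \<and> (\<exists>a. \<rho>2 c = a \<cdot>\<^sub>m 1\<^sub>m n2))"

definition absolutely_simple_splitting ::
  "('g, 'b) monoid_scheme \<Rightarrow> ('k::field \<Rightarrow> 'v::ab_group_add \<Rightarrow> 'v) \<Rightarrow> ('g \<Rightarrow> 'v \<Rightarrow> 'v) \<Rightarrow>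
   ('x, 'a) monoid_scheme \<Rightarrow> ('x \<Rightarrow> 'g) \<Rightarrow>
   nat \<Rightarrow> ('x \<Rightarrow> 'k mat) \<Rightarrow> nat \<Rightarrow> ('x \<Rightarrow> 'k mat) \<Rightarrow> bool" where
  "absolutely_simple_splitting G scale \<rho> E \<pi> n1 \<rho>1 n2 \<rho>2 \<longleftrightarrow>
     splitting G scale \<rho> E \<pi> n1 \<rho>1 n2 \<rho>2 \<and>
     absolutely_irreducible_rep E n1 \<rho>1 \<and> absolutely_irreducible_rep E n2 \<rho>2"

text \<open>HOL cannot quantify over the type of \<open>E\<close>.  The type chosen here loses nothing: the lemma
  \<open>admits_splittingI\<close> below shows that a splitting over a group \<open>E\<close> of any type, with the required
  properties, yields one over its image in \<open>G \<times> GL n1 \<times> GL n2\<close>.\<close>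

definition admits_projective_absolutely_simple_splitting ::
  "('g, 'b) monoid_scheme \<Rightarrow> ('k::field \<Rightarrow> 'v::ab_group_add \<Rightarrow> 'v) \<Rightarrow> ('g \<Rightarrow> 'v \<Rightarrow> 'v) \<Rightarrow> bool" where
  "admits_projective_absolutely_simple_splitting G scale \<rho> \<longleftrightarrow>
     (\<exists>(E :: ('g \<times> 'k mat \<times> 'k mat) monoid) \<pi> n1 \<rho>1 n2 \<rho>2.
        projective_splitting G scale \<rho> E \<pi> n1 \<rho>1 n2 \<rho>2 \<and>
        absolutely_simple_splitting G scale \<rho> E \<pi> n1 \<rho>1 n2 \<rho>2)"

lemma group_GL: "group (GL n :: 'k::field mat monoid)"
proof -
  interpret ring "ring_mat TYPE('k) n ()" by (rule ring_mat)
  show ?thesis by (rule units_group)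
qed

lemma absolutely_irreducible_rep_image:
  assumes "absolutely_irreducible_rep E n M"
    and "\<And>x. x \<in> carrier E \<Longrightarrow> \<exists>y\<in>carrier Y. M' y = M x"
  shows "absolutely_irreducible_rep Y n M'"
proof -
  have "invariant_subspace E n (\<lambda>x. map_mat to_ac (M x)) U"
    if "invariant_subspace Y n (\<lambda>y. map_mat to_ac (M' y)) U" for U
    using that assms(2) unfolding invariant_subspace_def by metis
  then show ?thesis
    using assms(1) unfolding absolutely_irreducible_rep_def irreducible_rep_def by blast
qed

lemma admits_splittingI:
  fixes E :: "('x, 'a) monoid_scheme" and G :: "('g, 'b) monoid_scheme"
    and \<rho>1 \<rho>2 :: "'x \<Rightarrow> 'k::field mat"
  assumes G: "group G"
    and proj: "projective_splitting G scale \<rho> E \<pi> n1 \<rho>1 n2 \<rho>2"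
    and abs: "absolutely_simple_splitting G scale \<rho> E \<pi> n1 \<rho>1 n2 \<rho>2"
  shows "admits_projective_absolutely_simple_splitting G scale \<rho>"
proof -
  define e where "e x = (\<pi> x, \<rho>1 x, \<rho>2 x)" for x
  define P where "P = G \<times>\<times> ((GL n1 :: 'k mat monoid) \<times>\<times> (GL n2 :: 'k mat monoid))"
  define Y where "Y = P\<lparr>carrier := e ` carrier E\<rparr>"
  have split: "splitting G scale \<rho> E \<pi> n1 \<rho>1 n2 \<rho>2"
    using abs by (simp add: absolutely_simple_splitting_def)
  then have E: "group E" and epi: "\<pi> \<in> epi E G"
    and cent: "\<And>c x. c \<in> kernel E G \<pi> \<Longrightarrow> x \<in> carrier E \<Longrightarrow> c \<otimes>\<^bsub>E\<^esub> x = x \<otimes>\<^bsub>E\<^esub> c"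
    and n: "n1 > 1" "n2 > 1" and r: "\<rho>1 \<in> hom E (GL n1)" "\<rho>2 \<in> hom E (GL n2)"
    and aff: "affords_matrix_rep E scale (\<rho> \<circ> \<pi>) (n1 * n2) (\<lambda>x. kronecker (\<rho>1 x) (\<rho>2 x))"
    by (auto simp: splitting_def central_extension_def matrix_rep_def)
  have pi: "\<pi> \<in> hom E G" and surj: "\<pi> ` carrier E = carrier G"
    using epi by (auto simp: epi_def)
  have P: "group P"
    unfolding P_def by (intro DirProd_group G group_GL)
  have e: "e \<in> hom E P"
    using pi r by (auto simp: e_def P_def hom_def DirProd_def)
  have sub: "subgroup (e ` carrier E) P"
    using e E P by (simp add: group_hom.img_is_subgroup group_hom_def group_hom_axioms_def)
  have Y: "group Y"
    unfolding Y_def using sub P by (rule subgroup.subgroup_is_group)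
  have multY: "e x \<otimes>\<^bsub>Y\<^esub> e y = e (x \<otimes>\<^bsub>E\<^esub> y)" if "x \<in> carrier E" "y \<in> carrier E" for x y
    using e that by (simp add: Y_def hom_mult)
  have carY: "carrier Y = e ` carrier E" by (simp add: Y_def)
  have homY: "f \<in> hom Y H" if "f \<circ> e \<in> hom E H" for f and H :: "('h, 'i) monoid_scheme"
    using that multY carY by (auto simp: hom_def Pi_iff)
  have p0: "fst \<in> hom Y G"
    by (rule homY) (use pi in \<open>simp add: e_def comp_def\<close>)
  have p1: "fst \<circ> snd \<in> hom Y (GL n1)"
    by (rule homY) (use r in \<open>simp add: e_def comp_def\<close>)
  have p2: "snd \<circ> snd \<in> hom Y (GL n2)"
    by (rule homY) (use r in \<open>simp add: e_def comp_def\<close>)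
  have ker: "\<exists>x \<in> kernel E G \<pi>. c = e x" if "c \<in> kernel Y G fst" for c
    using that by (auto simp: kernel_def carY e_def)
  have ext: "central_extension Y G fst"
    unfolding central_extension_def
  proof (intro conjI ballI Y)
    show "fst \<in> epi Y G"
      using p0 surj by (auto simp: epi_def carY e_def image_image)
  next
    fix c y assume "c \<in> kernel Y G fst" "y \<in> carrier Y"
    then obtain x z where xz: "x \<in> kernel E G \<pi>" "c = e x" "z \<in> carrier E" "y = e z"
      using ker carY by blast
    then show "c \<otimes>\<^bsub>Y\<^esub> y = y \<otimes>\<^bsub>Y\<^esub> c"
      using cent[of x z] by (simp add: multY kernel_def)
  qed
  have K: "(\<lambda>x. kronecker (\<rho>1 x) (\<rho>2 x)) \<in> hom E (GL (n1 * n2))"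
    using aff by (simp add: affords_matrix_rep_def matrix_rep_def)
  have "(\<lambda>y. kronecker ((fst \<circ> snd) y) ((snd \<circ> snd) y)) \<in> hom Y (GL (n1 * n2))"
    by (rule homY) (use K in \<open>simp add: e_def comp_def\<close>)
  moreover have "rep_isomorphic Y scale (\<rho> \<circ> fst) (module_vec TYPE('k) (n1 * n2))
      (\<lambda>y u. kronecker ((fst \<circ> snd) y) ((snd \<circ> snd) y) *\<^sub>v u)"
    using aff unfolding affords_matrix_rep_def rep_isomorphic_def carY by (auto simp: e_def)
  ultimately have sY: "splitting G scale \<rho> Y fst n1 (fst \<circ> snd) n2 (snd \<circ> snd)"
    using ext n p1 p2
    by (simp add: splitting_def affords_matrix_rep_def matrix_rep_def)
  have "\<forall>c\<in>kernel Y G fst.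
      (\<exists>a. (fst \<circ> snd) c = a \<cdot>\<^sub>m 1\<^sub>m n1) \<and> (\<exists>a. (snd \<circ> snd) c = a \<cdot>\<^sub>m 1\<^sub>m n2)"
    using ker proj by (fastforce simp: projective_splitting_def e_def)
  then have "projective_splitting G scale \<rho> Y fst n1 (fst \<circ> snd) n2 (snd \<circ> snd)"
    using sY by (simp add: projective_splitting_def)
  moreover have "absolutely_irreducible_rep Y n1 (fst \<circ> snd)"
    by (rule absolutely_irreducible_rep_image[of E n1 \<rho>1])
      (use abs in \<open>auto simp: absolutely_simple_splitting_def carY e_def\<close>)
  moreover have "absolutely_irreducible_rep Y n2 (snd \<circ> snd)"
    by (rule absolutely_irreducible_rep_image[of E n2 \<rho>2])
      (use abs in \<open>auto simp: absolutely_simple_splitting_def carY e_def\<close>)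
  ultimately show ?thesis
    unfolding admits_projective_absolutely_simple_splitting_def absolutely_simple_splitting_def
    using sY by blast
qed

subsection \<open>Induced modules\<close>

text \<open>The function model of the induced module: maps \<open>f : G \<rightarrow> W\<close> with
  \<open>f (g h) = h\<^sup>-\<^sup>1 f(g)\<close> for \<open>h \<in> H\<close>, where \<open>s\<close> acts by \<open>(s f)(g) = f (s\<^sup>-\<^sup>1 g)\<close>.  For \<open>H\<close> of
  finite index it is isomorphic to \<open>k[G] \<otimes> W\<close> over \<open>k[H]\<close>; for infinite index one would have to
  require finite support modulo \<open>H\<close>.\<close>

definition induced_module ::
  "('g, 'b) monoid_scheme \<Rightarrow> 'g set \<Rightarrow> nat \<Rightarrow> ('g \<Rightarrow> 'k::field mat) \<Rightarrow> ('k, 'g \<Rightarrow> 'k vec) module" where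
  "induced_module G H d \<sigma> =
     \<lparr>carrier = {f \<in> carrier G \<rightarrow>\<^sub>E carrier_vec d.
                   \<forall>g\<in>carrier G. \<forall>h\<in>H. f (g \<otimes>\<^bsub>G\<^esub> h) = \<sigma> (inv\<^bsub>G\<^esub> h) *\<^sub>v f g},
      monoid.mult = undefined,
      one = undefined,
      zero = (\<lambda>g\<in>carrier G. 0\<^sub>v d),
      add = (\<lambda>f1 f2. \<lambda>g\<in>carrier G. f1 g + f2 g),
      module.smult = (\<lambda>c f. \<lambda>g\<in>carrier G. c \<cdot>\<^sub>v f g)\<rparr>"

definition induced_action ::
  "('g, 'b) monoid_scheme \<Rightarrow> 'g \<Rightarrow> ('g \<Rightarrow> 'w) \<Rightarrow> ('g \<Rightarrow> 'w)" where
  "induced_action G s f = (\<lambda>g\<in>carrier G. f (inv\<^bsub>G\<^esub> s \<otimes>\<^bsub>G\<^esub> g))"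

text \<open>\<open>card (rcosets H) > 1\<close> includes that the index is finite, as \<open>card\<close> of an infinite set
  is \<open>0\<close>.\<close>

definition induced_from_proper_finite_index ::
  "('g, 'b) monoid_scheme \<Rightarrow> ('k::field \<Rightarrow> 'v::ab_group_add \<Rightarrow> 'v) \<Rightarrow> ('g \<Rightarrow> 'v \<Rightarrow> 'v) \<Rightarrow> bool" where
  "induced_from_proper_finite_index G scale \<rho> \<longleftrightarrow>
     (\<exists>H d (\<sigma> :: 'g \<Rightarrow> 'k mat).
        subgroup H G \<and> card (rcosets\<^bsub>G\<^esub> H) > 1 \<and>
        matrix_rep (G\<lparr>carrier := H\<rparr>) d \<sigma> \<and>
        rep_isomorphic G scale \<rho> (induced_module G H d \<sigma>) (induced_action G))"

end

theory Submission
  imports Defs "HOL-Algebra.Group_Action" "HOL-Algebra.Multiplicative_Group"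
    "HOL-Computational_Algebra.Fundamental_Theorem_Algebra"
    "HOL-Computational_Algebra.Polynomial_Factorial" "Jordan_Normal_Form.Char_Poly"
begin

text \<open>If \<open>V\<close> is very simple, a failing condition would produce a forbidden normal subalgebra: the
  operators whose matrices preserve an invariant subspace over the algebraic closure, the commutant
  of the operators \<open>1 \<otimes> B\<close>, or the multiplications by functions on the cosets of the inducing subgroup.

  Conversely, let \<open>R\<close> be a normal subalgebra and \<open>C\<close> its commutant.  The translates of a minimal
  stable subspace span the simple module \<open>V\<close>, so subspaces stable under a conjugation-stable set of
  operators have stable projections.  An idempotent of minimal rank in a commutative normal subalgebra
  is either equal or orthogonal to each of its conjugates; as \<open>V\<close> is not induced, such an idempotent is
  trivial.  Applied to \<open>C\<close> intersected with its own commutant, this shows that \<open>V\<close> is simple over \<open>R\<close>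
  and \<open>C\<close> together, hence that \<open>R\<close> acts faithfully on a simple submodule \<open>W\<close>.  The division algebra of
  endomorphisms of \<open>W\<close> is \<open>k\<close>: over an algebraically closed field because of eigenvectors; over a
  finite field because it is commutative by Wedderburn's theorem, so that by density it comes from the
  centre of \<open>R\<close>, a finite field, on which the perfect group acts trivially through its cyclic
  automorphism group.  By density \<open>R\<close> is a matrix algebra, and by Skolem--Noether each \<open>\<rho> s\<close> is a product of
  an element of \<open>R\<close> and an element of \<open>C\<close>.  This is a splitting unless \<open>R\<close> is \<open>k\<close> or \<open>End V\<close>.\<close>

section \<open>Wedderburn's little theorem\<close>

text \<open>\<open>G\<close> may be infinite and the characteristic of \<open>k\<close> is
  arbitrary, so no averaging over the group is available; complements and projections have to come
  from the simplicity of \<open>V\<close>. Such a projection commutes with the chosen operators but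
  in general not with \<open>G\<close>. Its conjugates form a system of imprimitivity only if they
  are pairwise equal or orthogonal, which is what commutativity and minimal rank achieve. Over a
  finite field the endomorphisms of \<open>W\<close> could be a larger field, with \<open>G\<close>
  acting on the centre of \<open>R\<close> by Galois automorphisms; since these commute, perfectness
  makes the action trivial. The two factors of \<open>\<rho> s\<close> are determined only up to
  inverse scalars, and no choice of them need be multiplicative in \<open>s\<close>. All choices are
  therefore kept: the central extension consists of the triples of \<open>s\<close> with an
  admissible pair of invertible matrices, and its kernel consists of pairs of scalar matrices.
  Absolute irreducibility of the two factors is inherited from their tensor product.\<close>

lemma map_poly_of_int_mult:
  "map_poly (of_int :: int \<Rightarrow> complex) (p * q) = map_poly of_int p * map_poly of_int q"
  by (rule poly_eqI) (simp add: coeff_map_poly coeff_mult)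

text \<open>The ring of integer polynomials is factorial and evaluation at \<open>z\<close> is
  multiplicative, so one prime factor of \<open>p\<close> vanishes at \<open>z\<close>. The
  factorisation reproduces \<open>p\<close> only up to a unit, hence the two divisibilities in
  \<open>dvd\<close>.\<close>

lemma prime_factor_with_root:
  fixes p :: "int poly" and z :: complex
  assumes "p \<noteq> 0" and "poly (map_poly of_int p) z = 0"
  obtains f where "prime_elem f" "f dvd p" "poly (map_poly of_int f) z = 0"
proof -
  have "\<exists>f \<in># A. poly (map_poly of_int f) z = 0"
    if "poly (map_poly of_int (prod_mset A)) z = 0" for A :: "int poly multiset"
    using that by (induction A) (auto simp: map_poly_of_int_mult)
  moreover obtain A where A: "\<And>x. x \<in># A \<Longrightarrow> prime x" "normalize (prod_mset A) = normalize p"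
    using prime_factorization_exists'[OF assms(1)] by blast
  moreover from A(2) have dvd: "p dvd prod_mset A" "prod_mset A dvd p"
    by (simp_all add: associated_iff_dvd)
  from dvd(1) have "poly (map_poly of_int (prod_mset A)) z = 0"
    using assms(2) by (auto simp: map_poly_of_int_mult elim!: dvdE)
  ultimately obtain f where "f \<in># A" "poly (map_poly of_int f) z = 0" by blast
  then show ?thesis
    using that[of f] A(1)[of f] dvd(2) dvd_prod_mset[of f A] dvd_trans by (auto simp: prime_def)
qed

lemma poly_map_poly_monom_minus_one:
  "poly (map_poly (of_int :: int \<Rightarrow> complex) (monom 1 d - 1)) z = z ^ d - 1"
proof -
  have "map_poly (of_int :: int \<Rightarrow> complex) (monom 1 d - 1) = monom 1 d - 1"
    by (rule poly_eqI) (simp add: coeff_map_poly)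
  then show ?thesis by (simp add: poly_monom)
qed

text \<open>Every factor exceeds \<open>c \<ge> 1\<close>, so one factor already passes the bound
  and the others can only enlarge the product.\<close>

lemma prod_mset_gt:
  fixes A :: "real multiset"
  assumes "A \<noteq> {#}" "\<And>x. x \<in># A \<Longrightarrow> x > c" "c \<ge> 1"
  shows "prod_mset A > c"
  using assms
proof (induction A)
  case (add x A)
  show ?case
  proof (cases "A = {#}")
    case False
    then have "c < prod_mset A" using add by auto
    then have "c * 1 < x * prod_mset A"
      using add.prems(2)[of x] add.prems(3) by (intro mult_strict_mono) auto
    then show ?thesis by simp
  qed (use add in auto)
qed simp

text \<open>Among the points of the unit circle only 1 has real part 1, and the distance to
  \<open>q\<close> is at least the difference of the real parts. This makes the bound
  strict.\<close>

lemma norm_diff_root_of_unity: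
  fixes x :: complex
  assumes "norm x = 1" "x \<noteq> 1"
  shows "norm (of_real q - x) > q - 1"
proof -
  have "Re x < 1"
  proof (rule ccontr)
    assume "\<not> Re x < 1"
    then have "Re x = 1" using complex_Re_le_cmod[of x] assms(1) by simp
    then show False using assms by (auto simp: cmod_def complex_eq_iff)
  qed
  moreover have "q - Re x \<le> norm (of_real q - x)"
    using complex_Re_le_cmod[of "of_real q - x"] by simp
  ultimately show ?thesis by simp
qed

text \<open>The divisor is the value at \<open>q\<close> of an irreducible factor of \<open>X\<^sup>n - 1\<close> that
  vanishes at a primitive \<open>n\<close>-th root of unity; it takes the place of the cyclotomic polynomial.\<close>

lemma large_common_divisor:
  fixes q :: int and n :: nat
  assumes q: "q \<ge> 2" and n: "n > 1"
  obtains N :: int where "N > q - 1" "N dvd q ^ n - 1"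
    "\<And>d. 0 < d \<Longrightarrow> d < n \<Longrightarrow> d dvd n \<Longrightarrow> N * (q ^ d - 1) dvd q ^ n - 1"
proof -
  define p :: "int poly" where "p = monom 1 n - 1"
  define z where "z = cis (2 * pi / n)"
  \<comment> \<open>\<open>z\<close> is a primitive \<open>n\<close>-th root of unity: a power equal
    to 1 would make \<open>n\<close> divide the exponent.\<close>
  have zd: "z ^ d \<noteq> 1" if "0 < d" "d < n" for d
  proof
    assume "z ^ d = 1"
    then have "cis (2 * pi * d / n) = 1" by (simp add: z_def DeMoivre field_simps)
    then have "cos (2 * pi * d / n) = 1" by (simp add: complex_eq_iff)
    then obtain m :: int where m: "2 * pi * d / n = m * 2 * pi"
      by (auto simp: cos_one_2pi_int)
    then have "real d = m * n" using n by (simp add: field_simps)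
    then have "int d = m * int n" by (metis of_int_eq_iff of_int_mult of_int_of_nat_eq)
    then have "n dvd d" by (metis dvd_triv_right int_dvd_int_iff)
    then show False using that by (auto dest: dvd_imp_le)
  qed
  have zn: "z ^ n = 1" using n by (simp add: z_def DeMoivre)
  have cp: "coeff p n = 1" using n by (simp add: p_def)
  have p0: "p \<noteq> 0" using cp by auto
  have "degree p \<le> n" unfolding p_def by (rule degree_diff_le) (auto simp: degree_monom_le)
  with cp have degp: "degree p = n" by (intro antisym le_degree) auto
  obtain f where f: "prime_elem f" "f dvd p" "poly (map_poly of_int f) z = 0"
    using prime_factor_with_root[OF p0, of z] zn
    by (metis diff_self p_def poly_map_poly_monom_minus_one)
  have f0: "f \<noteq> 0" using f(2) p0 by auto
  have ndvd: "\<not> f dvd monom 1 d - 1" if "0 < d" "d < n" for d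
  proof
    assume "f dvd monom 1 d - 1"
    then have "poly (map_poly of_int (monom 1 d - 1)) z = 0"
      using f(3) by (auto simp: map_poly_of_int_mult elim!: dvdE)
    with zd[OF that] show False by (simp only: poly_map_poly_monom_minus_one) simp
  qed
  define P :: "complex poly" where "P = map_poly of_int f"
  have degP: "degree P = degree f" unfolding P_def by (rule degree_map_poly) simp_all
  have lcP: "lead_coeff P = of_int (lead_coeff f)"
    using degP by (simp add: P_def coeff_map_poly)
  have P0: "P \<noteq> 0" using f0 lcP by (metis leading_coeff_0_iff of_int_eq_0_iff)
  have roots: "norm x = 1 \<and> x \<noteq> 1" if "poly P x = 0" for x
  proof -
    have "poly (map_poly of_int p) x = 0"
      using f(2) that by (auto simp: map_poly_of_int_mult P_def elim!: dvdE)
    then have "x ^ n = 1" by (simp add: p_def poly_map_poly_monom_minus_one del: poly_diff)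
    then have "norm x ^ n = 1" by (metis norm_one norm_power)
    then have "norm x = 1" using n power_eq_1_iff[of "norm x" n] by simp
    \<comment> \<open>A root 1 would make the irreducible \<open>f\<close> associated to X - 1,
      which is \<open>monom 1 1 - 1\<close>; this contradicts \<open>ndvd\<close> for
      \<open>d = 1\<close>, as \<open>n > 1\<close>.\<close>
    moreover have "x \<noteq> 1"
    proof
      assume "x = 1"
      then have "poly P (of_int 1) = 0" using that by simp
      moreover have "poly P (of_int a) = of_int (poly f a)" for a
        by (simp add: P_def poly_altdef coeff_map_poly degP[unfolded P_def])
      ultimately have "poly f 1 = 0" by (metis of_int_eq_0_iff)
      then have "[:-1, 1:] dvd f" by (simp add: poly_eq_0_iff_dvd)
      then obtain g where g: "f = [:-1, 1:] * g" by (elim dvdE)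
      have "is_unit g \<or> is_unit [:-1, 1::int:]"
        using prime_elem_imp_irreducible[OF f(1)] g by (auto simp: irreducible_def)
      moreover have "\<not> is_unit [:-1, 1::int:]"
        by (simp add: is_unit_poly_iff)
      ultimately have "is_unit g" by simp
      then have "f dvd [:-1, 1:]" using g by (metis dvd_refl mult_unit_dvd_iff)
      moreover have "[:-1, 1:] = monom 1 1 - (1 :: int poly)"
        by (simp add: monom_altdef one_pCons)
      ultimately show False using ndvd[of 1] n by simp
    qed
    ultimately show ?thesis by simp
  qed
  \<comment> \<open>Since \<open>p\<close> is monic, the leading coefficient of \<open>f\<close> is
    1 or -1. The absolute value of \<open>f\<close> at \<open>q\<close> is then exactly the product
    of the distances from \<open>q\<close> to the roots, each larger than
    \<open>q - 1\<close>.\<close>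
  have "is_unit (lead_coeff f)"
  proof -
    obtain g where "p = f * g" using f(2) by (elim dvdE)
    then have "lead_coeff f * lead_coeff g = 1" using cp degp by (metis lead_coeff_mult)
    then show ?thesis by (metis dvd_triv_left)
  qed
  then have lc: "\<bar>lead_coeff f\<bar> = 1" by simp
  obtain A where A: "size A = degree P" "P = smult (lead_coeff P) (\<Prod>x\<in>#A. [:-x, 1:])"
    using alg_closed_imp_factorization[OF P0] by blast
  have "A \<noteq> {#}"
  proof
    assume "A = {#}"
    then have "P = [:lead_coeff P:]" using A(2) by simp
    then have "poly P z = lead_coeff P" by (metis poly_pCons poly_0 mult_zero_right add.right_neutral)
    then show False using f(3) P0 by (simp add: P_def)
  qed
  have evP: "poly P y = lead_coeff P * (\<Prod>x\<in>#A. y - x)" for y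
  proof -
    have "poly (\<Prod>x\<in>#A. [:-x, 1:]) y = (\<Prod>x\<in>#A. y - x)"
      by (induction A) (auto simp: algebra_simps)
    then show ?thesis by (subst A(2)) simp
  qed
  have "norm (poly P (of_int q)) = (\<Prod>x\<in>#A. norm (of_int q - x))"
  proof -
    have "norm (\<Prod>x\<in>#A. y - x) = (\<Prod>x\<in>#A. norm (y - x))" for y :: complex
      by (induction A) (auto simp: norm_mult)
    then show ?thesis using lc unfolding evP by (simp add: norm_mult lcP flip: of_int_abs)
  qed
  also have "\<dots> > real_of_int (q - 1)"
  proof (rule prod_mset_gt)
    fix x assume "x \<in># {#norm (of_int q - x). x \<in># A#}"
    then obtain a where a: "a \<in># A" "x = norm (of_int q - a)" by auto
    have "poly P a = 0" using a(1) unfolding evP by (auto simp: image_iff)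
    then show "x > real_of_int (q - 1)"
      using norm_diff_root_of_unity[of a "of_int q"] roots[of a] a(2) by simp
  qed (use q \<open>A \<noteq> {#}\<close> in auto)
  finally have "real_of_int (q - 1) < norm (poly P (of_int q))" .
  also have "poly P (of_int q) = of_int (poly f q)"
    by (simp add: P_def poly_altdef coeff_map_poly degP[unfolded P_def])
  finally have big: "q - 1 < \<bar>poly f q\<bar>" by (simp flip: of_int_abs)
  have ev: "poly (monom 1 d - 1) q = q ^ d - 1" for d :: nat by (simp add: poly_monom)
  show ?thesis
  proof (rule that[of "\<bar>poly f q\<bar>"])
    show "\<bar>poly f q\<bar> dvd q ^ n - 1"
      using f(2) unfolding p_def ev[symmetric] by (auto elim!: dvdE simp del: poly_diff)
    fix d assume d: "0 < d" "d < n" "d dvd n"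
    then obtain m where m: "n = d * m" by (elim dvdE)
    have "(monom 1 d - 1 :: int poly) dvd (monom 1 d) ^ m - 1"
      using power_diff_1_eq[of "monom 1 d :: int poly" m] by simp
    then have "monom 1 d - 1 dvd p" by (simp add: p_def m monom_power mult.commute)
    then obtain g where g: "p = (monom 1 d - 1) * g" by (elim dvdE)
    \<comment> \<open>\<open>f\<close> is prime and divides \<open>p\<close> but not
      \<open>monom 1 d - 1\<close>, so it divides the cofactor; evaluation at \<open>q\<close> turns
      this into divisibility of integers.\<close>
    then have "f dvd g"
      using f(1,2) ndvd[OF d(1,2)] by (metis prime_elem_dvd_mult_iff)
    then have "(monom 1 d - 1) * f dvd p" unfolding g by (rule mult_dvd_mono[OF dvd_refl])
    then have "poly ((monom 1 d - 1) * f) q dvd poly p q" by (auto elim!: dvdE)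
    then have "poly f q * (q ^ d - 1) dvd q ^ n - 1"
      unfolding p_def ev poly_mult by (simp only: mult.commute)
    then show "\<bar>poly f q\<bar> * (q ^ d - 1) dvd q ^ n - 1"
      by (cases "poly f q \<ge> 0") simp_all
  qed (use big in simp)
qed

section \<open>Counting over finite division rings\<close>

text \<open>\<open>M\<close> is a left vector space over the division ring \<open>K\<close>. No
  basis is chosen: among the submodules whose size is a power of \<open>card K\<close> one of
  largest size is taken, and a vector outside it would give one that is larger by the factor
  \<open>card K\<close>.\<close>

lemma (in ring) card_division_module:
  assumes fin: "finite (carrier R)"
    and K: "subring K R" "\<And>k. k \<in> K \<Longrightarrow> k \<noteq> \<zero> \<Longrightarrow> \<exists>l\<in>K. l \<otimes> k = \<one>" "\<one> \<noteq> \<zero>"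
    and M: "additive_subgroup M R" "\<And>k m. k \<in> K \<Longrightarrow> m \<in> M \<Longrightarrow> k \<otimes> m \<in> M"
  shows "\<exists>d. card M = card K ^ d"
proof -
  interpret M: additive_subgroup M R by (rule M(1))
  have Mc: "M \<subseteq> carrier R" by (rule M.a_subset)
  have finM: "finite M" using Mc fin by (rule finite_subset)
  have Kc: "K \<subseteq> carrier R" by (rule subringE(1)[OF K(1)])
  have finK: "finite K" using Kc fin by (rule finite_subset)
  have K01: "\<zero> \<in> K" "\<one> \<in> K" using subringE(2,3)[OF K(1)] by auto
  have q: "card K \<ge> 2"
  proof -
    have "card {\<zero>, \<one>} \<le> card K" using K01 finK by (intro card_mono) auto
    then show ?thesis using K(3) by simp
  qed
  define S where "S = {N. N \<subseteq> M \<and> \<zero> \<in> N \<and> (\<forall>x\<in>N. \<forall>y\<in>N. x \<oplus> y \<in> N) \<and>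
      (\<forall>k\<in>K. \<forall>x\<in>N. k \<otimes> x \<in> N) \<and> (\<exists>d. card N = card K ^ d)}"
  have "{\<zero>} \<in> S" using Kc by (auto simp: S_def intro!: exI[of _ 0])
  moreover have "finite S" by (rule finite_subset[of _ "Pow M"]) (auto simp: S_def finM)
  ultimately have "\<exists>N\<in>S. \<forall>N'\<in>S. card N' \<le> card N"
    using Max_in[of "card ` S"] Max_ge[of "card ` S"] by fastforce
  then obtain N where N: "N \<in> S" and mx: "\<And>N'. N' \<in> S \<Longrightarrow> card N' \<le> card N" by blast
  obtain d where d: "card N = card K ^ d" using N by (auto simp: S_def)
  have NM: "N \<subseteq> M" and N0: "\<zero> \<in> N" and Nadd: "\<And>x y. x \<in> N \<Longrightarrow> y \<in> N \<Longrightarrow> x \<oplus> y \<in> N"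
    and Nsm: "\<And>k x. k \<in> K \<Longrightarrow> x \<in> N \<Longrightarrow> k \<otimes> x \<in> N"
    using N by (auto simp: S_def)
  have Nc: "N \<subseteq> carrier R" using NM Mc by blast
  have m1K: "\<ominus> \<one> \<in> K" using subringE(5)[OF K(1)] K01 by auto
  have Nneg: "\<ominus> x \<in> N" if "x \<in> N" for x
    using Nsm[OF m1K that] that Nc by (auto simp: l_minus)
  have "N = M"
  proof (rule ccontr)
    assume "N \<noteq> M"
    then obtain x where x: "x \<in> M" "x \<notin> N" using NM by blast
    have xc: "x \<in> carrier R" using x Mc by blast
    define h where "h = (\<lambda>(k, y). k \<otimes> x \<oplus> y)"
    define N' where "N' = h ` (K \<times> N)"
    \<comment> \<open>If two representations had different coefficients of \<open>x\<close>,
      multiplying by a left inverse of their difference would express \<open>x\<close> by elements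
      of \<open>N\<close>.\<close>
    have inj: "inj_on h (K \<times> N)"
    proof (rule inj_onI, clarify)
      fix k y k' y'
      assume *: "k \<in> K" "y \<in> N" "k' \<in> K" "y' \<in> N" "h (k, y) = h (k', y')"
      have c: "k \<in> carrier R" "y \<in> carrier R" "k' \<in> carrier R" "y' \<in> carrier R"
        using * Kc Nc by auto
      have eq: "k \<otimes> x \<oplus> y = k' \<otimes> x \<oplus> y'" using * by (simp add: h_def)
      have "(k \<ominus> k') \<otimes> x = k \<otimes> x \<oplus> y \<ominus> y \<ominus> k' \<otimes> x"
        using c xc by algebra
      also have "\<dots> = y' \<oplus> \<ominus> y" unfolding eq using c xc by algebra
      finally have e: "(k \<ominus> k') \<otimes> x = y' \<oplus> \<ominus> y" .
      have "k \<ominus> k' = \<zero>"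
      proof (rule ccontr)
        assume nz: "k \<ominus> k' \<noteq> \<zero>"
        have "k \<ominus> k' \<in> K" using * subringE(5,7)[OF K(1)] by (auto simp: a_minus_def)
        then obtain l where l: "l \<in> K" "l \<otimes> (k \<ominus> k') = \<one>" using K(2) nz by blast
        have "x = l \<otimes> (k \<ominus> k') \<otimes> x" using l(2) xc by simp
        also have "\<dots> = l \<otimes> (y' \<oplus> \<ominus> y)"
          using e l(1) c xc Kc m_assoc[of l "k \<ominus> k'" x] by auto
        also have "\<dots> \<in> N" using l(1) * by (intro Nsm Nadd Nneg)
        finally show False using x by simp
      qed
      then have "k = k'" using c by (metis r_right_minus_eq)
      moreover from this have "y = y'" using eq c xc by (metis add.l_cancel m_closed)
      ultimately show "k = k' \<and> y = y'" by simp
    qed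
    have "card N' = card K ^ Suc d"
      unfolding N'_def card_image[OF inj] by (simp add: card_cartesian_product d)
    moreover have "N' \<in> S"
      unfolding S_def
    proof (intro CollectI conjI ballI)
      show "N' \<subseteq> M" using M x NM by (auto simp: N'_def h_def intro!: M.a_closed)
      show "\<zero> \<in> N'" unfolding N'_def h_def using K01(1) N0 xc by (force intro!: image_eqI[of _ _ "(\<zero>, \<zero>)"])
      show "\<exists>d. card N' = card K ^ d" using \<open>card N' = card K ^ Suc d\<close> by blast
    next
      fix u v assume "u \<in> N'" "v \<in> N'"
      then obtain k y k' y' where *: "k \<in> K" "y \<in> N" "k' \<in> K" "y' \<in> N"
        "u = k \<otimes> x \<oplus> y" "v = k' \<otimes> x \<oplus> y'" by (auto simp: N'_def h_def)
      have c: "k \<in> carrier R" "y \<in> carrier R" "k' \<in> carrier R" "y' \<in> carrier R"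
        using * Kc Nc by auto
      have "u \<oplus> v = h (k \<oplus> k', y \<oplus> y')"
        unfolding *(5,6) h_def using c xc by simp algebra
      then show "u \<oplus> v \<in> N'"
        unfolding N'_def using * subringE(7)[OF K(1)] Nadd by blast
    next
      fix l u assume "l \<in> K" "u \<in> N'"
      then obtain k y where *: "l \<in> K" "k \<in> K" "y \<in> N" "u = k \<otimes> x \<oplus> y"
        by (auto simp: N'_def h_def)
      have c: "k \<in> carrier R" "y \<in> carrier R" "l \<in> carrier R" using * Kc Nc by auto
      have "l \<otimes> u = h (l \<otimes> k, l \<otimes> y)"
        unfolding *(4) h_def using c xc by simp algebra
      then show "l \<otimes> u \<in> N'"
        unfolding N'_def using * subringE(6)[OF K(1)] Nsm by blast
    qed
    ultimately have "card K ^ Suc d \<le> card K ^ d" using mx d by metis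
    then show False using q by simp
  qed
  then show ?thesis using d by blast
qed

text \<open>One step of Euclid's algorithm in the exponents: modulo \<open>q ^ d - 1\<close>, the
  number \<open>q ^ n - 1\<close> is congruent to \<open>q ^ (n - d) - 1\<close>.\<close>

lemma power_minus_one_dvd_imp_dvd:
  fixes q :: nat
  assumes "q \<ge> 2" "q ^ d - 1 dvd q ^ n - 1"
  shows "d dvd n"
  using assms(2)
proof (induction n rule: less_induct)
  case (less n)
  show ?case
  proof (cases "n < d")
    case True
    then have "q ^ n - 1 < q ^ d - 1"
      using assms(1) by (intro diff_less_mono power_strict_increasing) auto
    then have "q ^ n - 1 = 0" using less.prems by (auto dest: dvd_imp_le)
    then have "n = 0" using assms(1) one_less_power[of q n] by (cases "n = 0") auto
    then show ?thesis by simp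
  next
    case False
    show ?thesis
    proof (cases "d = 0")
      case True
      \<comment> \<open>For \<open>d = 0\<close> the divisor is 0, which divides only 0, so
        \<open>n = 0\<close>.\<close>
      then have "q ^ n - 1 = 0" using less.prems by simp
      then show ?thesis using assms(1) one_less_power[of q n] by (cases "n = 0") auto
    next
      case d: False
      have "q ^ n - 1 = q ^ (n - d) * (q ^ d - 1) + (q ^ (n - d) - 1)"
      proof -
        have "q ^ n = q ^ (n - d) * q ^ d" using False by (simp flip: power_add)
        moreover have "q ^ (n - d) \<ge> 1" "q ^ d \<ge> 1" using assms(1) by simp_all
        moreover from this(2) have "q ^ (n - d) * 1 \<le> q ^ (n - d) * q ^ d" by (rule mult_le_mono2)
        ultimately show ?thesis by (simp add: diff_mult_distrib2)
      qed
      then have "q ^ d - 1 dvd q ^ (n - d) - 1"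
        using less.prems by (simp only: dvd_add_right_iff[OF dvd_triv_right])
      then have "d dvd n - d" using less.IH[of "n - d"] d False by simp
      then show ?thesis using False by (simp add: dvd_minus_self)
    qed
  qed
qed

text \<open>Witt's proof, through the class equation.\<close>

theorem (in ring) finite_division_ring_commutative:
  assumes fin: "finite (carrier R)"
    and units: "Units R = carrier R - {\<zero>}"
    and xy: "x \<in> carrier R" "y \<in> carrier R"
  shows "x \<otimes> y = y \<otimes> x"
proof -
  define Cz where "Cz = (\<lambda>a. {b \<in> carrier R. a \<otimes> b = b \<otimes> a})"
  define Z where "Z = {b \<in> carrier R. \<forall>a\<in>carrier R. a \<otimes> b = b \<otimes> a}"
  have one: "\<one> \<noteq> \<zero>" using units Units_one_closed by auto
  have inv_comm: "a \<otimes> inv b = inv b \<otimes> a"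
    if "a \<in> carrier R" "b \<in> carrier R" "b \<noteq> \<zero>" "a \<otimes> b = b \<otimes> a" for a b
  proof -
    have b: "b \<in> Units R" using that units by auto
    have "a \<otimes> inv b = inv b \<otimes> (b \<otimes> a) \<otimes> inv b"
      using b that by (metis Units_closed Units_inv_closed Units_l_inv l_one m_assoc)
    also have "\<dots> = inv b \<otimes> a"
      using b that by (metis Units_closed Units_inv_closed Units_r_inv r_one m_assoc m_closed)
    finally show ?thesis .
  qed
  have mult_comm: "a \<otimes> (b \<otimes> c) = (b \<otimes> c) \<otimes> a"
    if "a \<in> carrier R" "b \<in> carrier R" "c \<in> carrier R" "a \<otimes> b = b \<otimes> a" "a \<otimes> c = c \<otimes> a"
    for a b c
    using that by (metis m_assoc)
  have subC: "subring (Cz a) R" if "a \<in> carrier R" for a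
    by (rule subringI) (use that in \<open>auto simp: Cz_def l_minus r_minus l_distr r_distr mult_comm\<close>)
  have Z_iff: "b \<in> Z \<longleftrightarrow> b \<in> carrier R \<and> (\<forall>a\<in>carrier R. b \<in> Cz a)" for b
    unfolding Z_def Cz_def by blast
  have subZ: "subring Z R"
    by (rule subringI) (auto simp: Z_iff intro: subringE(3,5,6,7)[OF subC])
  have invZ: "\<exists>l\<in>Z. l \<otimes> b = \<one>" if "b \<in> Z" "b \<noteq> \<zero>" for b
  proof
    have bR: "b \<in> carrier R" using that by (simp add: Z_iff)
    then have bU: "b \<in> Units R" using that units by simp
    have "a \<otimes> inv b = inv b \<otimes> a" if "a \<in> carrier R" for a
      using inv_comm[OF that bR \<open>b \<noteq> \<zero>\<close>] \<open>b \<in> Z\<close> that unfolding Z_def by blast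
    then show "inv b \<in> Z" using Units_inv_closed[OF bU] unfolding Z_def by blast
    show "inv b \<otimes> b = \<one>" by (rule Units_l_inv[OF bU])
  qed
  define q where "q = card Z"
  have Zc: "Z \<subseteq> carrier R" by (auto simp: Z_iff)
  have finZ: "finite Z" using Zc fin by (rule finite_subset)
  have q2: "q \<ge> 2"
  proof -
    have "card {\<zero>, \<one>} \<le> card Z" using finZ subringE(2,3)[OF subZ] by (intro card_mono) auto
    then show ?thesis using one by (simp add: q_def)
  qed
  have addsub: "additive_subgroup K R" if "subring K R" for K
    using that by (simp add: subring_def additive_subgroup_def)
  have "\<exists>n. card (carrier R) = q ^ n"
    unfolding q_def
  proof (rule card_division_module[OF fin subZ invZ one addsub])
    show "subring (carrier R) R" by (rule carrier_is_subring)
  qed (auto simp: Z_iff)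
  then obtain n where n: "card (carrier R) = q ^ n" by blast
  have dim: "\<exists>d. card (Cz a) = q ^ d" if a: "a \<in> carrier R" for a
    unfolding q_def
  proof (rule card_division_module[OF fin subZ invZ one addsub[OF subC[OF a]]])
    fix k m assume "k \<in> Z" "m \<in> Cz a"
    moreover have "Z \<subseteq> Cz a" using a by (auto simp: Z_iff)
    ultimately show "k \<otimes> m \<in> Cz a" using subringE(6)[OF subC[OF a]] by blast
  qed auto
  show ?thesis
  proof (cases "n > 1")
    case False
    then have "card (carrier R) \<le> card Z"
      using n q2 by (cases "n = 0") (auto simp: q_def not_less le_Suc_eq)
    then have "Z = carrier R" using Zc fin by (metis card_seteq)
    then show ?thesis using xy unfolding Z_def by blast
  next
    case True
    define G where "G = units_of R"
    interpret G: group G unfolding G_def by (rule units_group)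
    have cG: "carrier G = carrier R - {\<zero>}" by (simp add: G_def units_of_def units)
    have mG: "a \<otimes>\<^bsub>G\<^esub> b = a \<otimes> b" for a b by (simp add: G_def units_of_def)
    define \<phi> where "\<phi> = (\<lambda>g. \<lambda>h \<in> carrier G. g \<otimes>\<^bsub>G\<^esub> h \<otimes>\<^bsub>G\<^esub> inv\<^bsub>G\<^esub> g)"
    interpret act: group_action G "carrier G" \<phi>
      unfolding \<phi>_def by (rule G.action_by_conjugation)
    have finG: "finite (carrier G)" using fin by (simp add: cG)
    have ordG: "Coset.order G = q ^ n - 1" using fin by (simp add: Coset.order_def cG n)
    have comm: "\<phi> g a = a \<longleftrightarrow> g \<otimes> a = a \<otimes> g" if "g \<in> carrier G" "a \<in> carrier G" for g a
    proof -
      have "\<phi> g a = a \<longleftrightarrow> g \<otimes>\<^bsub>G\<^esub> a = a \<otimes>\<^bsub>G\<^esub> g"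
        using that unfolding \<phi>_def by (simp add: G.inv_solve_right' ) 
      then show ?thesis by (simp add: mG)
    qed
    have stab: "card (stabilizer G \<phi> a) = card (Cz a) - 1" if "a \<in> carrier G" for a
    proof -
      have "stabilizer G \<phi> a = Cz a - {\<zero>}"
        using that comm by (auto simp: stabilizer_def Cz_def cG)
      moreover have "\<zero> \<in> Cz a" "finite (Cz a)" using that fin by (auto simp: Cz_def cG)
      ultimately show ?thesis by simp
    qed
    obtain N :: int where N: "N > int q - 1" "N dvd int q ^ n - 1"
      and Nd: "\<And>d. 0 < d \<Longrightarrow> d < n \<Longrightarrow> d dvd n \<Longrightarrow> N * (int q ^ d - 1) dvd int q ^ n - 1"
      using large_common_divisor[of "int q" n] q2 True by auto
    \<comment> \<open>The stabiliser of \<open>a\<close> is its centraliser without 0, of size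
      \<open>q ^ d - 1\<close> with \<open>d\<close> a proper divisor of \<open>n\<close>. The orbit
      size is the quotient of \<open>q ^ n - 1\<close> by this number, and \<open>N\<close> still
      divides the quotient.\<close>
    have noncentral: "N dvd int (card (orbit G \<phi> a))" if a: "a \<in> carrier G" "a \<notin> Z" for a
    proof -
      have aR: "a \<in> carrier R" using a by (simp add: cG)
      obtain d where d: "card (Cz a) = q ^ d" using dim[OF aR] by blast
      have os: "card (orbit G \<phi> a) * (q ^ d - 1) = q ^ n - 1"
        using act.orbit_stabilizer_theorem[OF a(1)] by (simp add: stab[OF a(1)] d ordG)
      then have "q ^ d - 1 dvd q ^ n - 1" by (metis dvd_triv_right)
      then have dn: "d dvd n" by (rule power_minus_one_dvd_imp_dvd[OF q2])
      have "Cz a \<subset> carrier R" using a aR unfolding Cz_def Z_def by force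
      then have "q ^ d < q ^ n" using fin unfolding d[symmetric] n[symmetric] by (rule psubset_card_mono[rotated])
      then have dn': "d < n" using q2 by simp
      have d0: "d > 0" using dn True by (metis dvd_0_left_iff gr0I not_one_less_zero)
      have e: "int (q ^ m - 1) = int q ^ m - 1" for m
        using q2 by (simp add: of_nat_diff)
      have "N * (int q ^ d - 1) dvd int (card (orbit G \<phi> a)) * (int q ^ d - 1)"
        using Nd[OF d0 dn' dn] os by (metis e of_nat_mult)
      moreover have "1 < int q ^ d" using q2 d0 by (intro one_less_power) auto
      ultimately show ?thesis by simp
    qed
    \<comment> \<open>\<open>f\<close> counts the noncentral elements. On a conjugacy class it sums
      to 0 if the class is central and to the size of the class otherwise, so \<open>N\<close>
      divides every partial sum.\<close>
    define f where "f = (\<lambda>a. if a \<in> Z then 0 else 1 :: int)"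
    have "N dvd (\<Sum>orb\<in>orbits G (carrier G) \<phi>. \<Sum>a\<in>orb. f a)"
    proof (rule dvd_sum)
      fix orb assume "orb \<in> orbits G (carrier G) \<phi>"
      then obtain a where a: "a \<in> carrier G" "orb = orbit G \<phi> a" by (auto simp: orbits_def)
      show "N dvd (\<Sum>b\<in>orb. f b)"
      proof (cases "a \<in> Z")
        case True
        have "orb = {a}"
        proof -
          have "\<phi> g a = a" if "g \<in> carrier G" for g
            using comm[OF that a(1)] True that by (simp add: Z_def cG)
          then show ?thesis unfolding a(2) orbit_def using G.one_closed by force
        qed
        then show ?thesis using True by (simp add: f_def)
      next
        case False
        have "b \<notin> Z" if borb: "b \<in> orb" for b
        proof
          assume bZ: "b \<in> Z"
          obtain g0 where "g0 \<in> carrier G" "b = \<phi> g0 a"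
            using borb by (auto simp: a(2) orbit_def)
          then have bG: "b \<in> carrier G" using act.element_image[OF _ a(1), of g0 b] by simp
          have "a \<in> orbit G \<phi> b"
            using act.orbit_sym[OF a(1) bG] borb unfolding a(2) by blast
          then obtain g where g: "g \<in> carrier G" "\<phi> g b = a" by (auto simp: orbit_def)
          have "\<phi> g b = b" using comm[OF g(1) bG] g(1) bZ by (simp add: Z_def cG)
          then show False using g bZ False by simp
        qed
        then have "(\<Sum>b\<in>orb. f b) = (\<Sum>b\<in>orb. 1)" by (intro sum.cong) (auto simp: f_def)
        then show ?thesis using noncentral[OF a(1) False] a(2) by simp
      qed
    qed
    also have "(\<Sum>orb\<in>orbits G (carrier G) \<phi>. \<Sum>a\<in>orb. f a) = (\<Sum>a\<in>carrier G. f a)"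
      by (rule act.disjoint_sum[OF finG])
    also have "\<dots> = (\<Sum>a\<in>carrier R - Z. 1)"
    proof (rule sum.mono_neutral_cong_right[OF finG])
      show "carrier R - Z \<subseteq> carrier G" using subringE(2)[OF subZ] by (auto simp: cG)
    qed (auto simp: f_def cG)
    also have "\<dots> = int q ^ n - int q"
    proof -
      have "card (carrier R - Z) = q ^ n - q"
        using card_Diff_subset[OF finZ Zc] n by (simp add: q_def)
      moreover have "q \<le> q ^ n" using q2 True by (simp add: self_le_power)
      ultimately show ?thesis by (simp add: of_nat_diff)
    qed
    \<comment> \<open>The noncentral elements number \<open>q ^ n - q\<close>, so \<open>N\<close>
      divides the difference \<open>q - 1\<close>, although it is larger.\<close>
    finally have "N dvd (int q ^ n - 1) - (int q ^ n - int q)" using N(2) by (rule dvd_diff[rotated])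
    then have "N dvd int q - 1" by simp
    then have "N \<le> int q - 1" using q2 by (intro zdvd_imp_le) auto
    then show ?thesis using N by simp
  qed
qed

section \<open>Matrices and coordinates\<close>

text \<open>The truncations \<open>t k\<close> of \<open>x\<close> to its first \<open>k\<close>
  coordinates assemble \<open>x\<close> by adding one multiple of a unit vector at a time, so the
  additivity of \<open>h\<close> for two vectors suffices for an induction.\<close>

lemma linear_map_as_matrix:
  fixes h :: "'k::field vec \<Rightarrow> 'k vec"
  assumes h: "\<And>x. x \<in> carrier_vec n \<Longrightarrow> h x \<in> carrier_vec m"
    and add: "\<And>x y. x \<in> carrier_vec n \<Longrightarrow> y \<in> carrier_vec n \<Longrightarrow> h (x + y) = h x + h y"
    and smult: "\<And>c x. x \<in> carrier_vec n \<Longrightarrow> h (c \<cdot>\<^sub>v x) = c \<cdot>\<^sub>v h x"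
  shows "\<exists>A\<in>carrier_mat m n. \<forall>x\<in>carrier_vec n. h x = A *\<^sub>v x"
proof
  let ?A = "mat m n (\<lambda>(i, j). h (unit_vec n j) $ i)"
  show "?A \<in> carrier_mat m n" by simp
  show "\<forall>x\<in>carrier_vec n. h x = ?A *\<^sub>v x"
  proof
    fix x :: "'k vec" assume x: "x \<in> carrier_vec n"
    define t where "t = (\<lambda>k. vec n (\<lambda>j. if j < k then x $ j else 0))"
    have tc: "t k \<in> carrier_vec n" for k by (simp add: t_def)
    have "h (t k) = vec m (\<lambda>i. \<Sum>j<k. h (unit_vec n j) $ i * x $ j)" if "k \<le> n" for k
      using that
    proof (induction k)
      case 0
      have "t 0 = 0 \<cdot>\<^sub>v t 0" by (rule eq_vecI) (auto simp: t_def)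
      then have "h (t 0) = 0 \<cdot>\<^sub>v h (t 0)" using smult[OF tc] by metis
      then show ?case using h[OF tc[of 0]] by (intro eq_vecI) (auto simp del: index_smult_vec(1), metis index_smult_vec(1) mult_zero_left carrier_vecD)
    next
      case (Suc k)
      have "t (Suc k) = t k + x $ k \<cdot>\<^sub>v unit_vec n k"
        using Suc.prems by (intro eq_vecI) (auto simp: t_def unit_vec_def less_Suc_eq)
      then have "h (t (Suc k)) = h (t k) + x $ k \<cdot>\<^sub>v h (unit_vec n k)"
        using add[OF tc, of "x $ k \<cdot>\<^sub>v unit_vec n k"] smult[of "unit_vec n k"] by simp
      then show ?case using Suc h[of "unit_vec n k"]
        by (intro eq_vecI) (auto simp: mult.commute)
    qed
    from this[of n] have "h (t n) = vec m (\<lambda>i. \<Sum>j<n. h (unit_vec n j) $ i * x $ j)" by simp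
    moreover have "t n = x" using x by (intro eq_vecI) (auto simp: t_def)
    ultimately show "h x = ?A *\<^sub>v x"
      using x by (intro eq_vecI) (auto simp: scalar_prod_def lessThan_atLeast0)
  qed
qed

lemma mat_eq_if_mult_vec_eq:
  fixes A B :: "'k::field mat"
  assumes "A \<in> carrier_mat m n" "B \<in> carrier_mat m n"
    and eq: "\<And>x. x \<in> carrier_vec n \<Longrightarrow> A *\<^sub>v x = B *\<^sub>v x"
  shows "A = B"
proof (rule eq_matI)
  fix i j assume ij: "i < dim_row B" "j < dim_col B"
  have "(A *\<^sub>v unit_vec n j) $ i = (B *\<^sub>v unit_vec n j) $ i"
    using eq[of "unit_vec n j"] by simp
  then show "A $$ (i, j) = B $$ (i, j)" using ij assms(1,2) by (simp add: scalar_prod_right_unit)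
qed (use assms in auto)

lemma smult_one_mult_vec:
  fixes x :: "'k::field vec"
  assumes "x \<in> carrier_vec n"
  shows "(c \<cdot>\<^sub>m 1\<^sub>m n) *\<^sub>v x = c \<cdot>\<^sub>v x"
proof (rule eq_vecI)
  fix i assume "i < dim_vec (c \<cdot>\<^sub>v x)"
  then show "((c \<cdot>\<^sub>m 1\<^sub>m n) *\<^sub>v x) $ i = (c \<cdot>\<^sub>v x) $ i"
    using assms by (simp add: row_smult smult_scalar_prod_distrib[of _ n])
qed (use assms in simp)

section \<open>Invertible matrices and matrix representations\<close>

text \<open>A right inverse of a square matrix over a field is also a left inverse, so one equation
  decides membership.\<close>

lemma carrier_GL:
  "A \<in> carrier (GL n) \<longleftrightarrow> A \<in> carrier_mat n n \<and> (\<exists>B\<in>carrier_mat n n. A * B = 1\<^sub>m n)"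
  unfolding units_of_def Units_def ring_mat_simps
  by (auto dest: mat_mult_left_right_inverse)

lemma mult_GL: "monoid.mult (GL n) = (*)"
  by (simp add: units_of_def ring_mat_simps)

lemma matrix_rep_mult:
  assumes "matrix_rep K n M" "x \<in> carrier K" "y \<in> carrier K"
  shows "M (x \<otimes>\<^bsub>K\<^esub> y) = M x * M y"
  using assms by (auto simp: matrix_rep_def hom_def mult_GL)

lemma matrix_rep_carrier:
  assumes "matrix_rep K n M" "x \<in> carrier K"
  shows "M x \<in> carrier_mat n n"
  using assms by (auto simp: matrix_rep_def hom_def Pi_iff carrier_GL)

lemma matrix_rep_one:
  assumes "group K" "matrix_rep K n M"
  shows "M \<one>\<^bsub>K\<^esub> = 1\<^sub>m n"
proof -
  interpret h: group_hom K "GL n" M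
    using assms by (simp add: group_hom_def group_hom_axioms_def group_GL matrix_rep_def)
  show ?thesis using h.hom_one by (simp add: units_of_def ring_mat_simps)
qed

text \<open>Invertibility comes from the group: \<open>M (inv x)\<close> is the inverse of
  \<open>M x\<close>.\<close>

lemma matrix_repI:
  fixes K (structure) and M :: "_ \<Rightarrow> 'k::field mat"
  assumes K: "group K" and car: "\<And>x. x \<in> carrier K \<Longrightarrow> M x \<in> carrier_mat n n"
    and mult: "\<And>x y. x \<in> carrier K \<Longrightarrow> y \<in> carrier K \<Longrightarrow> M (x \<otimes> y) = M x * M y"
    and one: "M \<one> = 1\<^sub>m n"
  shows "matrix_rep K n M"
proof -
  interpret group K by (rule K)
  have "M x \<in> carrier (GL n)" if "x \<in> carrier K" for x
    using car mult[of x "inv x"] that one by (auto simp: carrier_GL intro!: bexI[of _ "M (inv x)"])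
  then show ?thesis using mult by (auto simp: matrix_rep_def hom_def mult_GL)
qed

section \<open>Operators and coordinates on an abstract vector space\<close>

locale linear_space = vector_space scale
  for scale :: "'k::field \<Rightarrow> 'v::ab_group_add \<Rightarrow> 'v"
begin

abbreviation endo :: "('v \<Rightarrow> 'v) \<Rightarrow> bool" where
  "endo f \<equiv> Vector_Spaces.linear scale scale f"

lemma endo_iff: "endo f \<longleftrightarrow> (\<forall>x y. f (x + y) = f x + f y) \<and> (\<forall>c x. f (scale c x) = scale c (f x))"
  using vector_space_axioms by (simp add: Vector_Spaces.linear_iff)

lemma endo_addD: "endo f \<Longrightarrow> f (x + y) = f x + f y"
  and endo_scaleD: "endo f \<Longrightarrow> f (scale c x) = scale c (f x)"
  by (simp_all add: endo_iff)

lemma endo_zero: "endo f \<Longrightarrow> f 0 = 0"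
  using endo_scaleD[of f 0 0] by simp

lemma endo_neg: "endo f \<Longrightarrow> f (- x) = - f x"
  using endo_scaleD[of f "-1" x] by simp

lemma endo_diff: "endo f \<Longrightarrow> f (x - y) = f x - f y"
  by (metis ab_group_add_class.ab_diff_conv_add_uminus endo_addD endo_neg)

lemma endo_sum: "endo f \<Longrightarrow> f (sum g A) = (\<Sum>a\<in>A. f (g a))"
  by (induction A rule: infinite_finite_induct) (auto simp: endo_zero endo_addD)

lemma endo_id: "endo id" and endo_comp: "endo f \<Longrightarrow> endo g \<Longrightarrow> endo (f \<circ> g)"
  and endo_plus: "endo f \<Longrightarrow> endo g \<Longrightarrow> endo (\<lambda>v. f v + g v)"
  and endo_smult: "endo f \<Longrightarrow> endo (\<lambda>v. scale c (f v))"
  and endo_scale: "endo (scale c)" and endo_0: "endo (\<lambda>v. 0)"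
  by (simp_all add: endo_iff scale_right_distrib mult.commute)

lemma subalgebra_endo: "subalgebra_End scale R \<Longrightarrow> f \<in> R \<Longrightarrow> endo f"
  and subalgebra_id: "subalgebra_End scale R \<Longrightarrow> (\<lambda>v. v) \<in> R"
  and subalgebra_add: "subalgebra_End scale R \<Longrightarrow> f \<in> R \<Longrightarrow> g \<in> R \<Longrightarrow> (\<lambda>v. f v + g v) \<in> R"
  and subalgebra_scale: "subalgebra_End scale R \<Longrightarrow> f \<in> R \<Longrightarrow> (\<lambda>v. scale c (f v)) \<in> R"
  and subalgebra_mult: "subalgebra_End scale R \<Longrightarrow> f \<in> R \<Longrightarrow> g \<in> R \<Longrightarrow> (\<lambda>v. f (g v)) \<in> R"
  by (auto simp: subalgebra_End_def comp_def id_def)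

lemma subalgebra_zero: "subalgebra_End scale R \<Longrightarrow> (\<lambda>v. 0) \<in> R"
  using subalgebra_scale[OF _ subalgebra_id, of R 0] by simp

lemma subalgebra_sum:
  "subalgebra_End scale R \<Longrightarrow> (\<And>i. i \<in> I \<Longrightarrow> r i \<in> R) \<Longrightarrow> (\<lambda>v. \<Sum>i\<in>I. r i v) \<in> R"
  by (induction I rule: infinite_finite_induct) (auto simp: subalgebra_zero intro: subalgebra_add)

text \<open>A linear isomorphism of the subspace \<open>U\<close> with a coordinate space,
  unconstrained outside \<open>U\<close>. For \<open>U = UNIV\<close> these are the linear
  conditions that \<open>rep_isomorphic\<close> imposes when the target is
  \<open>module_vec\<close>.\<close>

definition coords :: "'v set \<Rightarrow> nat \<Rightarrow> ('v \<Rightarrow> 'k vec) \<Rightarrow> bool" where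
  "coords U n \<phi> \<longleftrightarrow> subspace U \<and> bij_betw \<phi> U (carrier_vec n) \<and>
     (\<forall>u\<in>U. \<forall>w\<in>U. \<phi> (u + w) = \<phi> u + \<phi> w) \<and> (\<forall>c. \<forall>u\<in>U. \<phi> (scale c u) = c \<cdot>\<^sub>v \<phi> u)"

lemma coords_add: "coords U n \<phi> \<Longrightarrow> u \<in> U \<Longrightarrow> w \<in> U \<Longrightarrow> \<phi> (u + w) = \<phi> u + \<phi> w"
  and coords_scale: "coords U n \<phi> \<Longrightarrow> u \<in> U \<Longrightarrow> \<phi> (scale c u) = c \<cdot>\<^sub>v \<phi> u"
  and coords_closed: "coords U n \<phi> \<Longrightarrow> u \<in> U \<Longrightarrow> \<phi> u \<in> carrier_vec n"
  and coords_inj: "coords U n \<phi> \<Longrightarrow> u \<in> U \<Longrightarrow> w \<in> U \<Longrightarrow> \<phi> u = \<phi> w \<Longrightarrow> u = w"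
  by (auto simp: coords_def bij_betw_def inj_on_def)

lemma coords_subspace: "coords U n \<phi> \<Longrightarrow> subspace U"
  by (simp add: coords_def)

lemma coords_zero: "coords U n \<phi> \<Longrightarrow> \<phi> 0 = 0\<^sub>v n"
proof -
  assume c: "coords U n \<phi>"
  then have 0: "0 \<in> U" by (simp add: coords_def subspace_0)
  have "\<phi> 0 = 0 \<cdot>\<^sub>v \<phi> 0" using coords_scale[OF c 0, of 0] by simp
  then show ?thesis using coords_closed[OF c 0] by (metis carrier_vecD eq_vecI index_smult_vec(1,2) index_zero_vec mult_zero_left)
qed

definition uncoords :: "'v set \<Rightarrow> ('v \<Rightarrow> 'k vec) \<Rightarrow> 'k vec \<Rightarrow> 'v" where
  "uncoords U \<phi> = inv_into U \<phi>"

lemma uncoords: 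
  assumes "coords U n \<phi>" "x \<in> carrier_vec n"
  shows "uncoords U \<phi> x \<in> U" "\<phi> (uncoords U \<phi> x) = x"
  using assms by (auto simp: uncoords_def coords_def bij_betw_def inv_into_into f_inv_into_f)

lemma uncoords_coords: "coords U n \<phi> \<Longrightarrow> u \<in> U \<Longrightarrow> uncoords U \<phi> (\<phi> u) = u"
  by (auto simp: uncoords_def coords_def bij_betw_def)

lemma uncoords_add:
  assumes c: "coords U n \<phi>" and x: "x \<in> carrier_vec n" "y \<in> carrier_vec n"
  shows "uncoords U \<phi> (x + y) = uncoords U \<phi> x + uncoords U \<phi> y"
  by (rule coords_inj[OF c])
    (use x in \<open>simp_all add: uncoords[OF c] coords_add[OF c] subspace_add[OF coords_subspace[OF c]]\<close>)

lemma uncoords_scale: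
  assumes c: "coords U n \<phi>" and x: "x \<in> carrier_vec n"
  shows "uncoords U \<phi> (a \<cdot>\<^sub>v x) = scale a (uncoords U \<phi> x)"
  by (rule coords_inj[OF c])
    (use x in \<open>simp_all add: uncoords[OF c] coords_scale[OF c] subspace_scale[OF coords_subspace[OF c]]\<close>)

lemma coords_mat_eqI:
  fixes A B :: "'k mat"
  assumes "coords U n \<phi>" "A \<in> carrier_mat m n" "B \<in> carrier_mat m n"
    and "\<And>u. u \<in> U \<Longrightarrow> A *\<^sub>v \<phi> u = B *\<^sub>v \<phi> u"
  shows "A = B"
  using assms uncoords[OF assms(1)] by (intro mat_eq_if_mult_vec_eq[OF assms(2,3)]) metis

lemma coords_UNIV_pos:
  assumes \<phi>: "coords UNIV n \<phi>" and nz: "\<exists>v :: 'v. v \<noteq> 0"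
  shows "n > 0"
proof (rule Nat.gr0I)
  assume "n = 0"
  have dim: "dim_vec (\<phi> v) = 0" for v
    using carrier_vecD[OF coords_closed[OF \<phi> UNIV_I]] unfolding \<open>n = 0\<close> .
  have "\<phi> v = \<phi> 0" for v by (rule eq_vecI) (simp_all add: dim)
  from coords_inj[OF \<phi> UNIV_I UNIV_I this] have "v = 0" for v :: 'v .
  then show False using nz by blast
qed

definition mat_op :: "('v \<Rightarrow> 'k vec) \<Rightarrow> 'k mat \<Rightarrow> 'v \<Rightarrow> 'v" where
  "mat_op \<phi> A v = uncoords UNIV \<phi> (A *\<^sub>v \<phi> v)"

lemma coords_mat_op:
  assumes \<phi>: "coords UNIV n \<phi>" and A: "A \<in> carrier_mat n n"
  shows "\<phi> (mat_op \<phi> A v) = A *\<^sub>v \<phi> v"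
  using uncoords(2)[OF \<phi> mult_mat_vec_carrier[OF A coords_closed[OF \<phi> UNIV_I]]] by (simp add: mat_op_def)

lemma mat_op_endo:
  assumes \<phi>: "coords UNIV n \<phi>" and A: "A \<in> carrier_mat n n"
  shows "endo (mat_op \<phi> A)"
proof -
  have \<phi>c: "\<phi> v \<in> carrier_vec n" for v using coords_closed[OF \<phi>] by simp
  show ?thesis
    unfolding endo_iff mat_op_def
    by (simp add: coords_add[OF \<phi>] coords_scale[OF \<phi>] mult_add_distrib_mat_vec[OF A \<phi>c \<phi>c]
        mult_mat_vec[OF A \<phi>c] uncoords_add[OF \<phi>] uncoords_scale[OF \<phi>] mult_mat_vec_carrier[OF A \<phi>c])
qed

lemma coords_matrix:
  assumes c: "coords U n \<phi>" and f: "endo f" and U: "\<And>u. u \<in> U \<Longrightarrow> f u \<in> U"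
  shows "\<exists>A\<in>carrier_mat n n. \<forall>u\<in>U. \<phi> (f u) = A *\<^sub>v \<phi> u"
proof -
  let ?h = "\<lambda>x. \<phi> (f (uncoords U \<phi> x))"
  have "\<exists>A\<in>carrier_mat n n. \<forall>x\<in>carrier_vec n. ?h x = A *\<^sub>v x"
    by (rule linear_map_as_matrix)
      (simp_all add: uncoords[OF c] coords_closed[OF c] U uncoords_add[OF c] uncoords_scale[OF c]
        coords_add[OF c] coords_scale[OF c] endo_addD[OF f] endo_scaleD[OF f])
  then obtain A where A: "A \<in> carrier_mat n n" "\<forall>x\<in>carrier_vec n. ?h x = A *\<^sub>v x" by blast
  have "\<phi> (f u) = A *\<^sub>v \<phi> u" if "u \<in> U" for u
    using A(2) coords_closed[OF c that] uncoords_coords[OF c that] by metis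
  then show ?thesis using A(1) by blast
qed

text \<open>The action has to be multiplicative on \<open>U\<close> only. The lemma thus serves both
  for the stabiliser of a block acting on that block and for \<open>\<rho>\<close> on the whole of
  \<open>V\<close>.\<close>

lemma coords_matrix_rep:
  fixes K (structure)
  assumes K: "group K" and c: "coords U n \<phi>"
    and lin: "\<And>x. x \<in> carrier K \<Longrightarrow> endo (\<tau> x)"
    and U: "\<And>x u. x \<in> carrier K \<Longrightarrow> u \<in> U \<Longrightarrow> \<tau> x u \<in> U"
    and mult: "\<And>x y u. x \<in> carrier K \<Longrightarrow> y \<in> carrier K \<Longrightarrow> u \<in> U \<Longrightarrow> \<tau> (x \<otimes> y) u = \<tau> x (\<tau> y u)"
    and one: "\<And>u. u \<in> U \<Longrightarrow> \<tau> \<one> u = u"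
  shows "\<exists>M. matrix_rep K n M \<and> (\<forall>x\<in>carrier K. \<forall>u\<in>U. \<phi> (\<tau> x u) = M x *\<^sub>v \<phi> u)"
proof -
  interpret group K by (rule K)
  have "\<forall>x\<in>carrier K. \<exists>A\<in>carrier_mat n n. \<forall>u\<in>U. \<phi> (\<tau> x u) = A *\<^sub>v \<phi> u"
    using coords_matrix[OF c] lin U by blast
  then obtain M where M: "\<And>x. x \<in> carrier K \<Longrightarrow> M x \<in> carrier_mat n n"
    "\<And>x u. x \<in> carrier K \<Longrightarrow> u \<in> U \<Longrightarrow> \<phi> (\<tau> x u) = M x *\<^sub>v \<phi> u" by metis
  have "matrix_rep K n M"
  proof (rule matrix_repI[OF K M(1)])
    fix x y assume xy: "x \<in> carrier K" "y \<in> carrier K"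
    show "M (x \<otimes> y) = M x * M y"
    proof (rule coords_mat_eqI[OF c, where m = n])
      fix u assume u: "u \<in> U"
      have "M (x \<otimes> y) *\<^sub>v \<phi> u = M x *\<^sub>v (M y *\<^sub>v \<phi> u)"
        using M(2)[of "x \<otimes> y" u] M(2)[of x "\<tau> y u"] M(2)[of y u] mult xy u U by simp
      then show "M (x \<otimes> y) *\<^sub>v \<phi> u = M x * M y *\<^sub>v \<phi> u"
        using M(1)[OF xy(1)] M(1)[OF xy(2)] coords_closed[OF c u] by simp
    qed (use M(1) xy in \<open>auto intro: mult_carrier_mat\<close>)
  next
    show "M \<one> = 1\<^sub>m n"
    proof (rule coords_mat_eqI[OF c, where m = n])
      fix u assume u: "u \<in> U"
      show "M \<one> *\<^sub>v \<phi> u = 1\<^sub>m n *\<^sub>v \<phi> u"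
        using M(2)[OF one_closed u] one[OF u] coords_closed[OF c u] by simp
    qed (use M(1) in auto)
  qed
  then show ?thesis using M(2) by blast
qed

end

locale fin_linear_space = linear_space scale + finite_dimensional_vector_space scale Basis
  for scale :: "'k::field \<Rightarrow> 'v::ab_group_add \<Rightarrow> 'v" and Basis
begin

lemma coords_exist:
  assumes U: "subspace U"
  shows "\<exists>\<phi>. coords U (dim U) \<phi>"
proof -
  obtain B where B: "B \<subseteq> U" "independent B" "U \<subseteq> span B" "card B = dim U"
    using basis_exists[of U] by blast
  have UB: "span B = U" using B U by (simp add: span_minimal subset_antisym)
  have finB: "finite B" using B(2) by (rule finiteI_independent)
  obtain b where b: "bij_betw b {..<dim U} B"
    using ex_bij_betw_nat_finite[OF finB] B(4) by (auto simp: lessThan_atLeast0)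
  define \<phi> where "\<phi> = (\<lambda>v. vec (dim U) (\<lambda>i. representation B v (b i)))"
  define \<psi> where "\<psi> = (\<lambda>x :: 'k vec. \<Sum>i<dim U. scale (x $ i) (b i))"
  have bB: "b i \<in> B" if "i < dim U" for i using b that by (auto simp: bij_betw_def)
  have \<psi>\<phi>: "\<psi> (\<phi> v) = v" if "v \<in> U" for v
  proof -
    have "\<psi> (\<phi> v) = (\<Sum>i<dim U. scale (representation B v (b i)) (b i))"
      by (simp add: \<psi>_def \<phi>_def)
    also have "\<dots> = (\<Sum>w\<in>B. scale (representation B v w) w)"
      by (rule sum.reindex_bij_betw[OF b])
    also have "\<dots> = v" by (rule sum_representation_eq) (use B UB finB that in auto)
    finally show ?thesis .
  qed
  have \<psi>U: "\<psi> x \<in> U" for x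
    unfolding \<psi>_def using bB B(1) U by (intro subspace_sum subspace_scale) auto
  have \<phi>\<psi>: "\<phi> (\<psi> x) = x" if x: "x \<in> carrier_vec (dim U)" for x
  proof -
    have "representation B (\<psi> x) (b i) = x $ i" if i: "i < dim U" for i
    proof -
      have "representation B (\<psi> x) (b i) = (\<Sum>j<dim U. x $ j * representation B (b j) (b i))"
        unfolding \<psi>_def
        by (subst representation_sum[OF B(2)]) (use bB in \<open>auto simp: span_base span_scale representation_scale[OF B(2)] intro!: sum.cong\<close>)
      also have "\<dots> = (\<Sum>j<dim U. if j = i then x $ j else 0)"
      proof (rule sum.cong[OF refl])
        fix j assume j: "j \<in> {..<dim U}"
        have "b j = b i \<longleftrightarrow> j = i" using b i j by (auto simp: bij_betw_def inj_on_def)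
        then show "x $ j * representation B (b j) (b i) = (if j = i then x $ j else 0)"
          using bB j by (auto simp: representation_basis[OF B(2)])
      qed
      finally show ?thesis using i by simp
    qed
    then show ?thesis using x by (intro eq_vecI) (auto simp: \<phi>_def)
  qed
  have "coords U (dim U) \<phi>"
    unfolding coords_def
  proof (intro conjI ballI allI U)
    show "bij_betw \<phi> U (carrier_vec (dim U))"
      by (rule bij_betw_byWitness[of _ \<psi>]) (use \<psi>\<phi> \<phi>\<psi> \<psi>U in \<open>auto simp: \<phi>_def\<close>)
  next
    fix u w assume "u \<in> U" "w \<in> U"
    then show "\<phi> (u + w) = \<phi> u + \<phi> w"
      using UB by (intro eq_vecI) (auto simp: \<phi>_def representation_add[OF B(2)])
  next
    fix c u assume "u \<in> U"
    then show "\<phi> (scale c u) = c \<cdot>\<^sub>v \<phi> u"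
      using UB by (intro eq_vecI) (auto simp: \<phi>_def representation_scale[OF B(2)])
  qed
  then show ?thesis by blast
qed

text \<open>A member of smallest dimension inside \<open>M\<close> is minimal. The predicate
  \<open>P\<close> is meant to exclude the zero subspace.\<close>

lemma minimal_stable:
  assumes P: "P M" and sub: "\<And>W. P W \<Longrightarrow> subspace W"
  obtains W where "P W" "W \<subseteq> M" "\<And>W'. P W' \<Longrightarrow> W' \<subseteq> W \<Longrightarrow> W' = W"
proof -
  obtain W where W: "P W \<and> W \<subseteq> M" "\<And>W'. P W' \<and> W' \<subseteq> M \<Longrightarrow> dim W \<le> dim W'"
    using exists_least_lemma[of "\<lambda>d. \<exists>W. P W \<and> W \<subseteq> M \<and> dim W \<le> d"] P
      arg_min_nat_lemma[of "\<lambda>W. P W \<and> W \<subseteq> M" M dim] by blast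
  have "W' = W" if "P W'" "W' \<subseteq> W" for W'
    using W that subspace_dim_equal[OF sub sub, of W' W] by auto
  then show ?thesis using that W by blast
qed

text \<open>The clause on the range keeps the extension inside any subspace that contains the
  prescribed values.\<close>

lemma linear_extension:
  assumes "independent B"
  shows "\<exists>f. endo f \<and> (\<forall>b\<in>B. f b = g b) \<and> range f = span (g ` B)"
proof -
  interpret vector_space_pair scale scale ..
  show ?thesis
    using linear_independent_extend_subspace[OF assms, of g] by blast
qed

end

section \<open>Representations and stable subspaces\<close>

locale fin_rep = fin_linear_space scale Basis + group G
  for scale :: "'k::field \<Rightarrow> 'v::ab_group_add \<Rightarrow> 'v" and Basis
    and G :: "('g, 'b) monoid_scheme" (structure) +
  fixes \<rho> :: "'g \<Rightarrow> 'v \<Rightarrow> 'v"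
  assumes rep: "linear_rep G scale \<rho>"
begin

lemma rho_endo: "s \<in> carrier G \<Longrightarrow> endo (\<rho> s)"
  and rho_bij: "s \<in> carrier G \<Longrightarrow> bij (\<rho> s)"
  and rho_mult: "s \<in> carrier G \<Longrightarrow> t \<in> carrier G \<Longrightarrow> \<rho> (s \<otimes> t) v = \<rho> s (\<rho> t v)"
  using rep by (auto simp: linear_rep_def hom_def Aut_vs_def Pi_iff)

lemma rho_one: "\<rho> \<one> v = v"
  using rho_mult[of \<one> \<one> v] rho_bij[of \<one>] by (simp add: bij_def inj_eq)

lemma rho_inv [simp]:
  assumes "s \<in> carrier G"
  shows "\<rho> (inv s) (\<rho> s v) = v" "\<rho> s (\<rho> (inv s) v) = v"
  using assms rho_mult[of "inv s" s v] rho_mult[of s "inv s" v] by (simp_all add: rho_one)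

lemma Aut_inv:
  assumes s: "s \<in> carrier G"
  shows "inv\<^bsub>Aut_vs scale\<^esub> (\<rho> s) = \<rho> (inv s)"
  unfolding m_inv_def[of "Aut_vs scale"]
proof (rule the_equality)
  show "\<rho> (inv s) \<in> carrier (Aut_vs scale) \<and>
      \<rho> s \<otimes>\<^bsub>Aut_vs scale\<^esub> \<rho> (inv s) = \<one>\<^bsub>Aut_vs scale\<^esub> \<and>
      \<rho> (inv s) \<otimes>\<^bsub>Aut_vs scale\<^esub> \<rho> s = \<one>\<^bsub>Aut_vs scale\<^esub>"
    using s rho_endo[of "inv s"] rho_bij[of "inv s"] by (auto simp: Aut_vs_def)
next
  fix y assume "y \<in> carrier (Aut_vs scale) \<and> \<rho> s \<otimes>\<^bsub>Aut_vs scale\<^esub> y = \<one>\<^bsub>Aut_vs scale\<^esub> \<and>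
      y \<otimes>\<^bsub>Aut_vs scale\<^esub> \<rho> s = \<one>\<^bsub>Aut_vs scale\<^esub>"
  then have "\<rho> s (y v) = v" for v by (auto simp: Aut_vs_def fun_eq_iff)
  then show "y = \<rho> (inv s)" using s by (metis ext rho_inv(1))
qed

section \<open>Conjugation, commutants and stable subspaces\<close>

definition conjugate :: "'g \<Rightarrow> ('v \<Rightarrow> 'v) \<Rightarrow> 'v \<Rightarrow> 'v" where
  "conjugate s f = (\<lambda>v. \<rho> s (f (\<rho> (inv s) v)))"

definition conj_stable :: "('v \<Rightarrow> 'v) set \<Rightarrow> bool" where
  "conj_stable S \<longleftrightarrow> (\<forall>s\<in>carrier G. \<forall>f\<in>S. conjugate s f \<in> S)"

lemma conj_stableD: "conj_stable S \<Longrightarrow> s \<in> carrier G \<Longrightarrow> f \<in> S \<Longrightarrow> conjugate s f \<in> S"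
  by (simp add: conj_stable_def)

lemma normal_subalgebra_iff:
  "normal_subalgebra G scale \<rho> R \<longleftrightarrow> subalgebra_End scale R \<and> conj_stable R"
  by (simp add: normal_subalgebra_def conj_stable_def conjugate_def Aut_inv comp_def)

lemma conjugate_endo: "s \<in> carrier G \<Longrightarrow> endo f \<Longrightarrow> endo (conjugate s f)"
  using endo_comp[OF endo_comp[OF rho_endo[of s]], of f "\<rho> (inv s)"] rho_endo[of "inv s"]
  by (simp add: conjugate_def comp_def)

lemma conjugate_mult: "s \<in> carrier G \<Longrightarrow> t \<in> carrier G \<Longrightarrow> conjugate (s \<otimes> t) f = conjugate s (conjugate t f)"
  by (simp add: conjugate_def fun_eq_iff rho_mult inv_mult_group)

lemma conjugate_one: "conjugate \<one> f = f"
  by (simp add: conjugate_def rho_one)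

lemma conjugate_inv: "s \<in> carrier G \<Longrightarrow> conjugate (inv s) (conjugate s f) = f"
  by (simp add: conjugate_def fun_eq_iff)

lemma conjugate_comp: "s \<in> carrier G \<Longrightarrow> conjugate s (\<lambda>v. f (g v)) = (\<lambda>v. conjugate s f (conjugate s g v))"
  by (simp add: conjugate_def fun_eq_iff)

definition cent :: "('v \<Rightarrow> 'v) set \<Rightarrow> ('v \<Rightarrow> 'v) set" where
  "cent S = {f. endo f \<and> (\<forall>g\<in>S. \<forall>v. f (g v) = g (f v))}"

lemma cent_endo: "f \<in> cent S \<Longrightarrow> endo f"
  and centD: "f \<in> cent S \<Longrightarrow> g \<in> S \<Longrightarrow> f (g v) = g (f v)"
  by (auto simp: cent_def)

text \<open>Conjugation of \<open>f\<close> by \<open>s\<close> can be traded for conjugation of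
  \<open>g\<close> by \<open>inv s\<close>, which does not lead out of \<open>S\<close>.\<close>

lemma cent_conj_stable: "conj_stable S \<Longrightarrow> conj_stable (cent S)"
  unfolding conj_stable_def
proof (intro ballI)
  fix s f assume S: "\<forall>s\<in>carrier G. \<forall>f\<in>S. conjugate s f \<in> S" and s: "s \<in> carrier G" and f: "f \<in> cent S"
  have "conjugate s f (g v) = g (conjugate s f v)" if "g \<in> S" for g v
  proof -
    have "conjugate (inv s) g \<in> S" using S s that by simp
    then have "f (conjugate (inv s) g (\<rho> (inv s) v)) = conjugate (inv s) g (f (\<rho> (inv s) v))"
      using f by (simp add: centD)
    then have "f (\<rho> (inv s) (g v)) = \<rho> (inv s) (g (\<rho> s (f (\<rho> (inv s) v))))"
      using s by (simp add: conjugate_def)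
    then show ?thesis using s by (simp add: conjugate_def)
  qed
  then show "conjugate s f \<in> cent S"
    using conjugate_endo[OF s cent_endo[OF f]] by (simp add: cent_def)
qed

lemma cent_subalgebra: "subalgebra_End scale (cent S)" if "\<And>f. f \<in> S \<Longrightarrow> endo f"
  unfolding subalgebra_End_def cent_def
  using that by (auto simp: endo_id endo_comp endo_plus endo_smult endo_addD endo_scaleD)

definition stable :: "('v \<Rightarrow> 'v) set \<Rightarrow> 'v set \<Rightarrow> bool" where
  "stable S W \<longleftrightarrow> subspace W \<and> (\<forall>f\<in>S. \<forall>w\<in>W. f w \<in> W)"

lemma stable_subspace: "stable S W \<Longrightarrow> subspace W"
  and stableD: "stable S W \<Longrightarrow> f \<in> S \<Longrightarrow> w \<in> W \<Longrightarrow> f w \<in> W"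
  by (auto simp: stable_def)

definition simple_module :: bool where
  "simple_module \<longleftrightarrow> (\<forall>U. stable (\<rho> ` carrier G) U \<longrightarrow> U = {0} \<or> U = UNIV)"

text \<open>Schur's lemma in its strong form: the commutant of \<open>G\<close> is \<open>k\<close>
  itself and not merely a division algebra over \<open>k\<close>. It follows from absolute
  simplicity.\<close>

definition scalar_commutant :: bool where
  "scalar_commutant \<longleftrightarrow>
    (\<forall>f. endo f \<and> (\<forall>s\<in>carrier G. \<forall>v. f (\<rho> s v) = \<rho> s (f v)) \<longrightarrow> (\<exists>c. f = scale c))"

lemma scalar_commutantD:
  "scalar_commutant \<Longrightarrow> endo f \<Longrightarrow> (\<And>s v. s \<in> carrier G \<Longrightarrow> f (\<rho> s v) = \<rho> s (f v)) \<Longrightarrow> \<exists>c. f = scale c"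
  by (simp add: scalar_commutant_def)

lemma simple_moduleD:
  assumes "simple_module" "subspace U" "\<And>s u. s \<in> carrier G \<Longrightarrow> u \<in> U \<Longrightarrow> \<rho> s u \<in> U" "u \<in> U" "u \<noteq> 0"
  shows "U = UNIV"
  using assms by (auto simp: simple_module_def stable_def)

lemma stable_translate:
  assumes S: "conj_stable S" and W: "stable S W" and s: "s \<in> carrier G"
  shows "stable S (\<rho> s ` W)"
  unfolding stable_def
proof (intro conjI ballI)
  show "subspace (\<rho> s ` W)"
    using W rho_endo[OF s] by (auto simp: stable_def subspace_def endo_addD[symmetric] endo_scaleD[symmetric]
        intro!: image_eqI[of 0 _ 0] simp: endo_zero)
next
  fix f w assume "f \<in> S" "w \<in> \<rho> s ` W"
  then obtain u where u: "u \<in> W" "w = \<rho> s u" by auto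
  have "conjugate (inv s) f \<in> S" using S s \<open>f \<in> S\<close> by (simp add: conj_stable_def)
  then have "conjugate (inv s) f u \<in> W" using W u by (simp add: stable_def)
  moreover have "f w = \<rho> s (conjugate (inv s) f u)" using s u by (simp add: conjugate_def)
  ultimately show "f w \<in> \<rho> s ` W" by simp
qed

lemma stable_sum:
  assumes "stable S M" "stable S N" "\<And>f. f \<in> S \<Longrightarrow> endo f"
  shows "stable S {m + n |m n. m \<in> M \<and> n \<in> N}"
  unfolding stable_def
proof (intro conjI ballI)
  show "subspace {m + n |m n. m \<in> M \<and> n \<in> N}"
    using assms by (intro subspace_sums) (auto simp: stable_def)
next
  fix f w assume f: "f \<in> S" and "w \<in> {m + n |m n. m \<in> M \<and> n \<in> N}"
  then obtain m n where mn: "m \<in> M" "n \<in> N" "w = m + n" by blast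
  have "f w = f m + f n" using mn endo_addD[OF assms(3)[OF f]] by simp
  then show "f w \<in> {m + n |m n. m \<in> M \<and> n \<in> N}"
    using stableD[OF assms(1) f mn(1)] stableD[OF assms(2) f mn(2)] by blast
qed

text \<open>The translates of a minimal stable subspace span \<open>V\<close>, hence stable subspaces have stable
  complements, as for semisimple modules.\<close>

lemma stable_complement:
  assumes simple: "simple_module" and nz: "\<exists>v :: 'v. v \<noteq> 0"
    and S: "conj_stable S" "\<And>f. f \<in> S \<Longrightarrow> endo f" and M: "stable S M"
  shows "\<exists>N. stable S N \<and> M \<inter> N = {0} \<and> (\<forall>v. \<exists>m\<in>M. \<exists>n\<in>N. v = m + n)"
proof -
  have "stable S UNIV" by (simp add: stable_def)
  moreover have "(UNIV :: 'v set) \<noteq> {0}" using nz by blast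
  ultimately obtain W where W: "stable S W" "W \<noteq> {0}"
    and Wmin: "\<And>W'. stable S W' \<Longrightarrow> W' \<noteq> {0} \<Longrightarrow> W' \<subseteq> W \<Longrightarrow> W' = W"
    using minimal_stable[of "\<lambda>W. stable S W \<and> W \<noteq> {0}" UNIV] stable_subspace by metis
  obtain w0 where w0: "w0 \<in> W" "w0 \<noteq> 0" using W by (auto simp: stable_def subspace_0)
  \<comment> \<open>The complement is sought as a stable subspace of largest dimension among those
    that meet \<open>M\<close> only in 0.\<close>
  define Q where "Q = (\<lambda>N. stable S N \<and> M \<inter> N = {0})"
  have "Q {0}" using M S(2) by (auto simp: Q_def stable_def endo_zero subspace_0)
  moreover have "\<forall>N. Q N \<longrightarrow> dim N < Suc dimension" using dim_subset_UNIV by (auto simp: less_Suc_eq_le)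
  ultimately obtain N where N: "Q N" and Nmax: "\<And>N'. Q N' \<Longrightarrow> dim N' \<le> dim N"
    using ex_has_greatest_nat[of Q "{0}" dim "Suc dimension"] by auto
  have Nst: "stable S N" and MN0: "M \<inter> N = {0}" using N by (auto simp: Q_def)
  define MN where "MN = {m + n |m n. m \<in> M \<and> n \<in> N}"
  have MNst: "stable S MN" unfolding MN_def by (rule stable_sum[OF M Nst S(2)])
  have sub: "\<rho> s ` W \<subseteq> MN" if s: "s \<in> carrier G" for s
  proof -
    define T where "T = \<rho> s ` W"
    have Tst: "stable S T" unfolding T_def by (rule stable_translate[OF S(1) W(1) s])
    \<comment> \<open>Moved back by \<open>inv s\<close>, the part of the translate inside
      \<open>MN\<close> is a stable subspace of the minimal \<open>W\<close>, so it is
      \<open>W\<close> or 0. If it is 0, adding the translate to \<open>N\<close> keeps the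
      intersection with \<open>M\<close> trivial; by maximality the translate then lies in
      \<open>N\<close>, hence in \<open>MN\<close>, and would be 0.\<close>
    have I: "stable S (\<rho> (inv s) ` (T \<inter> MN))"
      using Tst MNst s by (intro stable_translate[OF S(1)]) (auto simp: stable_def subspace_inter)
    have IW: "\<rho> (inv s) ` (T \<inter> MN) \<subseteq> W" using s by (auto simp: T_def)
    show ?thesis
    proof (cases "\<rho> (inv s) ` (T \<inter> MN) = {0}")
      case False
      then have eq: "\<rho> (inv s) ` (T \<inter> MN) = W" using Wmin[OF I] IW by simp
      show ?thesis
      proof
        fix x assume "x \<in> \<rho> s ` W"
        then obtain y where y: "y \<in> T \<inter> MN" "x = \<rho> s (\<rho> (inv s) y)" using eq by auto
        then show "x \<in> MN" using s by simp
      qed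
    next
      case True
      have TMN: "x = 0" if "x \<in> T" "x \<in> MN" for x
      proof -
        have "\<rho> (inv s) x = 0" using True that by blast
        then show ?thesis using s endo_zero[OF rho_endo[OF s]] by (metis rho_inv(2))
      qed
      define N' where "N' = {n + t |n t. n \<in> N \<and> t \<in> T}"
      have 0: "0 \<in> N" "0 \<in> T" "0 \<in> M" using Nst Tst M by (auto simp: stable_def subspace_0)
      have "stable S N'" unfolding N'_def by (rule stable_sum[OF Nst Tst S(2)])
      moreover have "M \<inter> N' = {0}"
      proof (intro equalityI subsetI)
        fix m assume "m \<in> M \<inter> N'"
        then obtain n t where mt: "m \<in> M" "n \<in> N" "t \<in> T" "m = n + t" by (auto simp: N'_def)
        have "t = m + (- n)" using mt by simp
        moreover have "- n \<in> N" using Nst mt by (auto simp: stable_def subspace_neg)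
        ultimately have "t \<in> MN" using mt(1) unfolding MN_def by blast
        then have "t = 0" using TMN mt by blast
        then show "m \<in> {0}" using mt MN0 by auto
      qed (use 0 in \<open>auto simp: N'_def intro!: exI[of _ 0]\<close>)
      ultimately have "dim N' \<le> dim N" by (intro Nmax) (simp add: Q_def)
      moreover have "N \<subseteq> N'" using 0 by (force simp: N'_def)
      ultimately have "N = N'"
        using subspace_dim_equal[of N N'] Nst \<open>stable S N'\<close> by (simp add: stable_def)
      moreover have "\<rho> s w0 \<in> N'" using 0 w0 by (force simp: N'_def T_def)
      ultimately have "\<rho> s w0 \<in> MN" using 0 by (force simp: MN_def)
      then have "\<rho> s w0 = 0" using TMN w0 by (simp add: T_def)
      then have "w0 = 0" using s endo_zero[OF rho_endo[of "inv s"]] by (metis inv_closed rho_inv(1))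
      then show ?thesis using w0 by simp
    qed
  qed
  \<comment> \<open>The vectors with all translates in \<open>MN\<close> form a
    \<open>G\<close>-invariant subspace that contains \<open>w0\<close>.\<close>
  define T where "T = {v. \<forall>s\<in>carrier G. \<rho> s v \<in> MN}"
  have "T = UNIV"
  proof (rule simple_moduleD[OF simple _ _ _ w0(2)])
    show "subspace T" using MNst rho_endo
      by (auto simp: T_def stable_def subspace_def endo_addD endo_scaleD endo_zero)
    show "\<rho> s u \<in> T" if "s \<in> carrier G" "u \<in> T" for s u
      using that by (auto simp: T_def simp flip: rho_mult)
    show "w0 \<in> T" using sub w0 by (auto simp: T_def)
  qed
  then have "\<rho> \<one> v \<in> MN" for v unfolding T_def using one_closed by blast
  then have "v \<in> MN" for v by (simp add: rho_one)
  then show ?thesis using Nst MN0 unfolding MN_def by blast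
qed

text \<open>Both \<open>M\<close> and its complement are stable under \<open>S\<close>, so the
  projection along the complement commutes with \<open>S\<close>. Nothing is claimed about commuting
  with \<open>G\<close>.\<close>

lemma stable_projection:
  assumes simple: "simple_module" and nz: "\<exists>v :: 'v. v \<noteq> 0"
    and S: "conj_stable S" "\<And>f. f \<in> S \<Longrightarrow> endo f" and M: "stable S M"
  obtains p where "p \<in> cent S" "\<And>v. p v \<in> M" "\<And>m. m \<in> M \<Longrightarrow> p m = m"
proof -
  obtain N where N: "stable S N" "M \<inter> N = {0}" "\<And>v. \<exists>m\<in>M. \<exists>n\<in>N. v = m + n"
    using stable_complement[OF assms] by blast
  have sM: "subspace M" and sN: "subspace N" using M N by (auto simp: stable_def)
  have uniq: "m = m'" if "m \<in> M" "m' \<in> M" "v - m \<in> N" "v - m' \<in> N" for m m' v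
  proof -
    have "m - m' = (v - m') - (v - m)" by simp
    then have "m - m' \<in> N" using that sN by (metis subspace_diff)
    moreover have "m - m' \<in> M" using that sM by (metis subspace_diff)
    ultimately have "m - m' \<in> M \<inter> N" by simp
    then show ?thesis using N(2) by simp
  qed
  have ex: "\<exists>m\<in>M. v - m \<in> N" for v using N(3)[of v] by (metis add_diff_cancel_left')
  then obtain p where p: "\<And>v. p v \<in> M" "\<And>v. v - p v \<in> N" by metis
  have eq: "p v = m" if "m \<in> M" "v - m \<in> N" for v m
    using uniq[OF p(1) that(1) p(2) that(2)] .
  have "endo p"
    unfolding endo_iff
  proof (intro conjI allI)
    fix x y
    have "x + y - (p x + p y) = (x - p x) + (y - p y)" by simp
    then show "p (x + y) = p x + p y"
      using p sM sN by (intro eq) (auto intro: subspace_add simp only:)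
  next
    fix c x
    have "scale c x - scale c (p x) = scale c (x - p x)" by (simp add: scale_right_diff_distrib)
    then show "p (scale c x) = scale c (p x)"
      using p sM sN by (intro eq) (auto intro: subspace_scale simp only:)
  qed
  moreover have "p (g v) = g (p v)" if "g \<in> S" for g v
  proof (rule eq)
    show "g (p v) \<in> M" using stableD[OF M that p(1)] .
    have "g v - g (p v) = g (v - p v)" using endo_diff[OF S(2)[OF that]] by simp
    then show "g v - g (p v) \<in> N" using stableD[OF N(1) that p(2)] by simp
  qed
  ultimately have "p \<in> cent S" by (simp add: cent_def)
  moreover have "p m = m" if "m \<in> M" for m
    using that sN by (intro eq) (auto simp: subspace_0)
  ultimately show ?thesis using that p(1) by blast
qed

end

section \<open>Systems of imprimitivity\<close>

context fin_rep
begin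

text \<open>The conjugates of \<open>P\<close> project onto the translates of
  \<open>U = range P\<close>, which form the blocks of a system of imprimitivity. The stabiliser
  \<open>H\<close> of \<open>P\<close> acts on \<open>U\<close>, and \<open>V\<close> is induced
  from this action.\<close>

lemma imprimitive_imp_induced:
  assumes simple: simple_module
    and schur: scalar_commutant
    and P: "endo P" "\<And>v. P (P v) = P v" "P u0 \<noteq> 0" "P v0 \<noteq> v0"
    and imp: "\<And>s. s \<in> carrier G \<Longrightarrow> conjugate s P = P \<or> (\<forall>v. P (conjugate s P v) = 0)"
  shows "induced_from_proper_finite_index G scale \<rho>"
proof -
  define u where "u = P u0"
  have u: "P u = u" "u \<noteq> 0" using P by (auto simp: u_def)
  define U where "U = range P"
  have sU: "subspace U"
    unfolding U_def subspace_def using endo_addD[OF P(1)] endo_scaleD[OF P(1)] endo_zero[OF P(1)]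
    by (auto simp flip: endo_addD[OF P(1)] endo_scaleD[OF P(1)])
  have PU: "P x = x" if "x \<in> U" for x using that P(2) by (auto simp: U_def)
  have inU: "P x \<in> U" for x by (simp add: U_def)
  define H where "H = {s \<in> carrier G. conjugate s P = P}"
  have HP: "conjugate s P = P" if "s \<in> H" for s using that unfolding H_def by blast
  have HG: "s \<in> carrier G" if "s \<in> H" for s using that by (simp add: H_def)
  have H: "subgroup H G"
  proof (rule subgroupI)
    show "H \<noteq> {}" using conjugate_one[of P] by (auto simp: H_def)
    show "inv a \<in> H" if "a \<in> H" for a
      using that conjugate_inv[of a P] by (auto simp: H_def)
  qed (auto simp: H_def conjugate_mult)
  interpret H: subgroup H G by (rule H)
  have comm: "P (\<rho> s x) = \<rho> s (P x)" if "s \<in> H" for s x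
  proof -
    have "conjugate s P (\<rho> s x) = P (\<rho> s x)" using HP[OF that] by (rule fun_cong)
    then show ?thesis unfolding conjugate_def rho_inv(1)[OF HG[OF that]] by (rule sym)
  qed
  have off: "P (\<rho> s x) = 0" if "s \<in> carrier G" "s \<notin> H" "x \<in> U" for s x
  proof -
    have "conjugate s P \<noteq> P" using that unfolding H_def by blast
    then have "P (conjugate s P (\<rho> s x)) = 0" using imp[OF that(1)] by blast
    then show ?thesis using that PU by (simp add: conjugate_def)
  qed
  \<comment> \<open>The block of the coset \<open>Q\<close> is the image of \<open>U\<close> under
    \<open>\<rho> (inv (a Q))\<close>. The inverse is the reason for right cosets: replacing
    \<open>a Q\<close> by \<open>h \<otimes> a Q\<close> with \<open>h\<close> in \<open>H\<close>
    does not change the block.\<close>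
  have "\<forall>Q\<in>rcosets H. \<exists>a\<in>carrier G. Q = H #> a" by (auto simp: RCOSETS_def)
  then obtain a where a: "\<And>Q. Q \<in> rcosets H \<Longrightarrow> a Q \<in> carrier G" "\<And>Q. Q \<in> rcosets H \<Longrightarrow> Q = H #> a Q"
    by metis
  have mem: "x \<otimes> inv (a Q) \<in> H \<longleftrightarrow> x \<in> Q" if "x \<in> carrier G" "Q \<in> rcosets H" for x Q
    using H.rcos_module[OF is_group a(1)[OF that(2)] that(1)] a(2)[OF that(2)] by simp
  have memQ: "x \<in> Q \<longleftrightarrow> H #> x = Q" if "x \<in> carrier G" "Q \<in> rcosets H" for x Q
    using repr_independence[OF _ a(1)[OF that(2)] H, of x] a(2)[OF that(2)]
      rcos_self[OF that(1) H] by metis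
  have blocks: "P (\<rho> x (\<rho> (inv (a Q)) w)) = (if H #> x = Q then \<rho> (x \<otimes> inv (a Q)) w else 0)"
    if "x \<in> carrier G" "Q \<in> rcosets H" "w \<in> U" for x Q w
  proof -
    have aG: "inv (a Q) \<in> carrier G" using a(1)[OF that(2)] by simp
    define h where "h = x \<otimes> inv (a Q)"
    have h: "h \<in> carrier G" "h \<in> H \<longleftrightarrow> H #> x = Q"
      using mem[OF that(1,2)] memQ[OF that(1,2)] that(1) aG by (simp_all add: h_def)
    have "P (\<rho> h w) = (if H #> x = Q then \<rho> h w else 0)"
      using comm[of h w] off[OF h(1) _ that(3)] PU[OF that(3)] h(2) by presburger
    then show ?thesis unfolding h_def rho_mult[OF that(1) aG] .
  qed
  have cosetI: "H #> x \<in> rcosets H" if "x \<in> carrier G" for x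
    by (rule rcosetsI) (use that H.subset in auto)
  have aQ: "H #> a Q = Q" if "Q \<in> rcosets H" for Q using a(2)[OF that] by simp
  \<comment> \<open>One nonzero vector from each block. \<open>P\<close> composed with
    \<open>\<rho> (a Q)\<close> singles out the vector of \<open>Q\<close>, so these vectors are
    independent and the dimension bounds the index.\<close>
  define w where "w = (\<lambda>Q. \<rho> (inv (a Q)) u)"
  have uU: "u \<in> U" using inU[of u0] by (simp add: u_def)
  have Pw: "P (\<rho> (a Q) (w Q')) = (if Q = Q' then u else 0)" if "Q \<in> rcosets H" "Q' \<in> rcosets H" for Q Q'
    using blocks[OF a(1)[OF that(1)] that(2) uU] aQ[OF that(1)] a(1)[OF that(1)] by (auto simp: w_def rho_one)
  have injw: "inj_on w (rcosets H)"
    by (rule inj_onI) (metis Pw u(2))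
  have "independent (w ` (rcosets H))"
    unfolding independent_explicit_finite_subsets
  proof (intro allI impI ballI)
    fix S c x assume S: "S \<subseteq> w ` (rcosets H)" "finite S" and sum: "(\<Sum>v\<in>S. scale (c v) v) = 0" and x: "x \<in> S"
    obtain Q where Q: "Q \<in> rcosets H" "x = w Q" using S x by auto
    define f where "f = P \<circ> \<rho> (a Q)"
    have f: "endo f" unfolding f_def by (intro endo_comp P(1) rho_endo a Q)
    have fv: "f v = (if v = x then u else 0)" if v: "v \<in> S" for v
    proof -
      obtain Q' where Q': "Q' \<in> rcosets H" "v = w Q'" using S v by auto
      then have "v = x \<longleftrightarrow> Q = Q'" using injw Q by (auto simp: inj_on_def)
      then show ?thesis using Pw[OF Q(1) Q'(1)] Q' by (simp add: f_def)
    qed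
    have "0 = f (\<Sum>v\<in>S. scale (c v) v)" using sum f by (simp add: endo_zero)
    also have "\<dots> = (\<Sum>v\<in>S. scale (c v) (f v))" using f by (simp add: endo_sum endo_scaleD)
    also have "\<dots> = (\<Sum>v\<in>S. if v = x then scale (c v) u else 0)"
      by (rule sum.cong) (auto simp: fv)
    also have "\<dots> = scale (c x) u" using S(2) x by simp
    finally show "c x = 0" using u by simp
  qed
  then have "finite (w ` (rcosets H))" by (rule finiteI_independent)
  then have fin: "finite (rcosets H)" using injw by (simp add: finite_image_iff)
  \<comment> \<open>If \<open>H\<close> were all of \<open>G\<close>, then \<open>P\<close> would
    commute with \<open>G\<close> and be a scalar, hence 0 or the identity.\<close>
  have "\<exists>s\<in>carrier G. s \<notin> H"
  proof (rule ccontr)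
    assume "\<not> ?thesis"
    then obtain c where c: "P = scale c" using scalar_commutantD[OF schur P(1)] comm by metis
    then have "c \<noteq> 0" using P(3) by auto
    moreover have "scale c (P v0) = scale c v0" using c P(2)[of v0] by simp
    ultimately have "P v0 = v0" by simp
    then show False using P(4) by simp
  qed
  then obtain s where s: "s \<in> carrier G" "s \<notin> H" by blast
  have "H #> \<one> \<noteq> H #> s"
    using s H.subset rcos_self[OF s(1) H] by (auto simp: coset_mult_one)
  then have "card {H #> \<one>, H #> s} = 2" by simp
  moreover have "card {H #> \<one>, H #> s} \<le> card (rcosets H)"
    using fin cosetI s by (intro card_mono) auto
  ultimately have index: "card (rcosets H) > 1" by simp
  define d where "d = dim U"
  obtain \<chi> where \<chi>: "coords U d \<chi>" using coords_exist[OF sU] by (auto simp: d_def)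
  have "\<exists>\<sigma>. matrix_rep (G\<lparr>carrier := H\<rparr>) d \<sigma> \<and>
      (\<forall>x\<in>carrier (G\<lparr>carrier := H\<rparr>). \<forall>u\<in>U. \<chi> (\<rho> x u) = \<sigma> x *\<^sub>v \<chi> u)"
  proof (rule coords_matrix_rep[OF _ \<chi>])
    show "group (G\<lparr>carrier := H\<rparr>)" using H by (rule subgroup.subgroup_is_group) (rule is_group)
    show "\<rho> x u \<in> U" if "x \<in> carrier (G\<lparr>carrier := H\<rparr>)" "u \<in> U" for x u
      using comm[of x u] PU[of u] that inU[of "\<rho> x u"] by simp
  qed (use HG in \<open>auto simp: rho_endo rho_mult rho_one\<close>)
  then obtain \<sigma> where \<sigma>: "matrix_rep (G\<lparr>carrier := H\<rparr>) d \<sigma>"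
    "\<And>x u. x \<in> H \<Longrightarrow> u \<in> U \<Longrightarrow> \<chi> (\<rho> x u) = \<sigma> x *\<^sub>v \<chi> u" by auto
  \<comment> \<open>As in Frobenius reciprocity, the value at \<open>g\<close> records the component
    of \<open>\<rho> (inv g) v\<close> in the base block. The vectors with zero image form a
    \<open>G\<close>-invariant subspace that misses \<open>u\<close>.\<close>
  define \<phi> where "\<phi> = (\<lambda>v. \<lambda>g\<in>carrier G. \<chi> (P (\<rho> (inv g) v)))"
  let ?T = "induced_module G H d \<sigma>"
  have \<phi>c: "\<phi> v \<in> carrier ?T" for v
  proof -
    have "\<phi> v (g \<otimes> h) = \<sigma> (inv h) *\<^sub>v \<phi> v g" if "g \<in> carrier G" "h \<in> H" for g h
    proof -
      have h: "h \<in> carrier G" "inv h \<in> H" using that HG by auto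
      have "P (\<rho> (inv (g \<otimes> h)) v) = \<rho> (inv h) (P (\<rho> (inv g) v))"
        using that h by (simp add: inv_mult_group rho_mult comm)
      then show ?thesis using that h \<sigma>(2)[OF h(2) inU] by (simp add: \<phi>_def)
    qed
    moreover have "\<phi> v \<in> carrier G \<rightarrow>\<^sub>E carrier_vec d"
      using coords_closed[OF \<chi>] inU by (auto simp: \<phi>_def)
    ultimately show ?thesis by (simp add: induced_module_def)
  qed
  have \<phi>add: "\<phi> (v + v') = \<phi> v \<oplus>\<^bsub>?T\<^esub> \<phi> v'" for v v'
    by (auto simp: \<phi>_def induced_module_def fun_eq_iff restrict_def endo_addD[OF rho_endo] endo_addD[OF P(1)]
        coords_add[OF \<chi>] inU)
  have inj: "inj \<phi>"
  proof -
    define K where "K = {v. \<forall>g\<in>carrier G. P (\<rho> g v) = 0}"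
    have K0: "v = 0" if "v \<in> K" for v
    proof (rule ccontr)
      assume "v \<noteq> 0"
      have "K = UNIV"
      proof (rule simple_moduleD[OF simple _ _ that \<open>v \<noteq> 0\<close>])
        show "subspace K" using endo_addD[OF rho_endo] endo_scaleD[OF rho_endo] endo_zero[OF rho_endo]
          by (auto simp: K_def subspace_def endo_zero[OF P(1)] endo_addD[OF P(1)] endo_scaleD[OF P(1)])
        show "\<rho> s x \<in> K" if "s \<in> carrier G" "x \<in> K" for s x
          using that by (auto simp: K_def simp flip: rho_mult)
      qed
      then have "u \<in> K" by simp
      then have "P (\<rho> \<one> u) = 0" unfolding K_def by blast
      then show False using u by (simp add: rho_one)
    qed
    show ?thesis
    proof (rule injI)
      fix x y assume eq: "\<phi> x = \<phi> y"
      have "P (\<rho> g (x - y)) = 0" if g: "g \<in> carrier G" for g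
      proof -
        have "\<phi> x (inv g) = \<phi> y (inv g)" using eq by simp
        then have "P (\<rho> g x) = P (\<rho> g y)"
          using g coords_inj[OF \<chi> inU inU] by (simp add: \<phi>_def)
        then show ?thesis by (simp add: endo_diff[OF rho_endo[OF g]] endo_diff[OF P(1)])
      qed
      then have "x - y \<in> K" by (simp add: K_def)
      then show "x = y" using K0 by fastforce
    qed
  qed
  have surj: "f \<in> range \<phi>" if f: "f \<in> carrier ?T" for f
  proof -
    have fU: "f \<in> carrier G \<rightarrow>\<^sub>E carrier_vec d"
      and fH: "\<And>g h. g \<in> carrier G \<Longrightarrow> h \<in> H \<Longrightarrow> f (g \<otimes> h) = \<sigma> (inv h) *\<^sub>v f g"
      using f by (auto simp: induced_module_def)
    have fd: "f g \<in> carrier_vec d" if "g \<in> carrier G" for g using fU that by auto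
    define y where "y = (\<lambda>Q. uncoords U \<chi> (f (inv (a Q))))"
    have y: "y Q \<in> U" "\<chi> (y Q) = f (inv (a Q))" if "Q \<in> rcosets H" for Q
      using uncoords[OF \<chi> fd[of "inv (a Q)"]] a(1)[OF that] by (auto simp: y_def)
    \<comment> \<open>A function in the induced module is determined by its values at the points
      \<open>inv (a Q)\<close>; the preimage puts each of these values into the block of
      \<open>Q\<close>.\<close>
    define v where "v = (\<Sum>Q\<in>rcosets H. \<rho> (inv (a Q)) (y Q))"
    have "\<phi> v g = f g" if g: "g \<in> carrier G" for g
    proof -
      define Q where "Q = H #> inv g"
      have Q: "Q \<in> rcosets H" using g cosetI by (simp add: Q_def)
      define h where "h = inv g \<otimes> inv (a Q)"
      have hH: "h \<in> H" using mem[of "inv g" Q] memQ[of "inv g" Q] g Q by (simp add: h_def Q_def)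
      have hg: "inv (a Q) \<otimes> inv h = g"
        using g a(1)[OF Q] by (simp add: h_def inv_mult_group m_assoc[symmetric])
      have "P (\<rho> (inv g) v) = (\<Sum>Q'\<in>rcosets H. P (\<rho> (inv g) (\<rho> (inv (a Q')) (y Q'))))"
        unfolding v_def using g by (simp add: endo_sum[OF rho_endo] endo_sum[OF P(1)])
      also have "\<dots> = (\<Sum>Q'\<in>rcosets H. if Q' = Q then \<rho> h (y Q) else 0)"
        by (rule sum.cong[OF refl]) (use g in \<open>auto simp: blocks y h_def Q_def\<close>)
      also have "\<dots> = \<rho> h (y Q)" using fin Q by simp
      finally have "\<phi> v g = \<sigma> h *\<^sub>v f (inv (a Q))"
        using g \<sigma>(2)[OF hH y(1)[OF Q]] y(2)[OF Q] by (simp add: \<phi>_def)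
      also have "\<dots> = f g" using fH[of "inv (a Q)" "inv h"] a(1)[OF Q] hH HG[OF hH] hg by simp
      finally show ?thesis .
    qed
    moreover have "\<phi> v g = f g" if "g \<notin> carrier G" for g
      using that fU by (auto simp: \<phi>_def PiE_def extensional_def)
    ultimately have "f = \<phi> v" by (metis ext)
    then show ?thesis by blast
  qed
  have "rep_isomorphic G scale \<rho> ?T (induced_action G)"
    unfolding rep_isomorphic_def
  proof (intro exI[of _ \<phi>] conjI allI ballI \<phi>add)
    show "bij_betw \<phi> UNIV (carrier ?T)"
      using inj surj \<phi>c by (auto simp: bij_betw_def)
    show "\<phi> (scale c v) = c \<odot>\<^bsub>?T\<^esub> \<phi> v" for c v
      by (auto simp: \<phi>_def induced_module_def fun_eq_iff restrict_def endo_scaleD[OF rho_endo]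
          endo_scaleD[OF P(1)] coords_scale[OF \<chi>] inU)
    show "\<phi> (\<rho> g v) = induced_action G g (\<phi> v)" if "g \<in> carrier G" for g v
      using that by (auto simp: \<phi>_def induced_action_def fun_eq_iff restrict_def inv_mult_group rho_mult)
  qed
  then show ?thesis
    unfolding induced_from_proper_finite_index_def using H index \<sigma>(1) by blast
qed

end

section \<open>Absolute simplicity\<close>

text \<open>Closedness is a hypothesis on polynomials, so that the lemma applies to an algebraically
  closed \<open>k\<close> as well as to the type of the algebraic closure.\<close>

lemma eigenvector_exists:
  fixes A :: "'k::field mat"
  assumes A: "A \<in> carrier_mat n n" and n: "n > 0"
    and closed: "\<And>p :: 'k poly. degree p > 0 \<Longrightarrow> \<exists>x. poly p x = 0"
  shows "\<exists>e x. x \<in> carrier_vec n \<and> x \<noteq> 0\<^sub>v n \<and> A *\<^sub>v x = e \<cdot>\<^sub>v x"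
proof -
  have "degree (char_poly A) > 0" using degree_monic_char_poly[OF A] n by simp
  then obtain e where "poly (char_poly A) e = 0" using closed by blast
  then have "eigenvalue A e" using eigenvalue_root_char_poly[OF A] by simp
  then show ?thesis using A by (auto simp: eigenvalue_def eigenvector_def)
qed

interpretation to_ac: comm_ring_hom to_ac
  by unfold_locales simp_all

context fin_rep
begin

lemma affords_matrix_rep_iff:
  "affords_matrix_rep K scale \<tau> n M \<longleftrightarrow>
    matrix_rep K n M \<and> (\<exists>\<phi>. coords UNIV n \<phi> \<and> (\<forall>g\<in>carrier K. \<forall>v. \<phi> (\<tau> g v) = M g *\<^sub>v \<phi> v))"
  by (auto simp: affords_matrix_rep_def rep_isomorphic_def coords_def module_vec_simps)

lemma proper_subspace_annihilator:
  assumes U: "subspace U" "U \<noteq> UNIV"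
  obtains f v where "endo f" "\<And>u. u \<in> U \<Longrightarrow> f u = 0" "f v \<noteq> 0"
proof -
  obtain B where B: "B \<subseteq> U" "independent B" "U \<subseteq> span B" "card B = dim U"
    using basis_exists[of U] by blast
  obtain C where C: "B \<subseteq> C" "C \<subseteq> UNIV" "independent C" "UNIV \<subseteq> span C"
    by (rule maximal_independent_subset_extend[OF subset_UNIV B(2)])
  obtain c where c: "c \<in> C" "c \<notin> B"
  proof -
    have "C \<noteq> B" using C U B span_minimal[OF B(1) U(1)] by auto
    then show ?thesis using C that by blast
  qed
  let ?g = "\<lambda>b. if b \<in> B then 0 else b"
  obtain f where f: "endo f" "\<forall>b\<in>C. f b = ?g b"
    using linear_extension[OF C(3), of ?g] by blast
  have "subspace {v. f v = 0}"
    using f(1) by (auto simp: subspace_def endo_addD endo_scaleD endo_zero)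
  then have "span B \<subseteq> {v. f v = 0}" by (rule span_minimal[rotated]) (use f C in auto)
  moreover have "f c \<noteq> 0" using f(2) c C dependent_zero[of C] by auto
  ultimately show ?thesis using that[of f c] f(1) B by blast
qed

text \<open>Each part turns data over \<open>k\<close> into an invariant subspace over the algebraic
  closure, which has to be zero or everything.\<close>

lemma absolutely_simple_imp:
  assumes "absolutely_simple G scale \<rho>"
  shows simple_if_absolutely_simple: simple_module
    and scalar_commutant_if_absolutely_simple: scalar_commutant
proof -
  obtain n M \<phi> where M: "matrix_rep G n M" and irr: "absolutely_irreducible_rep G n M"
    and \<phi>: "coords UNIV n \<phi>" and eq: "\<And>g v. g \<in> carrier G \<Longrightarrow> \<phi> (\<rho> g v) = M g *\<^sub>v \<phi> v"
    using assms unfolding absolutely_simple_def affords_matrix_rep_iff by blast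
  let ?h = "map_mat (to_ac :: 'k \<Rightarrow> 'k alg_closure)"
  have n: "n > 0" and inv: "\<And>U. invariant_subspace G n (\<lambda>g. ?h (M g)) U \<Longrightarrow> U = {0\<^sub>v n} \<or> U = carrier_vec n"
    using irr by (auto simp: absolutely_irreducible_rep_def irreducible_rep_def)
  have Mc: "M g \<in> carrier_mat n n" if "g \<in> carrier G" for g
    using matrix_rep_carrier[OF M that] .
  have \<phi>c: "\<phi> v \<in> carrier_vec n" for v by (rule coords_closed[OF \<phi>]) simp
  show simple_module
    unfolding simple_module_def
  proof (intro allI impI)
    fix U assume U: "stable (\<rho> ` carrier G) U"
    show "U = {0} \<or> U = UNIV"
    proof (rule ccontr)
      assume "\<not> ?thesis"
      then have "U \<noteq> {0}" "U \<noteq> UNIV" by auto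
      \<comment> \<open>\<open>W\<close> plays the role of the scalar extension of \<open>U\<close>,
        described by linear equations over \<open>k\<close>. Equations valid on \<open>U\<close>
        remain valid for its image over the closure, and a nonzero equation keeps \<open>W\<close>
        proper.\<close>
      define Ann where "Ann = {A \<in> carrier_mat n n. \<forall>u\<in>U. A *\<^sub>v \<phi> u = 0\<^sub>v n}"
      define W where "W = {x \<in> carrier_vec n. \<forall>A\<in>Ann. ?h A *\<^sub>v x = 0\<^sub>v n}"
      have AnnM: "A * M g \<in> Ann" if Ag: "A \<in> Ann" "g \<in> carrier G" for A g
      proof -
        have "A * M g *\<^sub>v \<phi> u = 0\<^sub>v n" if u: "u \<in> U" for u
        proof -
          have "\<rho> g u \<in> U" using U u Ag(2) by (auto simp: stable_def)
          then have "A *\<^sub>v \<phi> (\<rho> g u) = 0\<^sub>v n" using Ag(1) by (auto simp: Ann_def)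
          moreover have "A \<in> carrier_mat n n" using Ag(1) by (simp add: Ann_def)
          ultimately show ?thesis
            using assoc_mult_mat_vec[of A n n "M g" n "\<phi> u"] Mc[OF Ag(2)] \<phi>c eq[OF Ag(2)] by simp
        qed
        then show ?thesis using Ag Mc by (auto simp: Ann_def intro!: mult_carrier_mat)
      qed
      have "invariant_subspace G n (\<lambda>g. ?h (M g)) W"
        unfolding invariant_subspace_def
      proof (intro conjI ballI allI)
        show "?h (M g) *\<^sub>v x \<in> W" if g: "g \<in> carrier G" and x: "x \<in> W" for g x
          unfolding W_def
        proof (intro CollectI conjI ballI)
          show "?h (M g) *\<^sub>v x \<in> carrier_vec n" using Mc[OF g] x by (auto simp: W_def intro!: mult_mat_vec_carrier)
          fix A assume A: "A \<in> Ann"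
          then have Ac: "A \<in> carrier_mat n n" by (simp add: Ann_def)
          have "?h A *\<^sub>v (?h (M g) *\<^sub>v x) = ?h (A * M g) *\<^sub>v x"
            using Mc[OF g] Ac x
            by (simp add: to_ac.mat_hom_mult[OF Ac Mc[OF g]] W_def assoc_mult_mat_vec[of _ n n _ n])
          then show "?h A *\<^sub>v (?h (M g) *\<^sub>v x) = 0\<^sub>v n" using AnnM[OF A g] x by (simp add: W_def)
        qed
      next
        fix x y assume "x \<in> W" "y \<in> W"
        then show "x + y \<in> W"
          by (auto simp: W_def Ann_def mult_add_distrib_mat_vec[of _ n n])
      next
        fix c x assume "x \<in> W"
        then show "c \<cdot>\<^sub>v x \<in> W"
          by (auto simp: W_def Ann_def mult_mat_vec[of _ n n])
      qed (auto simp: W_def Ann_def)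
      then have "W = {0\<^sub>v n} \<or> W = carrier_vec n" by (rule inv)
      moreover have "W \<noteq> {0\<^sub>v n}"
      proof
        assume W0: "W = {0\<^sub>v n}"
        obtain u where u: "u \<in> U" "u \<noteq> 0" using U \<open>U \<noteq> {0}\<close> by (auto simp: stable_def subspace_0)
        have "?h A *\<^sub>v map_vec to_ac (\<phi> u) = 0\<^sub>v n" if "A \<in> Ann" for A
        proof -
          have "?h A *\<^sub>v map_vec to_ac (\<phi> u) = map_vec to_ac (A *\<^sub>v \<phi> u)"
            using that \<phi>c by (intro to_ac.mult_mat_vec_hom[symmetric]) (auto simp: Ann_def)
          then show ?thesis using that u by (auto simp: Ann_def)
        qed
        then have "map_vec to_ac (\<phi> u) \<in> W" using \<phi>c by (auto simp: W_def)
        then have "map_vec to_ac (\<phi> u) = (0\<^sub>v n :: 'k alg_closure vec)" using W0 by simp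
        then have "\<phi> u $ i = 0" if "i < n" for i
          using that \<phi>c[of u] by (metis carrier_vecD index_map_vec(1) index_zero_vec(1) to_ac_eq_0_iff)
        then have "\<phi> u = \<phi> 0" using \<phi>c[of u] coords_zero[OF \<phi>] by (intro eq_vecI) auto
        then show False using coords_inj[OF \<phi>] u by auto
      qed
      moreover have "W \<noteq> carrier_vec n"
      proof
        assume W: "W = carrier_vec n"
        obtain f v where f: "endo f" "\<And>u. u \<in> U \<Longrightarrow> f u = 0" "f v \<noteq> 0"
          using proper_subspace_annihilator[OF stable_subspace[OF U] \<open>U \<noteq> UNIV\<close>] by blast
        obtain A where A: "A \<in> carrier_mat n n" "\<And>u. \<phi> (f u) = A *\<^sub>v \<phi> u"
          using coords_matrix[OF \<phi> f(1)] by auto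
        have "A \<in> Ann" using A f(2) coords_zero[OF \<phi>] by (auto simp: Ann_def simp flip: A(2))
        have hx: "?h A *\<^sub>v x = 0\<^sub>v n" if "x \<in> carrier_vec n" for x
          using W \<open>A \<in> Ann\<close> that unfolding W_def by blast
        have "?h A = 0\<^sub>m n n"
          by (rule mat_eq_if_mult_vec_eq[of _ n n])
            (use A hx in \<open>auto simp: scalar_prod_def intro!: eq_vecI\<close>)
        then have "A $$ (i, j) = 0" if "i < n" "j < n" for i j
          using that A(1) by (metis carrier_matD index_map_mat(1) index_zero_mat(1) to_ac_eq_0_iff)
        then have "A = 0\<^sub>m n n" using A(1) by (intro eq_matI) auto
        then have "\<phi> (f v) = \<phi> 0"
          using A(2)[of v] \<phi>c[of v] coords_zero[OF \<phi>] by (auto simp: scalar_prod_def intro!: eq_vecI)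
        then show False using coords_inj[OF \<phi>] f(3) by auto
      qed
      ultimately show False by blast
    qed
  qed
  show scalar_commutant
    unfolding scalar_commutant_def
  proof (intro allI impI, elim conjE)
    fix f assume f: "endo f" and "\<forall>s\<in>carrier G. \<forall>v. f (\<rho> s v) = \<rho> s (f v)"
    then have comm: "\<And>s v. s \<in> carrier G \<Longrightarrow> f (\<rho> s v) = \<rho> s (f v)" by blast
    obtain A where A: "A \<in> carrier_mat n n" "\<And>u. \<phi> (f u) = A *\<^sub>v \<phi> u"
      using coords_matrix[OF \<phi> f] by auto
    have AM: "A * M g = M g * A" if g: "g \<in> carrier G" for g
    proof (rule coords_mat_eqI[OF \<phi>, where m = n])
      fix v :: 'v
      have "A *\<^sub>v (M g *\<^sub>v \<phi> v) = M g *\<^sub>v (A *\<^sub>v \<phi> v)"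
        using comm[OF g, of v] eq[OF g] A(2) by metis
      then show "A * M g *\<^sub>v \<phi> v = M g * A *\<^sub>v \<phi> v"
        using A(1) Mc[OF g] \<phi>c by (simp add: assoc_mult_mat_vec[of _ n n _ n])
    qed (use A Mc[OF g] in \<open>auto intro: mult_carrier_mat\<close>)
    have hA: "?h A \<in> carrier_mat n n" using A by simp
    obtain e x where x: "x \<in> carrier_vec n" "x \<noteq> 0\<^sub>v n" "?h A *\<^sub>v x = e \<cdot>\<^sub>v x"
      using eigenvector_exists[OF hA n alg_closed_imp_poly_has_root] by blast
    \<comment> \<open>An eigenspace over the closure. Being everything, it makes the extended matrix
      the scalar \<open>e\<close>, and \<open>e\<close> lies in \<open>k\<close> because it is a
      diagonal entry of \<open>A\<close>.\<close>
    define W where "W = {x \<in> carrier_vec n. ?h A *\<^sub>v x = e \<cdot>\<^sub>v x}"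
    have "invariant_subspace G n (\<lambda>g. ?h (M g)) W"
      unfolding invariant_subspace_def
    proof (intro conjI ballI allI)
      show "?h (M g) *\<^sub>v x \<in> W" if g: "g \<in> carrier G" and x: "x \<in> W" for g x
      proof -
        have Mg: "?h (M g) \<in> carrier_mat n n" using Mc[OF g] by simp
        have xc: "x \<in> carrier_vec n" using x by (simp add: W_def)
        have "?h A * ?h (M g) = ?h (M g) * ?h A"
          using AM[OF g] to_ac.mat_hom_mult[OF A(1) Mc[OF g]] to_ac.mat_hom_mult[OF Mc[OF g] A(1)] by simp
        then have "?h A *\<^sub>v (?h (M g) *\<^sub>v x) = ?h (M g) *\<^sub>v (?h A *\<^sub>v x)"
          using assoc_mult_mat_vec[OF hA Mg xc] assoc_mult_mat_vec[OF Mg hA xc] by simp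
        also have "\<dots> = e \<cdot>\<^sub>v (?h (M g) *\<^sub>v x)"
          using x mult_mat_vec[OF Mg xc] by (simp add: W_def)
        finally show ?thesis using Mg xc by (auto simp: W_def intro!: mult_mat_vec_carrier)
      qed
    next
      fix x y assume "x \<in> W" "y \<in> W"
      then show "x + y \<in> W"
        using mult_add_distrib_mat_vec[OF hA] by (auto simp: W_def smult_add_distrib_vec[of _ n])
    next
      fix c x assume "x \<in> W"
      then show "c \<cdot>\<^sub>v x \<in> W"
        using mult_mat_vec[OF hA] by (auto simp: W_def smult_smult_assoc mult.commute)
    next
      show "0\<^sub>v n \<in> W" using hA by (auto simp: W_def)
    qed (auto simp: W_def)
    then have "W = {0\<^sub>v n} \<or> W = carrier_vec n" by (rule inv)
    moreover have "x \<in> W" using x by (simp add: W_def)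
    ultimately have W: "W = carrier_vec n" using x(2) by blast
    have entries: "to_ac (A $$ (i, j)) = (if i = j then e else 0)" if ij: "i < n" "j < n" for i j
    proof -
      have "unit_vec n j \<in> W" unfolding W by simp
      then have "?h A *\<^sub>v unit_vec n j = e \<cdot>\<^sub>v unit_vec n j" by (simp add: W_def)
      then have "(?h A *\<^sub>v unit_vec n j) $ i = (e \<cdot>\<^sub>v unit_vec n j) $ i" by simp
      then show ?thesis using A(1) ij by (auto simp: scalar_prod_right_unit)
    qed
    define c where "c = A $$ (0, 0)"
    have e: "e = to_ac c" using entries[of 0 0] n by (simp add: c_def)
    have "A $$ (i, j) = (if i = j then c else 0)" if "i < n" "j < n" for i j
      using entries[OF that] e by (auto split: if_splits)
    then have Ac: "A = c \<cdot>\<^sub>m 1\<^sub>m n" using A(1) by (intro eq_matI) auto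
    have "f v = scale c v" for v
    proof (rule coords_inj[OF \<phi>])
      show "\<phi> (f v) = \<phi> (scale c v)"
        using A(2)[of v] \<phi>c[of v] coords_scale[OF \<phi>, of v c] Ac
        by (simp add: smult_one_mult_vec)
    qed auto
    then have "f = scale c" by (rule ext)
    then show "\<exists>c. f = scale c" by (rule exI)
  qed
qed

end

section \<open>Commutative normal subalgebras\<close>

context fin_rep
begin

text \<open>The product of two commuting idempotents is an idempotent whose range lies in both
  ranges, so an idempotent of minimal rank cannot be cut down properly.\<close>

lemma commutative_idempotent_trivial:
  assumes simple: simple_module
    and schur: scalar_commutant
    and ind: "\<not> induced_from_proper_finite_index G scale \<rho>"
    and Z: "\<And>f. f \<in> Z \<Longrightarrow> endo f" "conj_stable Z" "\<And>f g. f \<in> Z \<Longrightarrow> g \<in> Z \<Longrightarrow> (\<lambda>v. f (g v)) \<in> Z"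
      "\<And>f g v. f \<in> Z \<Longrightarrow> g \<in> Z \<Longrightarrow> f (g v) = g (f v)"
    and e: "e \<in> Z" "\<And>v. e (e v) = e v"
  shows "(\<forall>v. e v = 0) \<or> (\<forall>v. e v = v)"
proof (rule ccontr)
  assume "\<not> ?thesis"
  then obtain v1 v2 where v12: "e v1 \<noteq> 0" "e v2 \<noteq> v2" by blast
  define I where "I = (\<lambda>P. P \<in> Z \<and> (\<forall>v. P (P v) = P v) \<and> (\<exists>v. P v \<noteq> 0))"
  have "I e" using e v12 by (auto simp: I_def)
  then obtain P where P: "I P" and Pmin: "\<And>Q. I Q \<Longrightarrow> dim (range P) \<le> dim (range Q)"
    using arg_min_nat_lemma[of I e "\<lambda>P. dim (range P)"] by blast
  have PZ: "P \<in> Z" and PP: "P (P v) = P v" for v using P by (auto simp: I_def)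
  obtain u0 where u0: "P u0 \<noteq> 0" using P by (auto simp: I_def)
  have sub: "subspace (range f)" if "f \<in> Z" for f
    using endo_zero[OF Z(1)[OF that]] unfolding subspace_def
    by (auto simp flip: endo_addD[OF Z(1)[OF that]] endo_scaleD[OF Z(1)[OF that]])
  have "\<exists>v0. P v0 \<noteq> v0"
  proof (rule ccontr)
    assume "\<not> ?thesis"
    then have "range P = UNIV" by (simp add: image_def)
    then have "dim UNIV \<le> dim (range e)" using Pmin[OF \<open>I e\<close>] by simp
    then have "range e = UNIV" using subspace_dim_equal[OF sub[OF e(1)] subspace_UNIV] by simp
    then obtain x where "v2 = e x" by blast
    then show False using v12 e(2) by simp
  qed
  then obtain v0 where v0: "P v0 \<noteq> v0" by blast
  \<comment> \<open>The product is nonzero and its range lies in that of \<open>P\<close>; by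
    minimality the ranges agree, and \<open>Q\<close> is the identity on its own range.\<close>
  have absorb: "Q (P v) = P v" if Q: "Q \<in> Z" "\<And>v. Q (Q v) = Q v" and ne: "Q (P v') \<noteq> 0" for Q v v'
  proof -
    have "I (\<lambda>v. Q (P v))"
      unfolding I_def using Z(3)[OF Q(1) PZ] Z(4)[OF Q(1) PZ] Q(2) PP ne by metis
    then have "dim (range P) \<le> dim (range (\<lambda>v. Q (P v)))" by (rule Pmin)
    moreover have "range (\<lambda>v. Q (P v)) \<subseteq> range P"
      using Z(4)[OF Q(1) PZ] by auto
    ultimately have "range (\<lambda>v. Q (P v)) = range P"
      using subspace_dim_equal[OF sub[OF Z(3)[OF Q(1) PZ]] sub[OF PZ]] by simp
    then obtain x where "P v = Q (P x)" by (metis (no_types, lifting) imageE rangeI)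
    then show ?thesis using Q(2) by simp
  qed
  have "induced_from_proper_finite_index G scale \<rho>"
  proof (rule imprimitive_imp_induced[OF simple schur Z(1)[OF PZ] PP u0 v0])
    fix s assume s: "s \<in> carrier G"
    have idem: "conjugate t P (conjugate t P v) = conjugate t P v" if "t \<in> carrier G" for t v
      using that by (simp add: conjugate_def PP)
    have cZ: "conjugate t P \<in> Z" if "t \<in> carrier G" for t by (rule conj_stableD[OF Z(2) that PZ])
    show "conjugate s P = P \<or> (\<forall>v. P (conjugate s P v) = 0)"
    proof (rule ccontr)
      assume neg: "\<not> ?thesis"
      then obtain v where v: "P (conjugate s P v) \<noteq> 0" by blast
      have 1: "conjugate s P (P x) = P x" for x
      proof (rule absorb[OF cZ[OF s] idem[OF s]])
        show "conjugate s P (P v) \<noteq> 0" using v unfolding Z(4)[OF PZ cZ[OF s]] .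
      qed
      \<comment> \<open>The same argument for \<open>inv s\<close>, conjugated back by
        \<open>s\<close>, yields the opposite inclusion of the ranges, so the two commuting
        projections coincide.\<close>
      have "conjugate (inv s) P (P (\<rho> (inv s) v)) \<noteq> 0"
      proof
        assume "conjugate (inv s) P (P (\<rho> (inv s) v)) = 0"
        then have "\<rho> s (conjugate (inv s) P (P (\<rho> (inv s) v))) = 0"
          using endo_zero[OF rho_endo[OF s]] by simp
        then show False using v s by (simp add: conjugate_def)
      qed
      then have 2: "conjugate (inv s) P (P x) = P x" for x
        by (rule absorb[OF cZ[OF inv_closed[OF s]] idem[OF inv_closed[OF s]]])
      have "P (conjugate s P x) = conjugate s P x" for x
      proof -
        have "\<rho> s (conjugate (inv s) P (P (\<rho> (inv s) x))) = \<rho> s (P (\<rho> (inv s) x))" using 2 by simp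
        then show ?thesis using s by (simp add: conjugate_def)
      qed
      then have "conjugate s P x = P x" for x using 1[of x] unfolding Z(4)[OF PZ cZ[OF s]] by simp
      then show False using neg by auto
    qed
  qed
  then show False using ind by simp
qed

lemma cent_comp: "f \<in> cent S \<Longrightarrow> g \<in> cent S \<Longrightarrow> (\<lambda>v. f (g v)) \<in> cent S"
  using endo_comp[of f g] by (auto simp: cent_def comp_def)

text \<open>The kernel of \<open>z\<close> is stable under the commutant of \<open>Z\<close>, so a projection onto it
  lies in the bicommutant of \<open>Z\<close>, which is again commutative.\<close>

lemma commutative_normal_injective:
  assumes simple: simple_module and nz: "\<exists>v :: 'v. v \<noteq> 0"
    and schur: scalar_commutant
    and ind: "\<not> induced_from_proper_finite_index G scale \<rho>"
    and Z: "\<And>f. f \<in> Z \<Longrightarrow> endo f" "conj_stable Z"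
      "\<And>f g v. f \<in> Z \<Longrightarrow> g \<in> Z \<Longrightarrow> f (g v) = g (f v)"
    and z: "z \<in> Z" "z v = 0" "v \<noteq> 0"
  shows "z x = 0"
proof -
  define S where "S = cent Z"
  have S: "conj_stable S" "\<And>f. f \<in> S \<Longrightarrow> endo f"
    using cent_conj_stable[OF Z(2)] by (auto simp: S_def cent_endo)
  have ZS: "Z \<subseteq> S" using Z(1,3) by (auto simp: S_def cent_def)
  then have YS: "cent S \<subseteq> S" by (auto simp: S_def cent_def)
  define M where "M = {v. z v = 0}"
  have "stable S M"
    using Z(1)[OF z(1)] S(2) z(1)
    by (auto simp: stable_def M_def subspace_def endo_addD endo_scaleD endo_zero S_def simp flip: centD[of _ Z z])
  then obtain p where p: "p \<in> cent S" "\<And>v. p v \<in> M" "\<And>m. m \<in> M \<Longrightarrow> p m = m"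
    using stable_projection[OF simple nz S] by blast
  have "(\<forall>v. p v = 0) \<or> (\<forall>v. p v = v)"
  proof (rule commutative_idempotent_trivial[OF simple schur ind, of "cent S" p])
    show "conj_stable (cent S)" by (rule cent_conj_stable[OF S(1)])
    show "f (g v) = g (f v)" if "f \<in> cent S" "g \<in> cent S" for f g v
      using that YS by (auto intro: centD)
  qed (use p in \<open>auto simp: cent_endo intro: cent_comp\<close>)
  moreover have "p v = v" using z by (intro p(3)) (simp add: M_def)
  ultimately have "p x = x" using z(3) by auto
  then show ?thesis using p(2)[of x] by (simp add: M_def)
qed

text \<open>The commutant of \<open>S\<close> is the intersection of \<open>cent R\<close> with its
  own commutant. It is therefore contained in \<open>S\<close> and commutative, and the projection
  onto \<open>M\<close> is an idempotent in it.\<close>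

lemma normal_joint_simple:
  assumes simple: simple_module and nz: "\<exists>v :: 'v. v \<noteq> 0"
    and schur: scalar_commutant
    and ind: "\<not> induced_from_proper_finite_index G scale \<rho>"
    and R: "conj_stable R" "\<And>f. f \<in> R \<Longrightarrow> endo f"
    and M: "stable (R \<union> cent R) M" "M \<noteq> {0}"
  shows "M = UNIV"
proof -
  define S where "S = R \<union> cent R"
  have S: "conj_stable S" "\<And>f. f \<in> S \<Longrightarrow> endo f"
    using cent_conj_stable[OF R(1)] R by (auto simp: S_def conj_stable_def cent_endo)
  obtain p where p: "p \<in> cent S" "\<And>v. p v \<in> M" "\<And>m. m \<in> M \<Longrightarrow> p m = m"
    using stable_projection[OF simple nz S M(1)[folded S_def]] by blast
  have CS: "cent S \<subseteq> S" by (auto simp: S_def cent_def)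
  have "(\<forall>v. p v = 0) \<or> (\<forall>v. p v = v)"
  proof (rule commutative_idempotent_trivial[OF simple schur ind, of "cent S" p])
    show "conj_stable (cent S)" by (rule cent_conj_stable[OF S(1)])
    show "f (g v) = g (f v)" if "f \<in> cent S" "g \<in> cent S" for f g v
      using that CS by (auto intro: centD)
  qed (use p in \<open>auto simp: cent_endo intro: cent_comp\<close>)
  moreover obtain m where "m \<in> M" "m \<noteq> 0"
    using M by (auto simp: stable_def subspace_0)
  ultimately have "p v = v" for v using p(3)[of m] by auto
  then show ?thesis using p(2) by (metis UNIV_eq_I)
qed

end

section \<open>Density on a simple submodule\<close>

text \<open>Precomposing with the \<open>R\<close>-linear projection \<open>e\<close> turns maps
  defined on \<open>W\<close> alone into operators on \<open>V\<close>, so \<open>W\<close> needs no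
  type of its own.\<close>

locale simple_submodule = fin_rep scale Basis G \<rho>
  for scale :: "'k::field \<Rightarrow> 'v::ab_group_add \<Rightarrow> 'v" and Basis
    and G :: "('g, 'b) monoid_scheme" (structure) and \<rho> +
  fixes R :: "('v \<Rightarrow> 'v) set" and W :: "'v set" and e :: "'v \<Rightarrow> 'v"
  assumes R_subalgebra: "subalgebra_End scale R"
    and W_stable: "stable R W"
    and W_minimal: "\<And>W'. stable R W' \<Longrightarrow> W' \<subseteq> W \<Longrightarrow> W' = {0} \<or> W' = W"
    and W_nonzero: "W \<noteq> {0}"
    and e_cent: "e \<in> cent R"
    and e_W: "\<And>v. e v \<in> W" "\<And>w. w \<in> W \<Longrightarrow> e w = w"
begin

lemmas R_endo = subalgebra_endo[OF R_subalgebra]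
  and R_id = subalgebra_id[OF R_subalgebra]
  and R_add = subalgebra_add[OF R_subalgebra]
  and R_scale = subalgebra_scale[OF R_subalgebra]
  and R_mult = subalgebra_mult[OF R_subalgebra]
  and R_0 = subalgebra_zero[OF R_subalgebra]
  and R_sum = subalgebra_sum[OF R_subalgebra]

lemma R_diff: "r \<in> R \<Longrightarrow> t \<in> R \<Longrightarrow> (\<lambda>v. r v - t v) \<in> R"
  using R_add[OF _ R_scale[of t "-1"]] by simp

lemma W_subspace: "subspace W"
  using W_stable by (rule stable_subspace)

lemma R_W: "r \<in> R \<Longrightarrow> w \<in> W \<Longrightarrow> r w \<in> W"
  using W_stable by (rule stableD)

text \<open>The endomorphisms of the \<open>R\<close>-module \<open>W\<close>, as operators on \<open>V\<close> that factor through \<open>e\<close>.\<close>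

definition D :: "('v \<Rightarrow> 'v) set" where
  "D = {d \<in> cent R. \<forall>v. d v \<in> W \<and> d (e v) = d v}"

lemma D_endo: "d \<in> D \<Longrightarrow> endo d"
  and D_R: "d \<in> D \<Longrightarrow> r \<in> R \<Longrightarrow> d (r v) = r (d v)"
  and D_W: "d \<in> D \<Longrightarrow> d v \<in> W"
  and D_e: "d \<in> D \<Longrightarrow> d (e v) = d v"
  by (auto simp: D_def cent_endo intro: centD)

lemma e_endo: "endo e"
  using e_cent by (rule cent_endo)

lemma e_R: "r \<in> R \<Longrightarrow> e (r v) = r (e v)"
  using e_cent by (rule centD)

lemma D_extend:
  assumes W: "\<And>w. w \<in> W \<Longrightarrow> h w \<in> W"
    and "\<And>w w'. w \<in> W \<Longrightarrow> w' \<in> W \<Longrightarrow> h (w + w') = h w + h w'"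
    and "\<And>c w. w \<in> W \<Longrightarrow> h (scale c w) = scale c (h w)"
    and "\<And>r w. r \<in> R \<Longrightarrow> w \<in> W \<Longrightarrow> h (r w) = r (h w)"
  shows "(\<lambda>v. h (e v)) \<in> D"
proof -
  have "endo (\<lambda>v. h (e v))"
    using assms e_W(1) by (simp add: endo_iff endo_addD[OF e_endo] endo_scaleD[OF e_endo])
  then show ?thesis
    using assms e_W by (simp add: D_def cent_def e_R)
qed

lemma e_D: "e \<in> D"
  using e_cent e_W by (simp add: D_def)

lemma D_add: "d \<in> D \<Longrightarrow> d' \<in> D \<Longrightarrow> (\<lambda>v. d v + d' v) \<in> D"
  and D_scale: "d \<in> D \<Longrightarrow> (\<lambda>v. scale c (d v)) \<in> D"
  and D_mult: "d \<in> D \<Longrightarrow> d' \<in> D \<Longrightarrow> (\<lambda>v. d (d' v)) \<in> D"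
  and D_0: "(\<lambda>v. 0) \<in> D"
  using W_subspace endo_comp[of d d']
  by (auto simp: D_def cent_def endo_plus endo_smult endo_0 comp_def endo_addD R_endo endo_scaleD endo_zero
      subspace_add subspace_scale subspace_0)

text \<open>Schur's lemma: the kernel and the image of \<open>d\<close> on \<open>W\<close> are
  stable under \<open>R\<close>, so minimality makes \<open>d\<close> bijective on \<open>W\<close>.
  The identity of \<open>D\<close> is \<open>e\<close>.\<close>

lemma D_inverse:
  assumes d: "d \<in> D" "d v \<noteq> 0"
  obtains d' where "d' \<in> D" "\<And>v. d' (d v) = e v" "\<And>v. d (d' v) = e v"
proof -
  have "stable R {w \<in> W. d w = 0}"
    using W_subspace R_W D_endo[OF d(1)] D_R[OF d(1)] R_endo
    by (auto simp: stable_def subspace_def endo_addD endo_scaleD endo_zero)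
  then have "{w \<in> W. d w = 0} = {0} \<or> {w \<in> W. d w = 0} = W" by (rule W_minimal) auto
  moreover have "e v \<in> W" "d (e v) \<noteq> 0" using e_W d(2) D_e[OF d(1), of v] by auto
  ultimately have ker: "w = 0" if "w \<in> W" "d w = 0" for w using that by blast
  have inj: "w = w'" if "w \<in> W" "w' \<in> W" "d w = d w'" for w w'
    using ker[of "w - w'"] that W_subspace endo_diff[OF D_endo[OF d(1)]] by (simp add: subspace_diff)
  have "stable R (d ` W)"
    unfolding stable_def
  proof (intro conjI ballI)
    show "subspace (d ` W)"
      using W_subspace D_endo[OF d(1)] unfolding subspace_def
      by (auto simp flip: endo_addD endo_scaleD intro!: image_eqI[of 0 d 0] simp: endo_zero)
    show "r w \<in> d ` W" if "r \<in> R" "w \<in> d ` W" for r w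
      using that R_W by (auto simp flip: D_R[OF d(1)])
  qed
  moreover have "d ` W \<subseteq> W" using D_W[OF d(1)] by blast
  ultimately have "d ` W = {0} \<or> d ` W = W" by (rule W_minimal)
  then have surj: "d ` W = W" using \<open>e v \<in> W\<close> \<open>d (e v) \<noteq> 0\<close> by blast
  then have "\<forall>w\<in>W. \<exists>u\<in>W. d u = w" by (metis imageE)
  then obtain h where h: "\<And>w. w \<in> W \<Longrightarrow> h w \<in> W" "\<And>w. w \<in> W \<Longrightarrow> d (h w) = w" by metis
  have "(\<lambda>v. h (e v)) \<in> D"
  proof (rule D_extend[OF h(1)])
    show "h (w + w') = h w + h w'" if "w \<in> W" "w' \<in> W" for w w'
      by (rule inj) (use that h W_subspace in \<open>simp_all add: subspace_add endo_addD[OF D_endo[OF d(1)]]\<close>)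
    show "h (scale c w) = scale c (h w)" if "w \<in> W" for c w
      by (rule inj) (use that h W_subspace in \<open>simp_all add: subspace_scale endo_scaleD[OF D_endo[OF d(1)]]\<close>)
    show "h (r w) = r (h w)" if "r \<in> R" "w \<in> W" for r w
      by (rule inj) (use that h R_W in \<open>simp_all add: D_R[OF d(1)]\<close>)
  qed
  moreover have "h (e (d v)) = e v" for v
  proof (rule inj)
    show "h (e (d v)) \<in> W" "e v \<in> W" using h(1) e_W(1) by auto
    show "d (h (e (d v))) = d (e v)"
      using h(2)[OF D_W[OF d(1)]] e_W(2)[OF D_W[OF d(1)]] D_e[OF d(1)] by simp
  qed
  moreover have "d (h (e v)) = e v" for v using h(2)[OF e_W(1)] .
  ultimately show ?thesis by (rule that)
qed

section \<open>The density theorem\<close>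

text \<open>The orbit of \<open>w\<close> under \<open>R\<close> is a stable subspace of the minimal
  \<open>W\<close> and contains \<open>w\<close>.\<close>

lemma R_transitive:
  assumes "w \<in> W" "w \<noteq> 0" "y \<in> W"
  shows "\<exists>r\<in>R. r w = y"
proof -
  have "stable R ((\<lambda>r. r w) ` R)"
    unfolding stable_def subspace_def
  proof (intro conjI ballI allI)
    show "0 \<in> (\<lambda>r. r w) ` R" using R_0 by force
    show "x + z \<in> (\<lambda>r. r w) ` R" if "x \<in> (\<lambda>r. r w) ` R" "z \<in> (\<lambda>r. r w) ` R" for x z
      using that R_add by force
    show "scale c x \<in> (\<lambda>r. r w) ` R" if "x \<in> (\<lambda>r. r w) ` R" for c x
      using that R_scale by force
    show "r x \<in> (\<lambda>r. r w) ` R" if "r \<in> R" "x \<in> (\<lambda>r. r w) ` R" for r x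
      using that R_mult by force
  qed
  moreover have "(\<lambda>r. r w) ` R \<subseteq> W" using R_W assms by blast
  ultimately have "(\<lambda>r. r w) ` R = {0} \<or> (\<lambda>r. r w) ` R = W" by (rule W_minimal)
  moreover have "w \<in> (\<lambda>r. r w) ` R" using R_id by force
  ultimately have "y \<in> (\<lambda>r. r w) ` R" using assms by auto
  then show ?thesis by blast
qed

text \<open>The span over the division algebra \<open>D\<close>, built one vector at a time so that
  inductions can peel vectors off the list.\<close>

primrec D_span :: "'v list \<Rightarrow> 'v set" where
  "D_span [] = {0}"
| "D_span (x # xs) = {d x + y |d y. d \<in> D \<and> y \<in> D_span xs}"

text \<open>The induction behind Jacobson's density theorem.\<close>

lemma annihilator_in_D_span:
  assumes "set ws \<subseteq> W" "w \<in> W" "\<And>r. r \<in> R \<Longrightarrow> (\<And>x. x \<in> set ws \<Longrightarrow> r x = 0) \<Longrightarrow> r w = 0"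
  shows "w \<in> D_span ws"
  using assms
proof (induction ws arbitrary: w)
  case Nil
  then have "w = 0" using R_id by force
  then show ?case by simp
next
  case (Cons x ws)
  \<comment> \<open>The annihilator of the remaining vectors is a left ideal of \<open>R\<close>, so
    the vectors \<open>r x\<close> with \<open>r\<close> in \<open>I\<close> form a stable subspace
    of \<open>W\<close>: zero or all of it.\<close>
  define I where "I = {r \<in> R. \<forall>y\<in>set ws. r y = 0}"
  have x: "x \<in> W" using Cons.prems by simp
  have kill: "r w = 0" if "r \<in> I" "r x = 0" for r
    using Cons.prems(3)[of r] that by (auto simp: I_def)
  have I: "r \<in> R" if "r \<in> I" for r using that by (simp add: I_def)
  have I_0: "(\<lambda>v. 0) \<in> I" and I_add: "\<And>r t. r \<in> I \<Longrightarrow> t \<in> I \<Longrightarrow> (\<lambda>v. r v + t v) \<in> I"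
    and I_diff: "\<And>r t. r \<in> I \<Longrightarrow> t \<in> I \<Longrightarrow> (\<lambda>v. r v - t v) \<in> I"
    and I_scale: "\<And>c r. r \<in> I \<Longrightarrow> (\<lambda>v. scale c (r v)) \<in> I"
    and I_mult: "\<And>r t. r \<in> R \<Longrightarrow> t \<in> I \<Longrightarrow> (\<lambda>v. r (t v)) \<in> I"
    by (auto simp: I_def R_0 R_add R_diff R_scale R_mult endo_zero[OF R_endo])
  show ?case
  proof (cases "\<forall>r\<in>I. r x = 0")
    case True
    then have "w \<in> D_span ws"
      using kill Cons.prems(1,2) by (intro Cons.IH) (auto simp: I_def)
    then show ?thesis using D_0 by force
  next
    case False
    have "stable R ((\<lambda>r. r x) ` I)"
      unfolding stable_def subspace_def
    proof (intro conjI ballI allI)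
      show "0 \<in> (\<lambda>r. r x) ` I" using I_0 by force
      show "y + z \<in> (\<lambda>r. r x) ` I" if "y \<in> (\<lambda>r. r x) ` I" "z \<in> (\<lambda>r. r x) ` I" for y z
        using that I_add by force
      show "scale c y \<in> (\<lambda>r. r x) ` I" if "y \<in> (\<lambda>r. r x) ` I" for c y
        using that I_scale by force
      show "r y \<in> (\<lambda>r. r x) ` I" if "r \<in> R" "y \<in> (\<lambda>r. r x) ` I" for r y
        using that I_mult by force
    qed
    moreover have "(\<lambda>r. r x) ` I \<subseteq> W" using R_W I x by blast
    ultimately have "(\<lambda>r. r x) ` I = {0} \<or> (\<lambda>r. r x) ` I = W" by (rule W_minimal)
    then have Ix: "(\<lambda>r. r x) ` I = W" using False by blast
    then have "\<exists>r\<in>I. r x = y" if "y \<in> W" for y using that by auto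
    then obtain s where s: "\<And>y. y \<in> W \<Longrightarrow> s y \<in> I" "\<And>y. y \<in> W \<Longrightarrow> s y x = y"
      by metis
    have well: "r w = t w" if "r \<in> I" "t \<in> I" "r x = t x" for r t
      using kill[OF I_diff[OF that(1,2)]] that(3) by simp
    \<comment> \<open>\<open>h\<close> sends \<open>r x\<close> to \<open>r w\<close> for
      \<open>r\<close> in \<open>I\<close>. This is unambiguous, as an element of \<open>I\<close>
      that kills \<open>x\<close> also kills \<open>w\<close>, and it commutes with
      \<open>R\<close>, hence gives an element of \<open>D\<close>.\<close>
    define h where "h = (\<lambda>y. s y w)"
    have h: "h (r x) = r w" if "r \<in> I" for r
    proof -
      have rx: "r x \<in> W" using R_W[OF I[OF that] x] .
      show ?thesis unfolding h_def by (rule well[OF s(1)[OF rx] that s(2)[OF rx]])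
    qed
    have d: "(\<lambda>v. h (e v)) \<in> D"
    proof (rule D_extend)
      show "h y \<in> W" if "y \<in> W" for y
        using R_W[OF I[OF s(1)[OF that]] Cons.prems(2)] by (simp add: h_def)
      show "h (y + z) = h y + h z" if "y \<in> W" "z \<in> W" for y z
        using h[OF I_add[OF s(1)[OF that(1)] s(1)[OF that(2)]]] s(2)[OF that(1)] s(2)[OF that(2)]
        by (simp add: h_def)
      show "h (scale c y) = scale c (h y)" if "y \<in> W" for c y
        using h[OF I_scale[OF s(1)[OF that]]] s(2)[OF that] by (simp add: h_def)
      show "h (r y) = r (h y)" if "r \<in> R" "y \<in> W" for r y
        using h[OF I_mult[OF that(1) s(1)[OF that(2)]]] s(2)[OF that(2)] by (simp add: h_def)
    qed
    define d where "d = (\<lambda>v. h (e v))"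
    have dD: "d \<in> D" using \<open>(\<lambda>v. h (e v)) \<in> D\<close> by (simp add: d_def)
    \<comment> \<open>By the choice of \<open>d\<close>, every element of \<open>I\<close> kills
      \<open>w - d x\<close>, which is what the induction hypothesis asks for the shorter
      list.\<close>
    have "w - d x \<in> D_span ws"
    proof (rule Cons.IH)
      show "w - d x \<in> W" using Cons.prems(2) D_W[OF dD] W_subspace by (simp add: subspace_diff)
      fix r assume "r \<in> R" "\<And>y. y \<in> set ws \<Longrightarrow> r y = 0"
      then have r: "r \<in> I" by (simp add: I_def)
      have "r (d x) = d (r x)" using D_R[OF dD I[OF r]] by simp
      also have "\<dots> = r w" using h[OF r] e_W(2)[OF R_W[OF I[OF r] x]] by (simp add: d_def)
      finally show "r (w - d x) = 0" using endo_diff[OF R_endo[OF I[OF r]]] by simp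
    qed (use Cons.prems in simp)
    moreover have "w = d x + (w - d x)" by simp
    ultimately show ?thesis using dD by force
  qed
qed

text \<open>Agreement of \<open>r\<close> and \<open>f\<close> on a list extends to its span over
  \<open>D\<close>. For a vector \<open>x\<close> outside this span some \<open>t\<close> in
  \<open>R\<close> kills the list but not \<open>x\<close>, and \<open>r\<close> is corrected by
  \<open>q\<close> after \<open>t\<close>, where \<open>q\<close> takes \<open>t x\<close> to the
  defect \<open>f x - r x\<close>. A basis of \<open>W\<close> over \<open>k\<close> is reached in
  finitely many such steps.\<close>

theorem density:
  assumes f: "endo f" "\<And>w. w \<in> W \<Longrightarrow> f w \<in> W" "\<And>d w. d \<in> D \<Longrightarrow> w \<in> W \<Longrightarrow> f (d w) = d (f w)"
  shows "\<exists>r\<in>R. \<forall>w\<in>W. r w = f w"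
proof -
  have agree: "r w = f w" if "r \<in> R" "set ws \<subseteq> W" "\<And>x. x \<in> set ws \<Longrightarrow> r x = f x" "w \<in> D_span ws" for r ws w
    using that(2-)
  proof (induction ws arbitrary: w)
    case Nil
    then show ?case using endo_zero[OF f(1)] endo_zero[OF R_endo[OF that(1)]] by simp
  next
    case (Cons x ws)
    then obtain d y where d: "d \<in> D" "y \<in> D_span ws" "w = d x + y" by auto
    have "r x = f x" "x \<in> W" using Cons.prems by auto
    then have "r (d x) = f (d x)" using D_R[OF d(1) that(1), of x] f(3)[OF d(1), of x] by simp
    moreover have "r y = f y" using Cons d by simp
    ultimately show ?case
      using d endo_addD[OF f(1)] endo_addD[OF R_endo[OF that(1)]] by simp
  qed
  have agree_list: "\<exists>r\<in>R. \<forall>x\<in>set ws. r x = f x" if "set ws \<subseteq> W" for ws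
    using that
  proof (induction ws)
    case Nil
    then show ?case using R_0 by auto
  next
    case (Cons x ws)
    then obtain r where r: "r \<in> R" "\<And>y. y \<in> set ws \<Longrightarrow> r y = f y" by auto
    have xW: "x \<in> W" "set ws \<subseteq> W" using Cons.prems by auto
    show ?case
    proof (cases "x \<in> D_span ws")
      case True
      then have "r x = f x" using agree[OF r(1) xW(2) r(2)] by blast
      then show ?thesis using r by auto
    next
      case False
      then obtain t where t: "t \<in> R" "\<And>y. y \<in> set ws \<Longrightarrow> t y = 0" "t x \<noteq> 0"
        using annihilator_in_D_span[OF xW(2,1)] by blast
      have "f x - r x \<in> W" using f(2)[OF xW(1)] R_W[OF r(1) xW(1)] W_subspace by (simp add: subspace_diff)
      then obtain q where q: "q \<in> R" "q (t x) = f x - r x"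
        using R_transitive[OF R_W[OF t(1) xW(1)] t(3)] by blast
      have "(\<lambda>v. r v + q (t v)) \<in> R" by (rule R_add[OF r(1) R_mult[OF q(1) t(1)]])
      moreover have "r y + q (t y) = f y" if "y \<in> set (x # ws)" for y
        using that r(2) t(2) q(2) endo_zero[OF R_endo[OF q(1)]] by (cases "y = x") auto
      ultimately show ?thesis by (intro bexI[of _ "\<lambda>v. r v + q (t v)"]) auto
    qed
  qed
  obtain B where B: "B \<subseteq> W" "independent B" "W \<subseteq> span B" "card B = dim W"
    using basis_exists[of W] by blast
  obtain ws where ws: "set ws = B" using finite_list[OF finiteI_independent[OF B(2)]] by blast
  obtain r where r: "r \<in> R" "\<forall>x\<in>B. r x = f x"
    using agree_list[of ws] B(1) unfolding ws by blast
  have "subspace {v. r v = f v}"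
    using f(1) R_endo[OF r(1)] by (auto simp: subspace_def endo_addD endo_scaleD endo_zero)
  then have "span B \<subseteq> {v. r v = f v}" by (rule span_minimal[rotated]) (use r in auto)
  then have "\<forall>w\<in>W. r w = f w" using B(3) by blast
  then show ?thesis using r(1) by blast
qed

end

section \<open>Finite fields and matrix units\<close>

context linear_space
begin

text \<open>The identity \<open>u\<close> is a parameter because \<open>D\<close> has the identity
  \<open>e\<close>, whereas a subalgebra of the endomorphisms of \<open>V\<close> has the identity
  operator.\<close>

definition operator_ring :: "('v \<Rightarrow> 'v) \<Rightarrow> ('v \<Rightarrow> 'v) set \<Rightarrow> ('v \<Rightarrow> 'v) ring" where
  "operator_ring u A = \<lparr>carrier = A, monoid.mult = (\<lambda>f g v. f (g v)), one = u,
     zero = (\<lambda>v. 0), add = (\<lambda>f g v. f v + g v)\<rparr>"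

lemma operator_ring_simps [simp]:
  "carrier (operator_ring u A) = A" "monoid.mult (operator_ring u A) = (\<lambda>f g v. f (g v))"
  "one (operator_ring u A) = u" "zero (operator_ring u A) = (\<lambda>v. 0)"
  "add (operator_ring u A) = (\<lambda>f g v. f v + g v)"
  by (simp_all add: operator_ring_def)

text \<open>The last clause makes the corners between the idempotents \<open>E i i\<close> consist
  of scalar multiples of matrix units. Hence the matrix units span \<open>R\<close>, and for nonzero
  \<open>V\<close> this says that \<open>R\<close> is the full matrix algebra of size
  \<open>n\<close> over \<open>k\<close>.\<close>

definition matrix_unit_system :: "('v \<Rightarrow> 'v) set \<Rightarrow> nat \<Rightarrow> (nat \<Rightarrow> nat \<Rightarrow> 'v \<Rightarrow> 'v) \<Rightarrow> bool" where
  "matrix_unit_system R n E \<longleftrightarrow>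
    (\<forall>i<n. \<forall>j<n. E i j \<in> R) \<and>
    (\<forall>i<n. \<forall>j<n. \<forall>k<n. \<forall>l<n. \<forall>v. E i j (E k l v) = (if j = k then E i l v else 0)) \<and>
    (\<forall>v. (\<Sum>i<n. E i i v) = v) \<and>
    (\<forall>r\<in>R. \<forall>i<n. \<forall>j<n. \<exists>c. \<forall>v. E i i (r (E j j v)) = scale c (E i j v))"

lemma matrix_unit_mem: "matrix_unit_system R n E \<Longrightarrow> i < n \<Longrightarrow> j < n \<Longrightarrow> E i j \<in> R"
  and matrix_unit_mult: "matrix_unit_system R n E \<Longrightarrow> i < n \<Longrightarrow> j < n \<Longrightarrow> k < n \<Longrightarrow> l < n \<Longrightarrow>
    E i j (E k l v) = (if j = k then E i l v else 0)"
  and matrix_unit_sum: "matrix_unit_system R n E \<Longrightarrow> (\<Sum>i<n. E i i v) = v"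
  and matrix_unit_corner: "matrix_unit_system R n E \<Longrightarrow> r \<in> R \<Longrightarrow> i < n \<Longrightarrow> j < n \<Longrightarrow>
    \<exists>c. \<forall>v. E i i (r (E j j v)) = scale c (E i j v)"
  by (simp_all add: matrix_unit_system_def)

lemma ring_operator_ring:
  assumes endo: "\<And>f. f \<in> A \<Longrightarrow> endo f"
    and add: "\<And>f g. f \<in> A \<Longrightarrow> g \<in> A \<Longrightarrow> (\<lambda>v. f v + g v) \<in> A"
    and smult: "\<And>c f. f \<in> A \<Longrightarrow> (\<lambda>v. scale c (f v)) \<in> A"
    and mult: "\<And>f g. f \<in> A \<Longrightarrow> g \<in> A \<Longrightarrow> (\<lambda>v. f (g v)) \<in> A"
    and u: "u \<in> A" "\<And>f v. f \<in> A \<Longrightarrow> u (f v) = f v" "\<And>f v. f \<in> A \<Longrightarrow> f (u v) = f v"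
  shows "ring (operator_ring u A)"
proof (rule ringI)
  show "abelian_group (operator_ring u A)"
  proof (rule abelian_groupI)
    show "\<zero>\<^bsub>operator_ring u A\<^esub> \<in> carrier (operator_ring u A)"
      using smult[OF u(1), of 0] by simp
    fix f assume "f \<in> carrier (operator_ring u A)"
    then show "\<exists>g\<in>carrier (operator_ring u A). g \<oplus>\<^bsub>operator_ring u A\<^esub> f = \<zero>\<^bsub>operator_ring u A\<^esub>"
      using smult[of f "-1"] by (intro bexI[of _ "\<lambda>v. scale (-1) (f v)"]) auto
  qed (auto simp: add ac_simps)
  show "monoid (operator_ring u A)"
    by (rule monoidI) (use mult u in auto)
qed (use endo in \<open>auto simp: endo_addD\<close>)

end

context fin_linear_space
begin

lemma finite_space:
  assumes "finite (UNIV :: 'k set)"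
  shows "finite (UNIV :: 'v set)"
proof -
  obtain \<phi> n where \<phi>: "coords UNIV n \<phi>" using coords_exist[OF subspace_UNIV] by blast
  have "carrier_vec n \<subseteq> vec_of_list ` {xs :: 'k list. set xs \<subseteq> UNIV \<and> length xs = n}"
  proof
    fix x :: "'k vec" assume "x \<in> carrier_vec n"
    then show "x \<in> vec_of_list ` {xs :: 'k list. set xs \<subseteq> UNIV \<and> length xs = n}"
      by (intro image_eqI[of _ _ "list_of_vec x"]) (auto simp: vec_list)
  qed
  then have "finite (carrier_vec n :: 'k vec set)"
    by (rule finite_subset) (rule finite_imageI[OF finite_lists_length_eq[OF assms]])
  moreover have "bij_betw \<phi> UNIV (carrier_vec n)" using \<phi> by (simp add: coords_def)
  ultimately show ?thesis by (simp add: bij_betw_finite)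
qed

lemma finite_operators:
  assumes "finite (UNIV :: 'k set)"
  shows "finite (A :: ('v \<Rightarrow> 'v) set)"
proof -
  have "finite (PiE (UNIV :: 'v set) (\<lambda>_. UNIV :: 'v set))"
    using finite_space[OF assms] by (intro finite_PiE) auto
  moreover have "A \<subseteq> PiE UNIV (\<lambda>_. UNIV)" by auto
  ultimately show ?thesis by (rule finite_subset[rotated])
qed

end

context fin_rep
begin

text \<open>\<open>Z\<close> is a finite field, so its automorphisms commute with each other and a perfect group acts
  trivially on it.\<close>

lemma commutative_normal_scalar:
  assumes simple: simple_module and nz: "\<exists>v :: 'v. v \<noteq> 0"
    and schur: scalar_commutant
    and ind: "\<not> induced_from_proper_finite_index G scale \<rho>"
    and perfect: "derived G (carrier G) = carrier G" and fin: "finite (UNIV :: 'k set)"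
    and Z: "subalgebra_End scale Z" "conj_stable Z"
      "\<And>f g v. f \<in> Z \<Longrightarrow> g \<in> Z \<Longrightarrow> f (g v) = g (f v)"
    and z: "z \<in> Z"
  shows "\<exists>c. z = scale c"
proof -
  note endo = subalgebra_endo[OF Z(1)] and id = subalgebra_id[OF Z(1)]
    and add = subalgebra_add[OF Z(1)] and smult = subalgebra_scale[OF Z(1)]
    and mult = subalgebra_mult[OF Z(1)]
  have finZ: "finite Z" by (rule finite_operators[OF fin])
  define F where "F = operator_ring (\<lambda>v. v) Z"
  have F: "carrier F = Z" "monoid.mult F = (\<lambda>f g v. f (g v))" "one F = (\<lambda>v. v)" "zero F = (\<lambda>v. 0)"
    by (simp_all add: F_def)
  interpret F: ring F
    unfolding F_def by (rule ring_operator_ring, (fact endo add smult mult id)+) (rule refl)+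
  have inj: "x = y" if f: "f \<in> Z" "f \<noteq> (\<lambda>v. 0)" and eq: "f x = f y" for f x y
  proof (rule ccontr)
    assume "x \<noteq> y"
    have fxy: "f (x - y) = 0" using eq endo_diff[OF endo[OF f(1)]] by simp
    have "f v = 0" for v
      by (rule commutative_normal_injective[OF simple nz schur ind, of Z f "x - y"])
        (use endo Z(2) f(1) fxy \<open>x \<noteq> y\<close> in \<open>auto intro: Z(3)\<close>)
    then show False using f(2) by auto
  qed
  interpret F: cring F
    by (intro cring.intro F.ring_axioms F.monoid_comm_monoidI) (use Z(3) F in auto)
  interpret F: field F
  proof (rule F.cring_fieldI2)
    show "\<zero>\<^bsub>F\<^esub> \<noteq> \<one>\<^bsub>F\<^esub>" using nz by (auto simp: F fun_eq_iff)
    fix f assume "f \<in> carrier F" "f \<noteq> \<zero>\<^bsub>F\<^esub>"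
    then have f: "f \<in> Z" "f \<noteq> (\<lambda>v. 0)" by (auto simp: F)
    \<comment> \<open>A nonzero \<open>f\<close> is injective on \<open>V\<close>, so left
      multiplication by it is injective on the finite set \<open>Z\<close>, hence onto, and it
      reaches the identity.\<close>
    have "inj_on (\<lambda>g v. f (g v)) Z"
      by (rule inj_onI) (use inj[OF f] in \<open>auto simp: fun_eq_iff\<close>)
    moreover have "(\<lambda>g v. f (g v)) ` Z \<subseteq> Z" using mult f by auto
    ultimately have "(\<lambda>g v. f (g v)) ` Z = Z" using finZ by (simp add: endo_inj_surj)
    then have "(\<lambda>v. v) \<in> (\<lambda>g v. f (g v)) ` Z" using id by simp
    then show "\<exists>g\<in>carrier F. f \<otimes>\<^bsub>F\<^esub> g = \<one>\<^bsub>F\<^esub>" unfolding F by (metis imageE)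
  qed
  obtain a where a: "a \<in> Z" "a \<noteq> (\<lambda>v. 0)" and gen: "\<And>f. f \<in> Z \<Longrightarrow> f \<noteq> (\<lambda>v. 0) \<Longrightarrow> \<exists>i :: nat. f = a [^]\<^bsub>F\<^esub> i"
    using F.finite_field_mult_group_has_gen finZ by (auto simp: F)
  have conjZ: "conjugate s f \<in> Z" if "s \<in> carrier G" "f \<in> Z" for s f
    using Z(2) that by (rule conj_stableD)
  have conj_pow: "conjugate s (f [^]\<^bsub>F\<^esub> i) = conjugate s f [^]\<^bsub>F\<^esub> i" if "s \<in> carrier G" "f \<in> Z" for s f and i :: nat
  proof (induction i)
    case 0
    show ?case using that(1) by (simp add: F conjugate_def)
  next
    case (Suc i)
    then show ?case using conjugate_comp[OF that(1)] by (simp add: F)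
  qed
  \<comment> \<open>Conjugation is multiplicative on \<open>Z\<close>, so it is determined by the
    exponent to which it raises the generator \<open>a\<close>. Raising to powers commutes, and so
    do the conjugations.\<close>
  have conj_gen: "\<exists>i :: nat. conjugate s a = a [^]\<^bsub>F\<^esub> i" if s: "s \<in> carrier G" for s
  proof (rule gen)
    show "conjugate s a \<noteq> (\<lambda>v. 0)"
    proof
      assume 0: "conjugate s a = (\<lambda>v. 0)"
      have "a = conjugate (inv s) (conjugate s a)" using conjugate_inv[OF s] by simp
      also have "\<dots> = (\<lambda>v. 0)" using s endo_zero[OF rho_endo[of "inv s"]] unfolding 0 by (simp add: conjugate_def)
      finally show False using a by simp
    qed
  qed (use conjZ s a in simp)
  have comm_a: "conjugate s (conjugate t a) = conjugate t (conjugate s a)"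
    if st: "s \<in> carrier G" "t \<in> carrier G" for s t
  proof -
    obtain i j :: nat where i: "conjugate s a = a [^]\<^bsub>F\<^esub> i" and j: "conjugate t a = a [^]\<^bsub>F\<^esub> j"
      using conj_gen st by metis
    have "conjugate s (conjugate t a) = (a [^]\<^bsub>F\<^esub> i) [^]\<^bsub>F\<^esub> j"
      unfolding j conj_pow[OF st(1) a(1)] i ..
    moreover have "conjugate t (conjugate s a) = (a [^]\<^bsub>F\<^esub> j) [^]\<^bsub>F\<^esub> i"
      unfolding i conj_pow[OF st(2) a(1)] j ..
    ultimately show ?thesis using a by (simp add: F.nat_pow_pow F mult.commute)
  qed
  define K where "K = {s \<in> carrier G. conjugate s a = a}"
  have K: "subgroup K G"
  proof (rule subgroupI)
    show "K \<noteq> {}" using conjugate_one[of a] by (auto simp: K_def)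
    show "inv s \<in> K" if "s \<in> K" for s
      using that conjugate_inv[of s a] by (auto simp: K_def)
  qed (auto simp: K_def conjugate_mult)
  \<comment> \<open>As conjugations commute on \<open>a\<close>, every commutator fixes
    \<open>a\<close>; perfectness then puts all of \<open>G\<close> into \<open>K\<close>.\<close>
  have "derived_set G (carrier G) \<subseteq> K"
  proof
    fix x assume "x \<in> derived_set G (carrier G)"
    then obtain s t where st: "s \<in> carrier G" "t \<in> carrier G" "x = s \<otimes> t \<otimes> inv s \<otimes> inv t" by blast
    have "conjugate x a = conjugate s (conjugate t (conjugate (inv s) (conjugate (inv t) a)))"
      using st by (simp add: conjugate_mult)
    also have "\<dots> = conjugate s (conjugate t (conjugate (inv t) (conjugate (inv s) a)))"
      using comm_a[of "inv s" "inv t"] st by simp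
    also have "\<dots> = a"
      using st conjugate_inv[of "inv s"] conjugate_inv[of "inv t"] by simp
    finally show "x \<in> K" using st by (simp add: K_def)
  qed
  then have "derived G (carrier G) \<subseteq> K"
    unfolding derived_def using K by (rule generate_subgroup_incl)
  then have fix_a: "conjugate s a = a" if "s \<in> carrier G" for s
    using that unfolding perfect K_def by blast
  have fix_z: "conjugate s z = z" if s: "s \<in> carrier G" for s
  proof (cases "z = (\<lambda>v. 0)")
    case True
    then show ?thesis using s endo_zero[OF rho_endo[OF s]] by (simp add: conjugate_def)
  next
    case False
    then obtain i :: nat where "z = a [^]\<^bsub>F\<^esub> i" using gen z by blast
    then show ?thesis using conj_pow[OF s a(1), of i] fix_a[OF s] by simp
  qed
  show ?thesis
  proof (rule scalar_commutantD[OF schur endo[OF z]])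
    fix s v assume s: "s \<in> carrier G"
    have "conjugate s z (\<rho> s v) = z (\<rho> s v)" using fix_z[OF s] by simp
    then show "z (\<rho> s v) = \<rho> s (z v)" unfolding conjugate_def rho_inv(1)[OF s] by (rule sym)
  qed
qed

end

section \<open>Endomorphisms of \<open>W\<close> are scalars, and matrix units in
  \<open>R\<close>\<close>

context simple_submodule
begin

lemma D_commutative:
  assumes fin: "finite (UNIV :: 'k set)" and "d \<in> D" "d' \<in> D"
  shows "d (d' v) = d' (d v)"
proof -
  define F where "F = operator_ring e D"
  have F: "carrier F = D" "monoid.mult F = (\<lambda>f g v. f (g v))" "one F = e" "zero F = (\<lambda>v. 0)"
    by (simp_all add: F_def)
  interpret F: ring F
    unfolding F_def
    by (rule ring_operator_ring) (fact D_endo D_add D_scale D_mult e_D D_e e_W(2)[OF D_W])+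
  have "e \<noteq> (\<lambda>v. 0)"
  proof
    assume "e = (\<lambda>v. 0)"
    then have "w = 0" if "w \<in> W" for w using e_W(2)[OF that] by simp
    then show False using W_nonzero W_subspace by (auto simp: subspace_0)
  qed
  have "Units F = carrier F - {\<zero>\<^bsub>F\<^esub>}"
  proof (intro equalityI subsetI)
    fix f assume f: "f \<in> Units F"
    then obtain g where g: "g \<in> D" "(\<lambda>v. g (f v)) = e" by (auto simp: Units_def F)
    have "f \<noteq> (\<lambda>v. 0)"
    proof
      assume "f = (\<lambda>v. 0)"
      then have "e = (\<lambda>v. 0)" using g endo_zero[OF D_endo[OF g(1)]] by simp
      then show False using \<open>e \<noteq> (\<lambda>v. 0)\<close> by simp
    qed
    then show "f \<in> carrier F - {\<zero>\<^bsub>F\<^esub>}" using f by (simp add: Units_def F)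
  next
    fix f assume "f \<in> carrier F - {\<zero>\<^bsub>F\<^esub>}"
    then have f: "f \<in> D" "f \<noteq> (\<lambda>v. 0)" by (auto simp: F)
    then obtain v where "f v \<noteq> 0" by auto
    then obtain g where "g \<in> D" "\<And>v. g (f v) = e v" "\<And>v. f (g v) = e v"
      using D_inverse[OF f(1)] by blast
    then show "f \<in> Units F" using f(1) by (auto simp: Units_def F intro!: bexI[of _ g])
  qed
  then have "d \<otimes>\<^bsub>F\<^esub> d' = d' \<otimes>\<^bsub>F\<^esub> d"
    using finite_operators[OF fin] assms by (intro F.finite_division_ring_commutative) (auto simp: F)
  then show ?thesis by (simp add: F fun_eq_iff)
qed

text \<open>As \<open>D\<close> is commutative, density applies to \<open>d\<close> itself and
  yields an element of \<open>R\<close> that agrees with \<open>d\<close> on \<open>W\<close>.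
  Faithfulness makes this element central in \<open>R\<close>, and the centre of a normal subalgebra
  is again normal.\<close>

lemma D_scalar_finite:
  assumes simple: simple_module and nz: "\<exists>v :: 'v. v \<noteq> 0"
    and schur: scalar_commutant
    and ind: "\<not> induced_from_proper_finite_index G scale \<rho>"
    and perfect: "derived G (carrier G) = carrier G" and fin: "finite (UNIV :: 'k set)"
    and conj: "conj_stable R"
    and faithful: "\<And>r. r \<in> R \<Longrightarrow> (\<And>w. w \<in> W \<Longrightarrow> r w = 0) \<Longrightarrow> r = (\<lambda>v. 0)"
    and d: "d \<in> D"
  shows "\<exists>c. \<forall>v. d v = scale c (e v)"
proof -
  have "\<exists>r\<in>R. \<forall>w\<in>W. r w = d w"
    using D_commutative[OF fin d] by (intro density D_endo d D_W) auto
  then obtain r where r: "r \<in> R" "\<And>w. w \<in> W \<Longrightarrow> r w = d w" by blast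
  have central: "r (t v) = t (r v)" if t: "t \<in> R" for t v
  proof -
    have "(\<lambda>v. r (t v) - t (r v)) = (\<lambda>v. 0)"
    proof (rule faithful)
      show "(\<lambda>v. r (t v) - t (r v)) \<in> R" by (rule R_diff[OF R_mult[OF r(1) t] R_mult[OF t r(1)]])
      show "r (t w) - t (r w) = 0" if "w \<in> W" for w
        using r(2)[OF that] r(2)[OF R_W[OF t that]] D_R[OF d t] by simp
    qed
    then have "r (t v) - t (r v) = 0" by (rule fun_cong)
    then show ?thesis by simp
  qed
  define Z where "Z = R \<inter> cent R"
  have "\<exists>c. r = scale c"
  proof (rule commutative_normal_scalar[OF simple nz schur ind perfect fin])
    show "subalgebra_End scale Z"
      using R_subalgebra cent_subalgebra[OF R_endo, of R] unfolding Z_def subalgebra_End_def by auto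
    show "conj_stable Z" using conj cent_conj_stable[OF conj] by (auto simp: Z_def conj_stable_def)
    show "f (g v) = g (f v)" if "f \<in> Z" "g \<in> Z" for f g v
      using that by (auto simp: Z_def intro: centD)
    show "r \<in> Z" using r(1) central R_endo by (auto simp: Z_def cent_def)
  qed
  then obtain c where c: "r = scale c" by blast
  have "d v = scale c (e v)" for v
    using r(2)[OF e_W(1)] D_e[OF d] c by metis
  then show ?thesis by blast
qed

text \<open>Subtracting the multiple of \<open>e\<close> by an eigenvalue of \<open>d\<close> gives
  an element of \<open>D\<close> that kills a nonzero vector of \<open>W\<close>, whereas a nonzero
  element of \<open>D\<close> is invertible.\<close>

lemma D_scalar_closed:
  assumes closed: "\<And>p :: 'k poly. degree p > 0 \<Longrightarrow> \<exists>x. poly p x = 0"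
    and d: "d \<in> D"
  shows "\<exists>c. \<forall>v. d v = scale c (e v)"
proof -
  obtain \<phi> where \<phi>: "coords W (dim W) \<phi>" using coords_exist[OF W_subspace] by blast
  obtain A where A: "A \<in> carrier_mat (dim W) (dim W)" "\<And>w. w \<in> W \<Longrightarrow> \<phi> (d w) = A *\<^sub>v \<phi> w"
    using coords_matrix[OF \<phi> D_endo[OF d] D_W[OF d]] by blast
  have "dim W > 0"
    using W_nonzero W_subspace by (auto simp: subspace_0 intro!: Nat.gr0I)
  then obtain c x where x: "x \<in> carrier_vec (dim W)" "x \<noteq> 0\<^sub>v (dim W)" "A *\<^sub>v x = c \<cdot>\<^sub>v x"
    using eigenvector_exists[OF A(1) _ closed] by blast
  define w where "w = uncoords W \<phi> x"
  have w: "w \<in> W" "\<phi> w = x" using uncoords[OF \<phi> x(1)] by (auto simp: w_def)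
  have "w \<noteq> 0" using coords_zero[OF \<phi>] w x(2) by auto
  have "d w = scale c w"
  proof (rule coords_inj[OF \<phi>])
    show "\<phi> (d w) = \<phi> (scale c w)" using A(2)[OF w(1)] coords_scale[OF \<phi> w(1)] w(2) x(3) by simp
  qed (use w W_subspace D_W[OF d] in \<open>auto simp: subspace_scale\<close>)
  define g where "g = (\<lambda>v. d v + scale (- c) (e v))"
  have gD: "g \<in> D" unfolding g_def by (rule D_add[OF d D_scale[OF e_D]])
  have gw: "g w = 0" using \<open>d w = scale c w\<close> e_W(2)[OF w(1)] by (simp add: g_def)
  have "g v = 0" for v
  proof (rule ccontr)
    assume "g v \<noteq> 0"
    then obtain g' where g': "g' \<in> D" "\<And>v. g' (g v) = e v" "\<And>v. g (g' v) = e v"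
      using D_inverse[OF gD] by blast
    have "w = g' (g w)" using g'(2) e_W(2)[OF w(1)] by simp
    also have "\<dots> = 0" using gw endo_zero[OF D_endo[OF g'(1)]] by simp
    finally show False using \<open>w \<noteq> 0\<close> by simp
  qed
  then have "d v = scale c (e v)" for v by (simp add: g_def eq_neg_iff_add_eq_0 add_eq_0_iff)
  then show ?thesis by blast
qed

text \<open>Since \<open>D\<close> acts on \<open>W\<close> by scalars, density imposes no
  restriction and realises the elementary matrices of a basis of \<open>W\<close> in
  \<open>R\<close>. Faithfulness lets identities in \<open>R\<close> be checked on that
  basis.\<close>

lemma matrix_units:
  assumes faithful: "\<And>r. r \<in> R \<Longrightarrow> (\<And>w. w \<in> W \<Longrightarrow> r w = 0) \<Longrightarrow> r = (\<lambda>v. 0)"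
    and scalar: "\<And>d. d \<in> D \<Longrightarrow> \<exists>c. \<forall>v. d v = scale c (e v)"
  shows "\<exists>n E. n > 0 \<and> matrix_unit_system R n E"
proof -
  obtain B where B: "B \<subseteq> W" "independent B" "W \<subseteq> span B" "card B = dim W"
    using basis_exists[of W] by blast
  have finB: "finite B" using B(2) by (rule finiteI_independent)
  define n where "n = card B"
  obtain b where b: "bij_betw b {..<n} B"
    using ex_bij_betw_nat_finite[OF finB] by (auto simp: lessThan_atLeast0 n_def)
  have bB: "b i \<in> B" if "i < n" for i using b that by (auto simp: bij_betw_def)
  have bW: "b i \<in> W" if "i < n" for i using bB B(1) that by blast
  have b_eq: "b i = b j \<longleftrightarrow> i = j" if "i < n" "j < n" for i j
    using b that by (auto simp: bij_betw_def inj_on_def)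
  have "n > 0"
  proof (rule Nat.gr0I)
    assume "n = 0"
    then have "W \<subseteq> {0}" using B(3) finB by (simp add: n_def)
    then show False using W_nonzero W_subspace by (auto simp: subspace_0)
  qed
  have R_ext: "r = t" if rt: "r \<in> R" "t \<in> R" and eq: "\<And>k. k < n \<Longrightarrow> r (b k) = t (b k)" for r t
  proof -
    have "subspace {v. r v = t v}"
      using R_endo[OF rt(1)] R_endo[OF rt(2)] by (auto simp: subspace_def endo_addD endo_scaleD endo_zero)
    moreover have "B \<subseteq> {v. r v = t v}" using eq b by (auto simp: bij_betw_def)
    ultimately have "span B \<subseteq> {v. r v = t v}" by (rule span_minimal[rotated])
    then have "(\<lambda>v. r v - t v) = (\<lambda>v. 0)" using B(3) by (intro faithful R_diff rt) auto
    then have "r v - t v = 0" for v by (rule fun_cong)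
    then show "r = t" by (simp add: fun_eq_iff)
  qed
  have "\<exists>r\<in>R. \<forall>k<n. r (b k) = (if k = j then b i else 0)" if ij: "i < n" "j < n" for i j
  proof -
    let ?g = "\<lambda>x. if x = b j then b i else 0"
    obtain f where f: "endo f" "\<forall>x\<in>B. f x = ?g x" "range f = span (?g ` B)"
      using linear_extension[OF B(2), of ?g] by blast
    have "span (?g ` B) \<subseteq> W"
      by (rule span_minimal) (use bW[OF ij(1)] W_subspace in \<open>auto simp: subspace_0\<close>)
    then have fW: "f v \<in> W" for v using f(3) by blast
    have "\<exists>r\<in>R. \<forall>w\<in>W. r w = f w"
    proof (rule density[OF f(1) fW])
      fix d w assume dw: "d \<in> D" "w \<in> W"
      obtain c where "\<forall>v. d v = scale c (e v)" using scalar[OF dw(1)] by blast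
      then show "f (d w) = d (f w)" using e_W(2)[OF dw(2)] e_W(2)[OF fW] endo_scaleD[OF f(1)] by simp
    qed
    then obtain r where r: "r \<in> R" "\<And>w. w \<in> W \<Longrightarrow> r w = f w" by blast
    have "r (b k) = (if k = j then b i else 0)" if "k < n" for k
      using r(2)[OF bW[OF that]] f(2) bB[OF that] b_eq[OF that ij(2)] by simp
    then show ?thesis using r(1) by blast
  qed
  then obtain E where E: "\<And>i j. i < n \<Longrightarrow> j < n \<Longrightarrow> E i j \<in> R"
    and Eb: "\<And>i j k. i < n \<Longrightarrow> j < n \<Longrightarrow> k < n \<Longrightarrow> E i j (b k) = (if k = j then b i else 0)"
    by metis
  have E0: "E i j 0 = 0" if "i < n" "j < n" for i j using endo_zero[OF R_endo[OF E[OF that]]] .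
  have "E i j (E k l v) = (if j = k then E i l v else 0)" if "i < n" "j < n" "k < n" "l < n" for i j k l v
  proof -
    have "(\<lambda>v. E i j (E k l v)) = (\<lambda>v. if j = k then E i l v else 0)"
    proof (rule R_ext)
      show "(\<lambda>v. E i j (E k l v)) \<in> R" by (rule R_mult[OF E[OF that(1,2)] E[OF that(3,4)]])
      show "(\<lambda>v. if j = k then E i l v else 0) \<in> R" using that by (cases "j = k") (auto intro: E R_0)
    qed (use that in \<open>simp add: Eb E0\<close>)
    then show ?thesis by (rule fun_cong)
  qed
  moreover have "(\<Sum>i<n. E i i v) = v" for v
  proof -
    have "(\<lambda>v. \<Sum>i<n. E i i v) = (\<lambda>v. v)"
      by (rule R_ext[OF R_sum R_id]) (simp_all add: E Eb)
    then show ?thesis by (rule fun_cong)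
  qed
  moreover have "\<exists>c. \<forall>v. E i i (r (E j j v)) = scale c (E i j v)" if r: "r \<in> R" and ij: "i < n" "j < n" for r i j
  proof -
    \<comment> \<open>On \<open>W\<close> the operator \<open>E i i\<close> takes values in the line
      of \<open>b i\<close>; applied to \<open>r (b j)\<close> this yields the scalar of the
      corner.\<close>
    have "subspace {w. \<exists>c. E i i w = scale c (b i)}"
      unfolding subspace_def
    proof (intro conjI ballI allI)
      show "0 \<in> {w. \<exists>c. E i i w = scale c (b i)}" using E0 ij by (auto intro: exI[of _ 0])
      show "x + y \<in> {w. \<exists>c. E i i w = scale c (b i)}"
        if "x \<in> {w. \<exists>c. E i i w = scale c (b i)}" "y \<in> {w. \<exists>c. E i i w = scale c (b i)}" for x y
        using that endo_addD[OF R_endo[OF E[OF ij(1,1)]]] by (auto simp flip: scale_left_distrib)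
      show "scale a x \<in> {w. \<exists>c. E i i w = scale c (b i)}"
        if "x \<in> {w. \<exists>c. E i i w = scale c (b i)}" for a x
        using that endo_scaleD[OF R_endo[OF E[OF ij(1,1)]]] by auto
    qed
    moreover have "B \<subseteq> {w. \<exists>c. E i i w = scale c (b i)}"
    proof
      fix x assume "x \<in> B"
      then obtain k where k: "k < n" "x = b k" using b by (auto simp: bij_betw_def)
      have "E i i x = scale (if k = i then 1 else 0) (b i)" using Eb ij k by simp
      then show "x \<in> {w. \<exists>c. E i i w = scale c (b i)}" by blast
    qed
    ultimately have "span B \<subseteq> {w. \<exists>c. E i i w = scale c (b i)}" by (rule span_minimal[rotated])
    then obtain c where c: "E i i (r (b j)) = scale c (b i)"
      using R_W[OF r bW[OF ij(2)]] B(3) by blast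
    have "E i i (r (E j j v)) = scale c (E i j v)" for v
    proof -
      have "(\<lambda>v. E i i (r (E j j v))) = (\<lambda>v. scale c (E i j v))"
      proof (rule R_ext)
        show "(\<lambda>v. E i i (r (E j j v))) \<in> R"
          by (rule R_mult[OF E[OF ij(1,1)] R_mult[OF r E[OF ij(2,2)]]])
        show "(\<lambda>v. scale c (E i j v)) \<in> R" by (rule R_scale[OF E[OF ij]])
      qed (use ij c E0 endo_zero[OF R_endo[OF r]] in \<open>simp add: Eb\<close>)
      then show ?thesis by (rule fun_cong)
    qed
    then show ?thesis by blast
  qed
  ultimately have "matrix_unit_system R n E" using E unfolding matrix_unit_system_def by blast
  then show ?thesis using \<open>n > 0\<close> by blast
qed

end

section \<open>Kronecker products\<close>

lemma div_mod_block [simp]: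
  fixes j d :: nat
  assumes "j < d"
  shows "(i * d + j) div d = i" "(i * d + j) mod d = j"
  using assms by simp_all

lemma block_less:
  fixes i :: nat
  assumes "i < n" "j < d"
  shows "i * d + j < n * d"
proof -
  have "i * d + j < (i + 1) * d" using assms by simp
  also have "\<dots> \<le> n * d" using assms by (intro mult_right_mono) auto
  finally show ?thesis .
qed

lemma sum_blocks:
  fixes f :: "nat \<Rightarrow> 'a::comm_monoid_add"
  shows "(\<Sum>m<n * d. f m) = (\<Sum>i<n. \<Sum>j<d. f (i * d + j))"
proof -
  have "sum f {i * d..<i * d + d} = (\<Sum>j<d. f (i * d + j))" for i
    using sum.shift_bounds_nat_ivl[of f 0 "i * d" d] by (simp add: lessThan_atLeast0 add.commute)
  then show ?thesis using sum.nat_group[of f d n] by simp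
qed

lemma kronecker_carrier:
  "A \<in> carrier_mat n n \<Longrightarrow> B \<in> carrier_mat d d \<Longrightarrow> kronecker A B \<in> carrier_mat (n * d) (n * d)"
  by (auto simp: kronecker_def)

lemma kronecker_index:
  fixes A B :: "'k::field mat"
  assumes "A \<in> carrier_mat n n" "B \<in> carrier_mat d d" "i < n" "k < n" "j < d" "l < d"
  shows "kronecker A B $$ (i * d + j, k * d + l) = A $$ (i, k) * B $$ (j, l)"
  using assms block_less[of i n j d] block_less[of k n l d] by (simp add: kronecker_def)

lemma eq_mat_blocks:
  fixes A B :: "'a mat"
  assumes "A \<in> carrier_mat (n * d) (n * d)" "B \<in> carrier_mat (n * d) (n * d)"
    and "\<And>i j k l. i < n \<Longrightarrow> j < d \<Longrightarrow> k < n \<Longrightarrow> l < d \<Longrightarrow> A $$ (i * d + j, k * d + l) = B $$ (i * d + j, k * d + l)"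
  shows "A = B"
proof (rule eq_matI)
  fix p q assume "p < dim_row B" "q < dim_col B"
  then have pq: "p < n * d" "q < n * d" using assms by auto
  then have "d > 0" by (auto intro!: Nat.gr0I)
  then show "A $$ (p, q) = B $$ (p, q)"
    using assms(3)[of "p div d" "p mod d" "q div d" "q mod d"] pq by (simp add: less_mult_imp_div_less)
qed (use assms in auto)

lemma eq_vec_blocks:
  fixes x y :: "'a vec"
  assumes "x \<in> carrier_vec (n * d)" "y \<in> carrier_vec (n * d)"
    and "\<And>i j. i < n \<Longrightarrow> j < d \<Longrightarrow> x $ (i * d + j) = y $ (i * d + j)"
  shows "x = y"
proof (rule eq_vecI)
  fix p assume "p < dim_vec y"
  then have p: "p < n * d" using assms by auto
  then have "d > 0" by (auto intro!: Nat.gr0I)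
  then show "x $ p = y $ p"
    using assms(3)[of "p div d" "p mod d"] p by (simp add: less_mult_imp_div_less)
qed (use assms in auto)

lemma kronecker_mult_vec:
  fixes A B :: "'k::field mat" and x :: "'k vec"
  assumes "A \<in> carrier_mat n n" "B \<in> carrier_mat d d" "x \<in> carrier_vec (n * d)" "i < n" "j < d"
  shows "(kronecker A B *\<^sub>v x) $ (i * d + j) =
    (\<Sum>k<n. \<Sum>l<d. A $$ (i, k) * B $$ (j, l) * x $ (k * d + l))"
proof -
  have "(kronecker A B *\<^sub>v x) $ (i * d + j) = (\<Sum>m<n * d. kronecker A B $$ (i * d + j, m) * x $ m)"
    using kronecker_carrier[OF assms(1,2)] assms(3) block_less[OF assms(4,5)]
    by (auto simp: scalar_prod_def lessThan_atLeast0 intro!: sum.cong)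
  also have "\<dots> = (\<Sum>k<n. \<Sum>l<d. A $$ (i, k) * B $$ (j, l) * x $ (k * d + l))"
    unfolding sum_blocks using assms by (auto simp: kronecker_index intro!: sum.cong)
  finally show ?thesis .
qed

lemma kronecker_mult:
  fixes A B :: "'k::field mat"
  assumes "A \<in> carrier_mat n n" "B \<in> carrier_mat d d" "A' \<in> carrier_mat n n" "B' \<in> carrier_mat d d"
  shows "kronecker A B * kronecker A' B' = kronecker (A * A') (B * B')"
proof (rule eq_mat_blocks)
  fix i j k l assume *: "i < n" "j < d" "k < n" "l < d"
  have "(kronecker A B * kronecker A' B') $$ (i * d + j, k * d + l) =
      (\<Sum>m<n * d. kronecker A B $$ (i * d + j, m) * kronecker A' B' $$ (m, k * d + l))"
    using kronecker_carrier[OF assms(1,2)] kronecker_carrier[OF assms(3,4)]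
      block_less[OF *(1,2)] block_less[OF *(3,4)]
    by (auto simp: scalar_prod_def lessThan_atLeast0 intro!: sum.cong)
  also have "\<dots> = (\<Sum>p<n. \<Sum>q<d. (A $$ (i, p) * A' $$ (p, k)) * (B $$ (j, q) * B' $$ (q, l)))"
    unfolding sum_blocks using assms * by (auto simp: kronecker_index intro!: sum.cong)
  also have "\<dots> = (\<Sum>p<n. A $$ (i, p) * A' $$ (p, k)) * (\<Sum>q<d. B $$ (j, q) * B' $$ (q, l))"
    by (simp add: sum_product)
  also have "\<dots> = (A * A') $$ (i, k) * (B * B') $$ (j, l)"
    using assms * by (auto simp: scalar_prod_def lessThan_atLeast0 intro!: arg_cong2[of _ _ _ _ "(*)"] sum.cong)
  also have "\<dots> = kronecker (A * A') (B * B') $$ (i * d + j, k * d + l)"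
    using assms * by (subst kronecker_index[of _ n _ d]) auto
  finally show "(kronecker A B * kronecker A' B') $$ (i * d + j, k * d + l) =
      kronecker (A * A') (B * B') $$ (i * d + j, k * d + l)" .
qed (use assms in \<open>auto intro!: mult_carrier_mat kronecker_carrier\<close>)

lemma block_eq_iff:
  fixes d :: nat
  assumes "j < d" "l < d"
  shows "i * d + j = k * d + l \<longleftrightarrow> i = k \<and> j = l"
  by (metis assms div_mod_block)

lemma kronecker_one: "kronecker (1\<^sub>m n) (1\<^sub>m d) = 1\<^sub>m (n * d)"
  by (rule eq_mat_blocks)
    (auto simp: kronecker_carrier kronecker_index[of _ n _ d] block_less block_eq_iff)

text \<open>Fixing one entry of one factor determines the other factor. The lemma shows that kernel
  elements of the extension act by scalars on both factors, and that the factors of an invertible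
  Kronecker product are invertible.\<close>

lemma kronecker_eq_one:
  fixes A B :: "'k::field mat"
  assumes A: "A \<in> carrier_mat n n" and B: "B \<in> carrier_mat d d" and "n > 0" "d > 0"
    and eq: "kronecker A B = 1\<^sub>m (n * d)"
  obtains a b where "A = a \<cdot>\<^sub>m 1\<^sub>m n" "B = b \<cdot>\<^sub>m 1\<^sub>m d" "a * b = 1"
proof -
  have e: "A $$ (i, k) * B $$ (j, l) = (if i = k \<and> j = l then 1 else 0)"
    if "i < n" "j < d" "k < n" "l < d" for i j k l
    using kronecker_index[OF A B that(1,3,2,4)] that block_less[OF that(1,2)] block_less[OF that(3,4)]
    by (simp add: eq block_eq_iff)
  define a b where "a = A $$ (0, 0)" and "b = B $$ (0, 0)"
  have ab: "a * b = 1" using e[of 0 0 0 0] assms by (simp add: a_def b_def)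
  have "A $$ (i, k) = (if i = k then a else 0)" if "i < n" "k < n" for i k
  proof -
    have "A $$ (i, k) = A $$ (i, k) * b * a" using ab by (simp add: mult.assoc mult.commute)
    also have "\<dots> = (if i = k then a else 0)" using e[of i 0 k 0] that assms by (simp add: b_def)
    finally show ?thesis .
  qed
  moreover have "B $$ (j, l) = (if j = l then b else 0)" if "j < d" "l < d" for j l
  proof -
    have "B $$ (j, l) = a * B $$ (j, l) * b" using ab by (simp add: ac_simps)
    also have "\<dots> = (if j = l then b else 0)" using e[of 0 j 0 l] that assms by (simp add: a_def)
    finally show ?thesis .
  qed
  ultimately have "A = a \<cdot>\<^sub>m 1\<^sub>m n" "B = b \<cdot>\<^sub>m 1\<^sub>m d"
    using A B by (auto intro!: eq_matI)
  then show ?thesis using that ab by blast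
qed

lemma map_kronecker:
  fixes A B :: "'k::field mat"
  assumes "A \<in> carrier_mat n n" "B \<in> carrier_mat d d"
  shows "map_mat to_ac (kronecker A B) = kronecker (map_mat to_ac A) (map_mat to_ac B)"
  by (rule eq_mat_blocks[of _ n d])
    (use assms in \<open>auto simp: kronecker_carrier kronecker_index[of _ n _ d] block_less
      carrier_matD[OF kronecker_carrier[OF assms]]\<close>)

lemma linear_combination_closed:
  fixes W :: "'k::field vec set" and y :: "nat \<Rightarrow> 'k vec"
  assumes "0\<^sub>v n \<in> W" "\<And>x y. x \<in> W \<Longrightarrow> y \<in> W \<Longrightarrow> x + y \<in> W" "\<And>a x. x \<in> W \<Longrightarrow> a \<cdot>\<^sub>v x \<in> W"
    and W: "W \<subseteq> carrier_vec n" and "\<And>l. l < m \<Longrightarrow> y l \<in> W"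
  shows "vec n (\<lambda>i. \<Sum>l<m. c l * y l $ i) \<in> W"
  using assms(5)
proof (induction m)
  case 0
  have "vec n (\<lambda>i. \<Sum>l<0. c l * y l $ i) = 0\<^sub>v n" by (rule eq_vecI) auto
  then show ?case using assms(1) by simp
next
  case (Suc m)
  have "y m \<in> carrier_vec n" using Suc.prems W by auto
  then have "vec n (\<lambda>i. \<Sum>l<Suc m. c l * y l $ i) = vec n (\<lambda>i. \<Sum>l<m. c l * y l $ i) + c m \<cdot>\<^sub>v y m"
    by (intro eq_vecI) auto
  then show ?case using Suc assms(2,3) by simp
qed

text \<open>For an invariant subspace \<open>W\<close> of a tensor factor, the vectors all of whose slices lie in \<open>W\<close>
  form an invariant subspace of the tensor product.\<close>

lemma irreducible_tensor_factor:
  fixes A :: "'x \<Rightarrow> 'k::field mat" and pos :: "nat \<Rightarrow> nat \<Rightarrow> nat" and c :: "'x \<Rightarrow> nat \<Rightarrow> nat \<Rightarrow> 'k" and n :: nat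
  defines "slice \<equiv> (\<lambda>(x :: 'k vec) j. vec n (\<lambda>i. x $ pos i j))"
  assumes irr: "irreducible_rep E N M" and n: "n > 0" and m: "m > 0"
    and M: "\<And>g. g \<in> carrier E \<Longrightarrow> M g \<in> carrier_mat N N"
    and pos: "\<And>i j. i < n \<Longrightarrow> j < m \<Longrightarrow> pos i j < N"
    and act: "\<And>g x j. g \<in> carrier E \<Longrightarrow> x \<in> carrier_vec N \<Longrightarrow> j < m \<Longrightarrow>
      slice (M g *\<^sub>v x) j = A g *\<^sub>v vec n (\<lambda>k. \<Sum>l<m. c g j l * slice x l $ k)"
    and emb: "\<And>w. w \<in> carrier_vec n \<Longrightarrow> emb w \<in> carrier_vec N"
      "\<And>w j. w \<in> carrier_vec n \<Longrightarrow> j < m \<Longrightarrow> slice (emb w) j = (if j = 0 then w else 0\<^sub>v n)"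
  shows "irreducible_rep E n A"
  unfolding irreducible_rep_def
proof (intro conjI allI impI n)
  fix W assume inv: "invariant_subspace E n A W"
  then have Wc: "W \<subseteq> carrier_vec n" and W0: "0\<^sub>v n \<in> W"
    and Wadd: "\<And>x y. x \<in> W \<Longrightarrow> y \<in> W \<Longrightarrow> x + y \<in> W" and Wsm: "\<And>a x. x \<in> W \<Longrightarrow> a \<cdot>\<^sub>v x \<in> W"
    and WA: "\<And>g x. g \<in> carrier E \<Longrightarrow> x \<in> W \<Longrightarrow> A g *\<^sub>v x \<in> W"
    by (auto simp: invariant_subspace_def)
  have slice_0: "slice (0\<^sub>v N) j = 0\<^sub>v n" if "j < m" for j
    using that by (intro eq_vecI) (auto simp: slice_def pos)
  define T where "T = {x \<in> carrier_vec N. \<forall>j<m. slice x j \<in> W}"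
  have "invariant_subspace E N M T"
    unfolding invariant_subspace_def
  proof (intro conjI ballI allI)
    show "0\<^sub>v N \<in> T" using W0 slice_0 by (simp add: T_def)
  next
    fix x y assume xy: "x \<in> T" "y \<in> T"
    have "slice (x + y) j = slice x j + slice y j" if "j < m" for j
      using that xy by (intro eq_vecI) (auto simp: slice_def T_def pos)
    then show "x + y \<in> T" using xy Wadd by (simp add: T_def)
  next
    fix a x assume x: "x \<in> T"
    have "slice (a \<cdot>\<^sub>v x) j = a \<cdot>\<^sub>v slice x j" if "j < m" for j
      using that x by (intro eq_vecI) (auto simp: slice_def T_def pos)
    then show "a \<cdot>\<^sub>v x \<in> T" using x Wsm by (simp add: T_def)
  next
    fix g x assume g: "g \<in> carrier E" and x: "x \<in> T"
    have xc: "x \<in> carrier_vec N" using x by (simp add: T_def)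
    have "slice (M g *\<^sub>v x) j \<in> W" if "j < m" for j
      unfolding act[OF g xc that]
      by (rule WA[OF g], rule linear_combination_closed[OF W0 Wadd Wsm Wc])
        (use x in \<open>auto simp: T_def\<close>)
    then show "M g *\<^sub>v x \<in> T" using mult_mat_vec_carrier[OF M[OF g] xc] by (simp add: T_def)
  qed (auto simp: T_def)
  then have T: "T = {0\<^sub>v N} \<or> T = carrier_vec N" using irr by (simp add: irreducible_rep_def)
  \<comment> \<open>\<open>emb w\<close> has the slice \<open>w\<close> at index 0 and zero slices
    elsewhere, so a trivial or full \<open>T\<close> forces the same of \<open>W\<close>.\<close>
  have emb_iff: "emb w \<in> T \<longleftrightarrow> w \<in> W" if "w \<in> carrier_vec n" for w
    using emb(1)[OF that] emb(2)[OF that] W0 m by (auto simp: T_def)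
  show "W = {0\<^sub>v n} \<or> W = carrier_vec n"
    using T
  proof
    assume T0: "T = {0\<^sub>v N}"
    have "w = 0\<^sub>v n" if "w \<in> W" for w
    proof -
      have w: "w \<in> carrier_vec n" using that Wc by auto
      have "emb w = 0\<^sub>v N" using emb_iff[OF w] that T0 by simp
      then show ?thesis using emb(2)[OF w m] slice_0[OF m] by simp
    qed
    then show ?thesis using W0 by blast
  next
    assume T1: "T = carrier_vec N"
    have "w \<in> W" if "w \<in> carrier_vec n" for w
      using emb_iff[OF that] emb(1)[OF that] unfolding T1 by simp
    then show ?thesis using Wc by blast
  qed
qed

text \<open>The slices run along the second tensor index: \<open>kronecker (A x) (B x)\<close>
  combines the slices with the entries of \<open>B x\<close> as coefficients and then applies
  \<open>A x\<close>.\<close>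

lemma irreducible_kronecker_left:
  fixes A B :: "'x \<Rightarrow> 'k::field mat"
  assumes irr: "irreducible_rep E (n * d) (\<lambda>x. kronecker (A x) (B x))" and d: "d > 0"
    and AB: "\<And>x. x \<in> carrier E \<Longrightarrow> A x \<in> carrier_mat n n" "\<And>x. x \<in> carrier E \<Longrightarrow> B x \<in> carrier_mat d d"
  shows "irreducible_rep E n A"
proof (rule irreducible_tensor_factor[OF irr _ d, where pos = "\<lambda>i j. i * d + j"
      and c = "\<lambda>g j l. B g $$ (j, l)"
      and emb = "\<lambda>w :: 'k vec. vec (n * d) (\<lambda>p. if p mod d = 0 then w $ (p div d) else 0)"])
  show "n > 0" using irr by (auto simp: irreducible_rep_def)
  fix g j and x :: "'k vec" assume g: "g \<in> carrier E" and x: "x \<in> carrier_vec (n * d)" and j: "j < d"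
  show "vec n (\<lambda>i. (kronecker (A g) (B g) *\<^sub>v x) $ (i * d + j)) =
      A g *\<^sub>v vec n (\<lambda>k. \<Sum>l<d. B g $$ (j, l) * vec n (\<lambda>i. x $ (i * d + l)) $ k)"
    by (rule eq_vecI)
      (use AB(1)[OF g] j in \<open>auto simp: kronecker_mult_vec[OF AB(1)[OF g] AB(2)[OF g] x]
        scalar_prod_def lessThan_atLeast0 sum_distrib_left mult.assoc intro!: sum.cong\<close>)
next
  fix w :: "'k vec" and j assume "w \<in> carrier_vec n" "j < d"
  then show "vec n (\<lambda>i. vec (n * d) (\<lambda>p. if p mod d = 0 then w $ (p div d) else 0) $ (i * d + j)) =
      (if j = 0 then w else 0\<^sub>v n)"
    by (intro eq_vecI) (auto simp: block_less)
qed (use AB in \<open>auto simp: kronecker_carrier block_less\<close>)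

text \<open>Now the slices run along the first tensor index, and two summations have to be exchanged
  to bring \<open>B x\<close> outside.\<close>

lemma irreducible_kronecker_right:
  fixes A B :: "'x \<Rightarrow> 'k::field mat"
  assumes irr: "irreducible_rep E (n * d) (\<lambda>x. kronecker (A x) (B x))" and n: "n > 0"
    and AB: "\<And>x. x \<in> carrier E \<Longrightarrow> A x \<in> carrier_mat n n" "\<And>x. x \<in> carrier E \<Longrightarrow> B x \<in> carrier_mat d d"
  shows "irreducible_rep E d B"
proof (rule irreducible_tensor_factor[OF irr _ n, where pos = "\<lambda>j i. i * d + j"
      and c = "\<lambda>g i k. A g $$ (i, k)"
      and emb = "\<lambda>w :: 'k vec. vec (n * d) (\<lambda>p. if p div d = 0 then w $ (p mod d) else 0)"])
  show "d > 0" using irr by (auto simp: irreducible_rep_def)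
  fix g i and x :: "'k vec" assume g: "g \<in> carrier E" and x: "x \<in> carrier_vec (n * d)" and i: "i < n"
  show "vec d (\<lambda>j. (kronecker (A g) (B g) *\<^sub>v x) $ (i * d + j)) =
      B g *\<^sub>v vec d (\<lambda>l. \<Sum>k<n. A g $$ (i, k) * vec d (\<lambda>j. x $ (k * d + j)) $ l)"
  proof (rule eq_vecI)
    fix j assume "j < dim_vec (B g *\<^sub>v vec d (\<lambda>l. \<Sum>k<n. A g $$ (i, k) * vec d (\<lambda>j. x $ (k * d + j)) $ l))"
    then have j: "j < d" using AB(2)[OF g] by simp
    have "vec d (\<lambda>j. (kronecker (A g) (B g) *\<^sub>v x) $ (i * d + j)) $ j =
        (\<Sum>l<d. \<Sum>k<n. A g $$ (i, k) * B g $$ (j, l) * x $ (k * d + l))"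
      using j kronecker_mult_vec[OF AB(1)[OF g] AB(2)[OF g] x i j] by (simp add: sum.swap[of _ "{..<d}"])
    also have "\<dots> = (B g *\<^sub>v vec d (\<lambda>l. \<Sum>k<n. A g $$ (i, k) * vec d (\<lambda>j. x $ (k * d + j)) $ l)) $ j"
      using AB(2)[OF g] j
      by (auto simp: scalar_prod_def lessThan_atLeast0 sum_distrib_left ac_simps intro!: sum.cong)
    finally show "vec d (\<lambda>j. (kronecker (A g) (B g) *\<^sub>v x) $ (i * d + j)) $ j =
        (B g *\<^sub>v vec d (\<lambda>l. \<Sum>k<n. A g $$ (i, k) * vec d (\<lambda>j. x $ (k * d + j)) $ l)) $ j" .
  qed (use AB(2)[OF g] in simp)
next
  fix w :: "'k vec" and i assume "w \<in> carrier_vec d" "i < n"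
  then show "vec d (\<lambda>j. vec (n * d) (\<lambda>p. if p div d = 0 then w $ (p mod d) else 0) $ (i * d + j)) =
      (if i = 0 then w else 0\<^sub>v d)"
    using block_less[of 0 n _ d] by (intro eq_vecI) (auto simp: block_less)
qed (use AB in \<open>auto simp: kronecker_carrier block_less\<close>)

section \<open>Tensor decompositions\<close>

context linear_space
begin

lemma coords_lincomb_index:
  fixes \<phi> :: "'v \<Rightarrow> 'k vec" and m :: nat
  assumes c: "coords U n \<phi>" and u: "\<And>k. k < m \<Longrightarrow> u k \<in> U" and j: "j < n"
  shows "\<phi> (\<Sum>k<m. scale (a k) (u k)) $ j = (\<Sum>k<m. a k * \<phi> (u k) $ j)"
  using u
proof (induction m)
  case 0
  then show ?case using coords_zero[OF c] j by simp
next
  case (Suc m)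
  have sU: "subspace U" by (rule coords_subspace[OF c])
  have 1: "(\<Sum>k<m. scale (a k) (u k)) \<in> U" "scale (a m) (u m) \<in> U"
    using Suc.prems sU by (auto intro!: subspace_sum subspace_scale)
  have "u m \<in> U" using Suc.prems by simp
  then have "dim_vec (\<phi> (u m)) = n" "dim_vec (\<phi> (scale (a m) (u m))) = n"
    using coords_closed[OF c] 1 by (auto dest: carrier_vecD)
  then show ?case
    using Suc coords_add[OF c 1] coords_scale[OF c \<open>u m \<in> U\<close>] j by simp
qed

end

context fin_rep
begin

text \<open>\<open>absolutely_simple\<close> provides one basis only. Two coordinate systems differ
  by mutually inverse matrices over \<open>k\<close>, which after extension of scalars carry
  invariant subspaces to invariant subspaces.\<close>

lemma absolutely_irreducible_coords:
  assumes abs: "absolutely_simple G scale \<rho>" and nz: "\<exists>v :: 'v. v \<noteq> 0"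
    and \<phi>: "coords UNIV N \<phi>"
    and M: "\<And>g. g \<in> carrier G \<Longrightarrow> M g \<in> carrier_mat N N"
      "\<And>g v. g \<in> carrier G \<Longrightarrow> \<phi> (\<rho> g v) = M g *\<^sub>v \<phi> v"
  shows "absolutely_irreducible_rep G N M"
proof -
  obtain m M' \<psi> where M': "matrix_rep G m M'" and irr: "absolutely_irreducible_rep G m M'"
    and \<psi>: "coords UNIV m \<psi>" and eq: "\<And>g v. g \<in> carrier G \<Longrightarrow> \<psi> (\<rho> g v) = M' g *\<^sub>v \<psi> v"
    using abs unfolding absolutely_simple_def affords_matrix_rep_iff by blast
  have M'c: "M' g \<in> carrier_mat m m" if "g \<in> carrier G" for g
    using matrix_rep_carrier[OF M' that] .
  have trans: "\<exists>P\<in>carrier_mat n2 n1. \<forall>v. \<phi>2 v = P *\<^sub>v \<phi>1 v"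
    if c1: "coords UNIV n1 \<phi>1" and c2: "coords UNIV n2 \<phi>2" for n1 n2 \<phi>1 \<phi>2
  proof -
    have "\<exists>P\<in>carrier_mat n2 n1. \<forall>x\<in>carrier_vec n1. \<phi>2 (uncoords UNIV \<phi>1 x) = P *\<^sub>v x"
      by (rule linear_map_as_matrix)
        (auto simp: coords_closed[OF c2] uncoords_add[OF c1] uncoords_scale[OF c1]
          coords_add[OF c2] coords_scale[OF c2])
    then obtain P where P: "P \<in> carrier_mat n2 n1"
      "\<And>x. x \<in> carrier_vec n1 \<Longrightarrow> \<phi>2 (uncoords UNIV \<phi>1 x) = P *\<^sub>v x" by blast
    have "\<phi>2 v = P *\<^sub>v \<phi>1 v" for v
      using P(2)[OF coords_closed[OF c1 UNIV_I]] uncoords_coords[OF c1 UNIV_I] by simp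
    then show ?thesis using P(1) by blast
  qed
  obtain P where P: "P \<in> carrier_mat N m" "\<And>v. \<phi> v = P *\<^sub>v \<psi> v" using trans[OF \<psi> \<phi>] by blast
  obtain Q where Q: "Q \<in> carrier_mat m N" "\<And>v. \<psi> v = Q *\<^sub>v \<phi> v" using trans[OF \<phi> \<psi>] by blast
  have \<phi>c: "\<phi> v \<in> carrier_vec N" for v using coords_closed[OF \<phi>] by simp
  have \<psi>c: "\<psi> v \<in> carrier_vec m" for v using coords_closed[OF \<psi>] by simp
  have PQ: "P * Q = 1\<^sub>m N"
  proof (rule coords_mat_eqI[OF \<phi>, where m = N])
    fix v
    show "P * Q *\<^sub>v \<phi> v = 1\<^sub>m N *\<^sub>v \<phi> v"
      using assoc_mult_mat_vec[OF P(1) Q(1) \<phi>c[of v]] one_mult_mat_vec[OF \<phi>c[of v]]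
      unfolding P(2)[symmetric] Q(2)[symmetric] by simp
  qed (use P Q in auto)
  have MP: "M g * P = P * M' g" if g: "g \<in> carrier G" for g
  proof (rule coords_mat_eqI[OF \<psi>, where m = N])
    fix v
    have "M g *\<^sub>v (P *\<^sub>v \<psi> v) = P *\<^sub>v (M' g *\<^sub>v \<psi> v)"
      using M(2)[OF g, of v] P(2)[of v] P(2)[of "\<rho> g v"] eq[OF g, of v] by simp
    then show "M g * P *\<^sub>v \<psi> v = P * M' g *\<^sub>v \<psi> v"
      using assoc_mult_mat_vec[OF M(1)[OF g] P(1) \<psi>c] assoc_mult_mat_vec[OF P(1) M'c[OF g] \<psi>c]
      by simp
  qed (use P(1) M(1)[OF g] M'c[OF g] in \<open>auto intro: mult_carrier_mat\<close>)
  let ?h = "map_mat (to_ac :: 'k \<Rightarrow> 'k alg_closure)"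
  have hP: "?h P \<in> carrier_mat N m" and hQ: "?h Q \<in> carrier_mat m N" using P Q by auto
  have hP0: "?h P *\<^sub>v 0\<^sub>v m = 0\<^sub>v N" by (rule eq_vecI) (use hP in auto)
  have hPQ: "?h P *\<^sub>v (?h Q *\<^sub>v x) = x" if "x \<in> carrier_vec N" for x
  proof -
    have "?h P * ?h Q = 1\<^sub>m N"
      unfolding to_ac.mat_hom_mult[OF P(1) Q(1), symmetric] PQ by (rule to_ac.mat_hom_one)
    then show ?thesis using assoc_mult_mat_vec[OF hP hQ that] one_mult_mat_vec[OF that] by simp
  qed
  show ?thesis
    unfolding absolutely_irreducible_rep_def irreducible_rep_def
  proof (intro conjI allI impI)
    show "N > 0" by (rule coords_UNIV_pos[OF \<phi> nz])
    fix U assume inv: "invariant_subspace G N (\<lambda>g. ?h (M g)) U"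
    define T where "T = {x \<in> carrier_vec m. ?h P *\<^sub>v x \<in> U}"
    have "invariant_subspace G m (\<lambda>g. ?h (M' g)) T"
      unfolding invariant_subspace_def
    proof (intro conjI ballI allI)
      show "0\<^sub>v m \<in> T" using inv hP0 by (simp add: T_def invariant_subspace_def)
      show "x + y \<in> T" if "x \<in> T" "y \<in> T" for x y
        using that inv by (auto simp: T_def invariant_subspace_def mult_add_distrib_mat_vec[OF hP])
      show "c \<cdot>\<^sub>v x \<in> T" if "x \<in> T" for c x
        using that inv by (auto simp: T_def invariant_subspace_def mult_mat_vec[OF hP])
      show "?h (M' g) *\<^sub>v x \<in> T" if g: "g \<in> carrier G" and x: "x \<in> T" for g x
      proof -
        have xc: "x \<in> carrier_vec m" using x by (simp add: T_def)
        have hM: "?h (M g) \<in> carrier_mat N N" "?h (M' g) \<in> carrier_mat m m"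
          using M(1)[OF g] M'c[OF g] by auto
        have "?h (M g) * ?h P = ?h P * ?h (M' g)"
          using MP[OF g] to_ac.mat_hom_mult[OF M(1)[OF g] P(1)] to_ac.mat_hom_mult[OF P(1) M'c[OF g]] by simp
        then have "?h P *\<^sub>v (?h (M' g) *\<^sub>v x) = ?h (M g) *\<^sub>v (?h P *\<^sub>v x)"
          using assoc_mult_mat_vec[OF hM(1) hP xc] assoc_mult_mat_vec[OF hP hM(2) xc] by simp
        also have "\<dots> \<in> U" using inv g x by (simp add: T_def invariant_subspace_def)
        finally show ?thesis using mult_mat_vec_carrier[OF hM(2) xc] by (simp add: T_def)
      qed
    qed (auto simp: T_def)
    then have T: "T = {0\<^sub>v m} \<or> T = carrier_vec m"
      using irr by (simp add: absolutely_irreducible_rep_def irreducible_rep_def)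
    have Uc: "U \<subseteq> carrier_vec N" and U0: "0\<^sub>v N \<in> U" using inv by (auto simp: invariant_subspace_def)
    have UT: "x \<in> U \<longleftrightarrow> ?h Q *\<^sub>v x \<in> T" if "x \<in> carrier_vec N" for x
      using hPQ[OF that] mult_mat_vec_carrier[OF hQ that] by (simp add: T_def)
    show "U = {0\<^sub>v N} \<or> U = carrier_vec N"
      using T
    proof
      assume T0: "T = {0\<^sub>v m}"
      have "x = 0\<^sub>v N" if "x \<in> U" for x
      proof -
        have xc: "x \<in> carrier_vec N" using that Uc by auto
        have "?h Q *\<^sub>v x = 0\<^sub>v m" using UT[OF xc] that T0 by simp
        then have "x = ?h P *\<^sub>v 0\<^sub>v m" using hPQ[OF xc] by simp
        then show ?thesis using hP0 by simp
      qed
      then show ?thesis using U0 by blast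
    next
      assume T1: "T = carrier_vec m"
      have "x \<in> U" if "x \<in> carrier_vec N" for x
        using UT[OF that] mult_mat_vec_carrier[OF hQ that] unfolding T1 by simp
      then show ?thesis using Uc by blast
    qed
  qed
qed

text \<open>The translated matrix units \<open>F i j = conjugate s (E i j)\<close> are conjugate to \<open>E\<close> by the element
  \<open>x\<close> of \<open>R\<close> (Skolem--Noether), and \<open>x\<^sup>-\<^sup>1 \<rho> s\<close> centralises \<open>R\<close>.\<close>

lemma matrix_units_factor:
  assumes R: "subalgebra_End scale R" "conj_stable R" and E: "matrix_unit_system R n E" and n: "n > 0"
    and nz: "\<exists>v :: 'v. v \<noteq> 0" and s: "s \<in> carrier G"
  obtains x b where "x \<in> R" "endo b" "\<And>v. \<rho> s v = x (b v)"
    "\<And>k l v. k < n \<Longrightarrow> l < n \<Longrightarrow> b (E k l v) = E k l (b v)"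
proof -
  note Rendo = subalgebra_endo[OF R(1)] and ER = matrix_unit_mem[OF E] and EE = matrix_unit_mult[OF E]
    and Eid = matrix_unit_sum[OF E]
  note Rmult = subalgebra_mult[OF R(1)] and Ecoef = matrix_unit_corner[OF E]
  have Eendo: "endo (E i j)" if "i < n" "j < n" for i j using Rendo[OF ER[OF that]] .
  have E0: "E i j 0 = 0" if "i < n" "j < n" for i j using endo_zero[OF Eendo[OF that]] .
  define F where "F = (\<lambda>i j. conjugate s (E i j))"
  have FR: "F i j \<in> R" if "i < n" "j < n" for i j
    unfolding F_def by (rule conj_stableD[OF R(2) s ER[OF that]])
  have Fendo: "endo (F i j)" if "i < n" "j < n" for i j using Rendo[OF FR[OF that]] .
  have FF: "F i j (F k l v) = (if j = k then F i l v else 0)" if "i < n" "j < n" "k < n" "l < n" for i j k l v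
    using s EE[OF that] endo_zero[OF rho_endo[OF s]] by (simp add: F_def conjugate_def)
  have F\<rho>: "F i j (\<rho> s v) = \<rho> s (E i j v)" for i j v
    using s by (simp add: F_def conjugate_def)
  have "\<exists>v. E 0 0 v \<noteq> 0"
  proof (rule ccontr)
    assume neg: "\<not> ?thesis"
    have "E i i v = 0" if "i < n" for i v
    proof -
      have "E i i v = E i 0 (E 0 0 (E 0 i v))" using EE n that by simp
      then show ?thesis using neg E0 n that by simp
    qed
    then have "v = 0" for v :: 'v using Eid[of v] by simp
    then show False using nz by blast
  qed
  then obtain v0 where v0: "E 0 0 v0 \<noteq> 0" by blast
  have F00: "F 0 0 (\<rho> s v0) \<noteq> 0"
    unfolding F\<rho> using v0 s endo_zero[OF rho_endo[of "inv s"]] by (metis inv_closed rho_inv(1))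
  \<comment> \<open>The blocks of \<open>F 0 0\<close> with respect to the idempotents
    \<open>E i i\<close> add up to it, so one of them is nonzero; it is the multiple by
    \<open>c\<close> of a matrix unit.\<close>
  have "\<exists>i<n. \<exists>j<n. \<exists>v. E i i (F 0 0 (E j j v)) \<noteq> 0"
  proof (rule ccontr)
    assume neg: "\<not> ?thesis"
    have "F 0 0 w = 0" for w
    proof -
      have "F 0 0 w = (\<Sum>i<n. E i i (F 0 0 (\<Sum>j<n. E j j w)))" unfolding Eid ..
      also have "\<dots> = (\<Sum>i<n. \<Sum>j<n. E i i (F 0 0 (E j j w)))"
        using n by (auto simp: endo_sum[OF Fendo] endo_sum[OF Eendo] intro!: sum.cong)
      also have "\<dots> = 0" using neg by (auto intro!: sum.neutral)
      finally show ?thesis .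
    qed
    then show False using F00 by simp
  qed
  then obtain i j v1 where ij: "i < n" "j < n" and v1: "E i i (F 0 0 (E j j v1)) \<noteq> 0" by blast
  obtain c where c: "\<And>v. E i i (F 0 0 (E j j v)) = scale c (E i j v)"
    using Ecoef[OF FR[OF n n] ij] by blast
  have c0: "c \<noteq> 0" using v1 c by auto
  \<comment> \<open>Intertwiners between the two systems of matrix units: \<open>x\<close> carries
    \<open>E k l\<close> to \<open>F k l\<close>. In the product of \<open>y\<close> and
    \<open>x\<close> the chosen block appears in every summand, and dividing by \<open>c\<close>
    leaves the sum of the \<open>E k k\<close>.\<close>
  define x where "x = (\<lambda>v. \<Sum>k<n. F k 0 (E j k v))"
  define y where "y = (\<lambda>v. scale (inverse c) (\<Sum>k<n. E k i (F 0 k v)))"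
  have xR: "x \<in> R"
    unfolding x_def by (rule subalgebra_sum[OF R(1)]) (rule Rmult[OF FR ER], use n ij in auto)
  have "(\<lambda>v. \<Sum>k<n. E k i (F 0 k v)) \<in> R"
    by (rule subalgebra_sum[OF R(1)]) (rule Rmult[OF ER FR], use n ij in auto)
  then have yendo: "endo y" unfolding y_def by (intro endo_smult Rendo)
  have xendo: "endo x" by (rule Rendo[OF xR])
  have yx: "y (x v) = v" for v
  proof -
    have "(\<Sum>k<n. E k i (F 0 k (x v))) = (\<Sum>k<n. scale c (E k k v))"
    proof (rule sum.cong[OF refl])
      fix k assume "k \<in> {..<n}"
      then have k: "k < n" by simp
      have "F 0 k (x v) = (\<Sum>m<n. if m = k then F 0 0 (E j m v) else 0)"
        unfolding x_def using n k by (auto simp: endo_sum[OF Fendo] FF intro!: sum.cong)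
      also have "\<dots> = F 0 0 (E j k v)" using k by simp
      finally have "E k i (F 0 k (x v)) = E k i (E i i (F 0 0 (E j j (E j k v))))"
        using EE k ij by simp
      also have "\<dots> = scale c (E k i (E i j (E j k v)))"
        unfolding c using k ij by (simp add: endo_scaleD[OF Eendo])
      also have "\<dots> = scale c (E k k v)" using EE k ij by simp
      finally show "E k i (F 0 k (x v)) = scale c (E k k v)" .
    qed
    also have "\<dots> = scale c v" by (simp add: Eid flip: scale_sum_right)
    finally show ?thesis using c0 by (simp add: y_def)
  qed
  have "inj x" using yx by (metis injI)
  then have "surj x" by (rule linear_inj_imp_surj[OF xendo])
  then have xy: "x (y w) = w" for w using yx by (metis surjD)
  have xE: "x (E k l v) = F k l (x v)" if "k < n" "l < n" for k l v
  proof -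
    have "x (E k l v) = (\<Sum>m<n. if m = k then F k 0 (E j l v) else 0)"
      unfolding x_def using that ij n endo_zero[OF Fendo] by (intro sum.cong) (auto simp: EE)
    moreover have "F k l (x v) = (\<Sum>m<n. if m = l then F k 0 (E j l v) else 0)"
      unfolding x_def using that ij n by (simp add: endo_sum[OF Fendo]) (auto simp: FF intro!: sum.cong)
    ultimately show ?thesis using that by simp
  qed
  define b where "b = (\<lambda>v. y (\<rho> s v))"
  show ?thesis
  proof (rule that[OF xR])
    show "endo b" unfolding b_def using endo_comp[OF yendo rho_endo[OF s]] by (simp add: comp_def)
    show "\<rho> s v = x (b v)" for v by (simp add: b_def xy)
    show "b (E k l v) = E k l (b v)" if kl: "k < n" "l < n" for k l v
    proof -
      have "b (E k l v) = y (F k l (x (y (\<rho> s v))))" by (simp add: b_def F\<rho> xy)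
      also have "\<dots> = E k l (b v)" by (simp add: xE[OF kl, symmetric] yx b_def)
      finally show ?thesis .
    qed
  qed
qed


text \<open>The matrix units identify \<open>V\<close> with the tensor product of an
  \<open>n\<close>-dimensional space and the range \<open>?U\<close> of \<open>E 0 0\<close>.
  Elements of \<open>R\<close> act on the first factor and operators commuting with the matrix units
  on the second, so each \<open>\<rho> s\<close> becomes a Kronecker product.\<close>

lemma tensor_splitting:
  assumes abs: "absolutely_simple G scale \<rho>" and nz: "\<exists>v :: 'v. v \<noteq> 0"
    and R: "subalgebra_End scale R" "conj_stable R" and E: "matrix_unit_system R n E"
    and n: "n > 1" and d: "d > 1" and \<chi>: "coords {v. E 0 0 v = v} d \<chi>"
  shows "admits_projective_absolutely_simple_splitting G scale \<rho>"
proof -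
  let ?U = "{v. E 0 0 v = v}"
  have n0: "0 < n" using n by simp
  note Rendo = subalgebra_endo[OF R(1)] and ER = matrix_unit_mem[OF E] and EE = matrix_unit_mult[OF E]
    and Eid = matrix_unit_sum[OF E]
  note Ecoef = matrix_unit_corner[OF E]
  have Eendo: "endo (E i j)" if "i < n" "j < n" for i j using Rendo[OF ER[OF that]] .
  have EU: "E 0 i v \<in> ?U" if "i < n" for i v using EE that n0 by simp
  \<comment> \<open>Block \<open>i\<close> of the coordinate vector is the component of
    \<open>v\<close> in the range of \<open>E i i\<close>, carried over to \<open>?U\<close> by
    \<open>E 0 i\<close>.\<close>
  define \<phi> where "\<phi> = (\<lambda>v. vec (n * d) (\<lambda>m. \<chi> (E 0 (m div d) v) $ (m mod d)))"
  have \<phi>_block: "\<phi> v $ (i * d + j) = \<chi> (E 0 i v) $ j" if "i < n" "j < d" for v i j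
    using that by (simp add: \<phi>_def block_less)
  have \<phi>c: "\<phi> v \<in> carrier_vec (n * d)" for v by (simp add: \<phi>_def)
  have \<chi>c: "\<chi> (E 0 i v) \<in> carrier_vec d" if "i < n" for i v
    using coords_closed[OF \<chi> EU[OF that]] .
  have \<phi>: "coords UNIV (n * d) \<phi>"
    unfolding coords_def
  proof (intro conjI ballI allI)
    show "\<phi> (u + w) = \<phi> u + \<phi> w" for u w
    proof (rule eq_vec_blocks[OF \<phi>c])
      fix i j assume ij: "i < n" "j < d"
      have "\<chi> (E 0 i (u + w)) = \<chi> (E 0 i u) + \<chi> (E 0 i w)"
        using coords_add[OF \<chi> EU[OF ij(1)] EU[OF ij(1)]] endo_addD[OF Eendo[OF n0 ij(1)]] by simp
      then show "\<phi> (u + w) $ (i * d + j) = (\<phi> u + \<phi> w) $ (i * d + j)"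
        using ij \<chi>c[OF ij(1), of u] \<chi>c[OF ij(1), of w] carrier_vecD[OF \<phi>c] block_less[OF ij]
        by (simp add: \<phi>_block)
    qed (use \<phi>c in simp)
    show "\<phi> (scale c u) = c \<cdot>\<^sub>v \<phi> u" for c u
    proof (rule eq_vec_blocks[OF \<phi>c])
      fix i j assume ij: "i < n" "j < d"
      have "\<chi> (E 0 i (scale c u)) = c \<cdot>\<^sub>v \<chi> (E 0 i u)"
        using coords_scale[OF \<chi> EU[OF ij(1)]] endo_scaleD[OF Eendo[OF n0 ij(1)]] by simp
      then show "\<phi> (scale c u) $ (i * d + j) = (c \<cdot>\<^sub>v \<phi> u) $ (i * d + j)"
        using ij \<chi>c[OF ij(1), of u] carrier_vecD[OF \<phi>c] block_less[OF ij] by (simp add: \<phi>_block)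
    qed (use \<phi>c in simp)
    show "bij_betw \<phi> UNIV (carrier_vec (n * d))"
      unfolding bij_betw_def
    proof (intro conjI injI equalityI subsetI)
      fix u w assume eq: "\<phi> u = \<phi> w"
      have "E 0 i u = E 0 i w" if i: "i < n" for i
      proof (rule coords_inj[OF \<chi> EU[OF i] EU[OF i]])
        show "\<chi> (E 0 i u) = \<chi> (E 0 i w)"
        proof (rule eq_vecI)
          fix j assume "j < dim_vec (\<chi> (E 0 i w))"
          then have "j < d" using carrier_vecD[OF \<chi>c[OF i, of w]] by simp
          then show "\<chi> (E 0 i u) $ j = \<chi> (E 0 i w) $ j" using \<phi>_block[OF i] eq by metis
        qed (simp add: carrier_vecD[OF \<chi>c[OF i]])
      qed
      then have "(\<Sum>i<n. E i 0 (E 0 i u)) = (\<Sum>i<n. E i 0 (E 0 i w))" by simp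
      then have "(\<Sum>i<n. E i i u) = (\<Sum>i<n. E i i w)" using EE n0 by simp
      then show "u = w" by (simp add: Eid)
    next
      fix x :: "'k vec" assume x: "x \<in> carrier_vec (n * d)"
      define u where "u = (\<lambda>i. uncoords ?U \<chi> (vec d (\<lambda>j. x $ (i * d + j))))"
      have u: "u i \<in> ?U" "\<chi> (u i) = vec d (\<lambda>j. x $ (i * d + j))" for i
        using uncoords[OF \<chi>, of "vec d (\<lambda>j. x $ (i * d + j))"] by (simp_all add: u_def)
      define v where "v = (\<Sum>i<n. E i 0 (u i))"
      have Ev: "E 0 k v = u k" if "k < n" for k
      proof -
        have "E 0 k v = (\<Sum>i<n. if i = k then E 0 0 (u i) else 0)"
          unfolding v_def using that n0 by (auto simp: endo_sum[OF Eendo] EE intro!: sum.cong)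
        then show ?thesis using that u(1)[of k] by simp
      qed
      have "\<phi> v = x"
        by (rule eq_vec_blocks[OF \<phi>c x]) (simp add: \<phi>_block Ev u(2))
      then show "x \<in> range \<phi>" by blast
    qed (use \<phi>c in auto)
  qed simp
  have factor: "\<exists>A\<in>carrier_mat n n. \<exists>B\<in>carrier_mat d d. \<forall>v. \<phi> (\<rho> s v) = kronecker A B *\<^sub>v \<phi> v"
    if s: "s \<in> carrier G" for s
  proof -
    obtain x b where xb: "x \<in> R" "endo b" "\<And>v. \<rho> s v = x (b v)"
      "\<And>k l v. k < n \<Longrightarrow> l < n \<Longrightarrow> b (E k l v) = E k l (b v)"
      using matrix_units_factor[OF R E n0 nz s] by blast
    \<comment> \<open>The corners of \<open>x\<close> are multiples of matrix units and give the
      entries of \<open>A\<close>. As \<open>b\<close> commutes with the matrix units, it preserves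
      \<open>?U\<close> and gives \<open>B\<close>.\<close>
    have "\<forall>i<n. \<forall>k<n. \<exists>c. \<forall>v. E i i (x (E k k v)) = scale c (E i k v)"
      using Ecoef[OF xb(1)] by blast
    then obtain a where a: "\<And>i k v. i < n \<Longrightarrow> k < n \<Longrightarrow> E i i (x (E k k v)) = scale (a i k) (E i k v)"
      by metis
    define A where "A = mat n n (\<lambda>(i, k). a i k)"
    have A: "A \<in> carrier_mat n n" by (simp add: A_def)
    have bU: "b u \<in> ?U" if "u \<in> ?U" for u using xb(4)[OF n0 n0, of u] that by simp
    obtain B where B: "B \<in> carrier_mat d d" "\<And>u. u \<in> ?U \<Longrightarrow> \<chi> (b u) = B *\<^sub>v \<chi> u"
      using coords_matrix[OF \<chi> xb(2) bU] by blast
    have "\<phi> (\<rho> s v) = kronecker A B *\<^sub>v \<phi> v" for v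
    proof (rule eq_vec_blocks[OF \<phi>c])
      show "kronecker A B *\<^sub>v \<phi> v \<in> carrier_vec (n * d)"
        by (rule mult_mat_vec_carrier[OF kronecker_carrier[OF A B(1)] \<phi>c])
      fix i j assume ij: "i < n" "j < d"
      have "E 0 i (x (b v)) = E 0 i (x (\<Sum>k<n. E k k (b v)))" unfolding Eid ..
      also have "\<dots> = (\<Sum>k<n. E 0 i (x (E k k (b v))))"
        using n0 ij by (simp add: endo_sum[OF Rendo[OF xb(1)]] endo_sum[OF Eendo])
      also have "\<dots> = (\<Sum>k<n. scale (a i k) (b (E 0 k v)))"
      proof (rule sum.cong[OF refl])
        fix k assume "k \<in> {..<n}"
        then have k: "k < n" by simp
        have "E 0 i (x (E k k (b v))) = E 0 i (E i i (x (E k k (b v))))" using EE n0 ij by simp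
        also have "\<dots> = scale (a i k) (E 0 k (b v))"
          using a ij k n0 by (simp add: endo_scaleD[OF Eendo] EE)
        finally show "E 0 i (x (E k k (b v))) = scale (a i k) (b (E 0 k v))" using xb(4)[OF n0 k] by simp
      qed
      finally have "\<chi> (E 0 i (x (b v))) $ j = (\<Sum>k<n. a i k * \<chi> (b (E 0 k v)) $ j)"
        using coords_lincomb_index[where m = n and a = "a i" and u = "\<lambda>k. b (E 0 k v)", OF \<chi> bU[OF EU] ij(2)] by simp
      also have "\<dots> = (\<Sum>k<n. \<Sum>l<d. A $$ (i, k) * B $$ (j, l) * \<phi> v $ (k * d + l))"
      proof (rule sum.cong[OF refl])
        fix k assume "k \<in> {..<n}"
        then have k: "k < n" by simp
        have "\<chi> (b (E 0 k v)) $ j = (\<Sum>l<d. B $$ (j, l) * \<chi> (E 0 k v) $ l)"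
          using B(2)[OF EU[OF k]] B(1) \<chi>c[OF k, of v] ij(2)
          by (auto simp: scalar_prod_def lessThan_atLeast0 intro!: sum.cong)
        then show "a i k * \<chi> (b (E 0 k v)) $ j = (\<Sum>l<d. A $$ (i, k) * B $$ (j, l) * \<phi> v $ (k * d + l))"
          using ij k by (simp add: A_def \<phi>_block sum_distrib_left mult.assoc)
      qed
      also have "\<dots> = (kronecker A B *\<^sub>v \<phi> v) $ (i * d + j)"
        using kronecker_mult_vec[OF A B(1) \<phi>c ij] by simp
      finally show "\<phi> (\<rho> s v) $ (i * d + j) = (kronecker A B *\<^sub>v \<phi> v) $ (i * d + j)"
        using ij by (simp add: \<phi>_block xb(3))
    qed
    then show ?thesis using A B(1) by blast
  qed
  note ext = coords_mat_eqI[OF \<phi>]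
  have kron_inv: "kronecker A B * kronecker A' B' = 1\<^sub>m (n * d)"
    if s: "s \<in> carrier G" and c: "A \<in> carrier_mat n n" "B \<in> carrier_mat d d" "A' \<in> carrier_mat n n" "B' \<in> carrier_mat d d"
    and eq: "\<And>v. \<phi> (\<rho> s v) = kronecker A B *\<^sub>v \<phi> v" "\<And>v. \<phi> (\<rho> (inv s) v) = kronecker A' B' *\<^sub>v \<phi> v"
    for s A B A' B'
  proof (rule ext)
    fix v
    have "kronecker A B *\<^sub>v (kronecker A' B' *\<^sub>v \<phi> v) = \<phi> v"
      unfolding eq(2)[symmetric] eq(1)[symmetric] using s by simp
    then show "kronecker A B * kronecker A' B' *\<^sub>v \<phi> v = 1\<^sub>m (n * d) *\<^sub>v \<phi> v"
      using assoc_mult_mat_vec[OF kronecker_carrier[OF c(1,2)] kronecker_carrier[OF c(3,4)] \<phi>c]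
        one_mult_mat_vec[OF \<phi>c] by simp
  qed (use c in \<open>auto intro!: mult_carrier_mat kronecker_carrier\<close>)
  define P where "P = G \<times>\<times> ((GL n :: 'k mat monoid) \<times>\<times> (GL d :: 'k mat monoid))"
  define T where "T = {(s, A, B) | s A B. s \<in> carrier G \<and> A \<in> carrier (GL n) \<and> B \<in> carrier (GL d) \<and>
      (\<forall>v. \<phi> (\<rho> s v) = kronecker A B *\<^sub>v \<phi> v)}"
  interpret GLn: group "GL n :: 'k mat monoid" by (rule group_GL)
  interpret GLd: group "GL d :: 'k mat monoid" by (rule group_GL)
  interpret P: group P unfolding P_def by (intro DirProd_group is_group group_GL)
  have GLc: "A \<in> carrier_mat m m" if "A \<in> carrier (GL m)" for A :: "'k mat" and m
    using that by (simp add: carrier_GL)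
  have T_iff: "(s, A, B) \<in> T \<longleftrightarrow> s \<in> carrier G \<and> A \<in> carrier (GL n) \<and> B \<in> carrier (GL d) \<and>
      (\<forall>v. \<phi> (\<rho> s v) = kronecker A B *\<^sub>v \<phi> v)" for s A B
    by (simp add: T_def)
  have GL_one: "\<one>\<^bsub>GL m\<^esub> = (1\<^sub>m m :: 'k mat)" for m by (simp add: units_of_def ring_mat_simps)
  have P_mult: "(s, A, B) \<otimes>\<^bsub>P\<^esub> (s', A', B') = (s \<otimes> s', A * A', B * B')" for s A B s' A' B'
    by (simp add: P_def DirProd_def mult_GL)
  have T_mult: "(s \<otimes> s', A * A', B * B') \<in> T" if "(s, A, B) \<in> T" "(s', A', B') \<in> T" for s A B s' A' B'
  proof -
    have c: "A \<in> carrier_mat n n" "B \<in> carrier_mat d d" "A' \<in> carrier_mat n n" "B' \<in> carrier_mat d d"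
      using that GLc by (auto simp: T_iff)
    have "\<phi> (\<rho> (s \<otimes> s') v) = kronecker (A * A') (B * B') *\<^sub>v \<phi> v" for v
      using that assoc_mult_mat_vec[OF kronecker_carrier[OF c(1,2)] kronecker_carrier[OF c(3,4)] \<phi>c]
      by (simp add: T_iff rho_mult kronecker_mult[OF c, symmetric])
    then show ?thesis
      using that GLn.m_closed[of A A'] GLd.m_closed[of B B'] by (simp add: T_iff mult_GL)
  qed
  have T_sub: "subgroup T P"
  proof (rule P.subgroupI)
    show "T \<subseteq> carrier P" by (auto simp: T_def P_def DirProd_def)
    have "(\<one>, 1\<^sub>m n, 1\<^sub>m d) \<in> T"
      using GLn.one_closed GLd.one_closed \<phi>c by (simp add: T_iff kronecker_one rho_one GL_one)
    then show "T \<noteq> {}" by blast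
  next
    fix t assume t: "t \<in> T"
    then obtain s A B where sAB: "t = (s, A, B)" "s \<in> carrier G" "A \<in> carrier (GL n)" "B \<in> carrier (GL d)"
      "\<And>v. \<phi> (\<rho> s v) = kronecker A B *\<^sub>v \<phi> v" by (auto simp: T_def)
    define A' B' where "A' = inv\<^bsub>GL n\<^esub> A" and "B' = inv\<^bsub>GL d\<^esub> B"
    have A': "A' \<in> carrier (GL n)" "A' * A = 1\<^sub>m n" and B': "B' \<in> carrier (GL d)" "B' * B = 1\<^sub>m d"
      using GLn.inv_closed[OF sAB(3)] GLn.l_inv[OF sAB(3)] GLd.inv_closed[OF sAB(4)] GLd.l_inv[OF sAB(4)]
      by (simp_all add: A'_def B'_def mult_GL GL_one)
    note c = GLc[OF A'(1)] GLc[OF B'(1)] GLc[OF sAB(3)] GLc[OF sAB(4)]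
    have "inv\<^bsub>P\<^esub> t = (inv s, A', B')"
      unfolding P_def sAB(1) using sAB is_group group_GL
      by (simp add: inv_DirProd[of G] DirProd_group inv_DirProd A'_def B'_def)
    moreover have "(inv s, A', B') \<in> T"
      unfolding T_iff
    proof (intro conjI allI)
      fix v
      have "kronecker A' B' *\<^sub>v \<phi> (\<rho> s (\<rho> (inv s) v)) = \<phi> (\<rho> (inv s) v)"
        unfolding sAB(5)
        using assoc_mult_mat_vec[OF kronecker_carrier[OF c(1,2)] kronecker_carrier[OF c(3,4)] \<phi>c]
          kronecker_mult[OF c] kronecker_one[of n d, where ?'a = 'k] A'(2) B'(2) one_mult_mat_vec[OF \<phi>c]
        by simp
      then show "\<phi> (\<rho> (inv s) v) = kronecker A' B' *\<^sub>v \<phi> v" using sAB(2) by simp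
    qed (use sAB A' B' in auto)
    ultimately show "inv\<^bsub>P\<^esub> t \<in> T" by simp
  next
    fix t t' assume "t \<in> T" "t' \<in> T"
    then show "t \<otimes>\<^bsub>P\<^esub> t' \<in> T" using T_mult by (cases t, cases t') (simp add: P_mult)
  qed
  define Y where "Y = P\<lparr>carrier := T\<rparr>"
  have Y: "group Y" unfolding Y_def using T_sub P.is_group by (rule subgroup.subgroup_is_group)
  have Y_simps: "carrier Y = T" "monoid.mult Y = monoid.mult P" "\<one>\<^bsub>Y\<^esub> = (\<one>, 1\<^sub>m n, 1\<^sub>m d)"
    by (simp_all add: Y_def P_def DirProd_def GL_one)
  have lift: "\<exists>A B. (s, A, B) \<in> T" if s: "s \<in> carrier G" for s
  proof -
    obtain A B where AB: "A \<in> carrier_mat n n" "B \<in> carrier_mat d d" "\<And>v. \<phi> (\<rho> s v) = kronecker A B *\<^sub>v \<phi> v"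
      using factor[OF s] by blast
    obtain A' B' where AB': "A' \<in> carrier_mat n n" "B' \<in> carrier_mat d d"
      "\<And>v. \<phi> (\<rho> (inv s) v) = kronecker A' B' *\<^sub>v \<phi> v"
      using factor[of "inv s"] s by blast
    have "kronecker (A * A') (B * B') = 1\<^sub>m (n * d)"
      using kron_inv[OF s AB(1,2) AB'(1,2) AB(3) AB'(3)] kronecker_mult[OF AB(1,2) AB'(1,2)] by simp
    then obtain a b where ab: "A * A' = a \<cdot>\<^sub>m 1\<^sub>m n" "B * B' = b \<cdot>\<^sub>m 1\<^sub>m d" "a * b = 1"
      using kronecker_eq_one[of "A * A'" n "B * B'" d] AB AB' n d by (auto intro: mult_carrier_mat)
    have cancel: "p \<cdot>\<^sub>m (q \<cdot>\<^sub>m 1\<^sub>m m) = 1\<^sub>m m" if "p * q = 1" for p q :: 'k and m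
      using that by (intro eq_matI) (auto simp: mult.assoc[symmetric])
    \<comment> \<open>The factors obtained so far need not be mutually inverse:
      \<open>A * A'\<close> is the scalar \<open>a\<close> and \<open>a * b = 1\<close>, so
      \<open>b\<close> times \<open>A'\<close> inverts \<open>A\<close>, and \<open>a\<close> times
      \<open>B'\<close> inverts \<open>B\<close>.\<close>
    have "A * (b \<cdot>\<^sub>m A') = 1\<^sub>m n"
      unfolding mult_smult_distrib[OF AB(1) AB'(1)] ab(1) using ab(3) by (simp add: cancel mult.commute)
    moreover have "B * (a \<cdot>\<^sub>m B') = 1\<^sub>m d"
      unfolding mult_smult_distrib[OF AB(2) AB'(2)] ab(2) using ab(3) by (rule cancel)
    ultimately have "A \<in> carrier (GL n)" "B \<in> carrier (GL d)"
      using AB AB' smult_carrier_mat unfolding carrier_GL by blast+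
    then show ?thesis using s AB(3) by (auto simp: T_iff)
  qed
  \<comment> \<open>Above the identity of \<open>G\<close> the Kronecker product is 1, so both
    factors are scalars. Centrality of the kernel and projectivity of the splitting both come from
    this.\<close>
  have ker: "\<exists>a b. A = a \<cdot>\<^sub>m 1\<^sub>m n \<and> B = b \<cdot>\<^sub>m 1\<^sub>m d" if "(s, A, B) \<in> kernel Y G fst" for s A B
  proof -
    have t: "(\<one>, A, B) \<in> T" "s = \<one>" using that by (auto simp: kernel_def Y_simps)
    then have c: "A \<in> carrier_mat n n" "B \<in> carrier_mat d d" using GLc by (auto simp: T_iff)
    have "kronecker A B = 1\<^sub>m (n * d)"
    proof (rule ext[OF kronecker_carrier[OF c]])
      fix v
      have "\<phi> v = kronecker A B *\<^sub>v \<phi> v" using t by (simp add: T_iff rho_one)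
      then show "kronecker A B *\<^sub>v \<phi> v = 1\<^sub>m (n * d) *\<^sub>v \<phi> v" using one_mult_mat_vec[OF \<phi>c] by simp
    qed simp
    then show ?thesis using kronecker_eq_one[OF c] n d by (metis gr_implies_not0 not_gr_zero)
  qed
  define A where "A = (\<lambda>t :: 'g \<times> 'k mat \<times> 'k mat. fst (snd t))"
  define B where "B = (\<lambda>t :: 'g \<times> 'k mat \<times> 'k mat. snd (snd t))"
  have Tc: "A t \<in> carrier_mat n n" "B t \<in> carrier_mat d d" "fst t \<in> carrier G"
    "\<phi> (\<rho> (fst t) v) = kronecker (A t) (B t) *\<^sub>v \<phi> v" if "t \<in> T" for t v
    using that GLc by (auto simp: T_def A_def B_def)
  have ext_Y: "central_extension Y G fst"
    unfolding central_extension_def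
  proof (intro conjI ballI Y)
    show "fst \<in> epi Y G"
    proof -
      have "fst \<in> hom Y G"
        unfolding hom_def Y_simps using Tc(3) by (auto simp: P_mult)
      moreover have "fst ` carrier Y = carrier G"
        unfolding Y_simps using Tc(3) lift by (auto simp: image_iff) (metis fst_conv)
      ultimately show ?thesis by (simp add: epi_def)
    qed
  next
    fix c y assume "c \<in> kernel Y G fst" "y \<in> carrier Y"
    then obtain s A0 B0 s' A1 B1 where cy: "c = (s, A0, B0)" "y = (s', A1, B1)"
      "(s, A0, B0) \<in> kernel Y G fst" "(s', A1, B1) \<in> T" by (metis Y_simps(1) prod_cases3)
    obtain a b where ab: "A0 = a \<cdot>\<^sub>m 1\<^sub>m n" "B0 = b \<cdot>\<^sub>m 1\<^sub>m d" using ker[OF cy(3)] by blast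
    have c1: "A1 \<in> carrier_mat n n" "B1 \<in> carrier_mat d d" "s' \<in> carrier G"
      using cy(4) GLc by (auto simp: T_iff)
    have s: "s = \<one>" using cy(3) by (simp add: kernel_def)
    show "c \<otimes>\<^bsub>Y\<^esub> y = y \<otimes>\<^bsub>Y\<^esub> c"
      unfolding cy(1,2) Y_simps P_mult ab s using c1
      by (simp add: mult_smult_distrib[OF c1(1) one_carrier_mat] mult_smult_distrib[OF c1(2) one_carrier_mat]
          mult_smult_assoc_mat[OF one_carrier_mat c1(1)] mult_smult_assoc_mat[OF one_carrier_mat c1(2)])
  qed
  have YA: "matrix_rep Y n A"
    by (rule matrix_repI[OF Y]) (use Tc in \<open>auto simp: Y_simps A_def P_mult\<close>)
  have YB: "matrix_rep Y d B"
    by (rule matrix_repI[OF Y]) (use Tc in \<open>auto simp: Y_simps B_def P_mult\<close>)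
  have YAB: "matrix_rep Y (n * d) (\<lambda>t. kronecker (A t) (B t))"
  proof (rule matrix_repI[OF Y])
    fix t t' assume "t \<in> carrier Y" "t' \<in> carrier Y"
    then show "kronecker (A (t \<otimes>\<^bsub>Y\<^esub> t')) (B (t \<otimes>\<^bsub>Y\<^esub> t')) = kronecker (A t) (B t) * kronecker (A t') (B t')"
      using kronecker_mult[OF Tc(1,2)[of t] Tc(1,2)[of t']] matrix_rep_mult[OF YA] matrix_rep_mult[OF YB]
      by (simp add: Y_simps)
  qed (use Tc in \<open>auto simp: Y_simps A_def B_def kronecker_one intro!: kronecker_carrier\<close>)
  have aff: "affords_matrix_rep Y scale (\<rho> \<circ> fst) (n * d) (\<lambda>t. kronecker (A t) (B t))"
    unfolding affords_matrix_rep_iff using YAB \<phi> Tc(4) by (auto simp: Y_simps)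
  have split: "splitting G scale \<rho> Y fst n A d B"
    using ext_Y n d YA YB aff by (simp add: splitting_def)
  have proj: "projective_splitting G scale \<rho> Y fst n A d B"
    unfolding projective_splitting_def
  proof (intro conjI ballI split)
    fix c assume "c \<in> kernel Y G fst"
    then have "\<exists>a b. A c = a \<cdot>\<^sub>m 1\<^sub>m n \<and> B c = b \<cdot>\<^sub>m 1\<^sub>m d"
      using ker[of "fst c" "A c" "B c"] by (simp add: A_def B_def)
    then show "\<exists>a. A c = a \<cdot>\<^sub>m 1\<^sub>m n" "\<exists>a. B c = a \<cdot>\<^sub>m 1\<^sub>m d" by auto
  qed
  have "\<forall>s\<in>carrier G. \<exists>N\<in>carrier_mat (n * d) (n * d). \<forall>v. \<phi> (\<rho> s v) = N *\<^sub>v \<phi> v"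
    using coords_matrix[OF \<phi> rho_endo] by blast
  then obtain M where M: "\<And>s. s \<in> carrier G \<Longrightarrow> M s \<in> carrier_mat (n * d) (n * d)"
    "\<And>s v. s \<in> carrier G \<Longrightarrow> \<phi> (\<rho> s v) = M s *\<^sub>v \<phi> v" by metis
  have "absolutely_irreducible_rep G (n * d) M"
    by (rule absolutely_irreducible_coords[OF abs nz \<phi> M])
  \<comment> \<open>The extension acts on \<open>V\<close> by the same set of matrices as
    \<open>G\<close>, and irreducibility depends on that set only.\<close>
  then have "absolutely_irreducible_rep Y (n * d) (\<lambda>t. kronecker (A t) (B t))"
  proof (rule absolutely_irreducible_rep_image)
    fix s assume s: "s \<in> carrier G"
    then obtain t where t: "t \<in> T" "fst t = s" using lift by (metis fst_conv)
    have "kronecker (A t) (B t) = M s"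
      by (rule ext[OF kronecker_carrier[OF Tc(1,2)[OF t(1)]] M(1)[OF s]])
        (use Tc(4)[OF t(1)] M(2)[OF s] t(2) in metis)
    then show "\<exists>y\<in>carrier Y. kronecker (A y) (B y) = M s" using t(1) by (auto simp: Y_simps)
  qed
  then have "irreducible_rep Y (n * d) (\<lambda>t. map_mat to_ac (kronecker (A t) (B t)))"
    by (simp add: absolutely_irreducible_rep_def)
  then have irr: "irreducible_rep Y (n * d) (\<lambda>t. kronecker (map_mat to_ac (A t)) (map_mat to_ac (B t)))"
    using map_kronecker[OF Tc(1,2)] unfolding irreducible_rep_def invariant_subspace_def
    by (simp add: Y_simps)
  have "absolutely_simple_splitting G scale \<rho> Y fst n A d B"
    unfolding absolutely_simple_splitting_def absolutely_irreducible_rep_def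
  proof (intro conjI split)
    show "irreducible_rep Y n (\<lambda>t. map_mat to_ac (A t))"
      by (rule irreducible_kronecker_left[OF irr]) (use d Tc in \<open>auto simp: Y_simps\<close>)
    show "irreducible_rep Y d (\<lambda>t. map_mat to_ac (B t))"
      by (rule irreducible_kronecker_right[OF irr]) (use n Tc in \<open>auto simp: Y_simps\<close>)
  qed
  then show ?thesis
    unfolding admits_projective_absolutely_simple_splitting_def using proj by blast
qed

end

section \<open>Very simple modules\<close>

context fin_rep
begin

section \<open>Sufficiency of the three conditions\<close>

text \<open>If the second tensor factor is at most a line, every operator has scalar corners between
  the idempotents \<open>E i i\<close>, so it is a combination of matrix units.\<close>

lemma matrix_units_dim_one:
  assumes R: "subalgebra_End scale R" and E: "matrix_unit_system R n E" and n: "n > 0"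
    and \<chi>: "coords {v. E 0 0 v = v} d \<chi>" and d: "d \<le> 1" and f: "endo f"
  shows "f \<in> R"
proof -
  let ?U = "{v. E 0 0 v = v}"
  note Rendo = subalgebra_endo[OF R] and ER = matrix_unit_mem[OF E] and EE = matrix_unit_mult[OF E]
    and Eid = matrix_unit_sum[OF E]
  have Eendo: "endo (E i j)" if "i < n" "j < n" for i j using Rendo[OF ER[OF that]] .
  have "\<exists>c. \<forall>v. E i i (f (E j j v)) = scale c (E i j v)" if ij: "i < n" "j < n" for i j
  proof -
    define g where "g = (\<lambda>v. E 0 i (f (E j 0 v)))"
    have g: "endo g"
      using endo_comp[OF Eendo[OF n ij(1)] endo_comp[OF f Eendo[OF ij(2) n]]] by (simp add: g_def comp_def)
    have gU: "g v \<in> ?U" for v using EE n ij by (simp add: g_def)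
    obtain A where A: "A \<in> carrier_mat d d" "\<And>u. u \<in> ?U \<Longrightarrow> \<chi> (g u) = A *\<^sub>v \<chi> u"
      using coords_matrix[OF \<chi> g gU] by blast
    have gc: "g u = scale (A $$ (0, 0)) u" if u: "u \<in> ?U" for u
    proof (rule coords_inj[OF \<chi> gU])
      show "scale (A $$ (0, 0)) u \<in> ?U" using u by (simp add: endo_scaleD[OF Eendo[OF n n]])
      \<comment> \<open>Here \<open>d\<close> is 0 or 1. For \<open>d = 0\<close> the index (0, 0)
        is out of range, but both vectors are then empty.\<close>
      have "A *\<^sub>v \<chi> u = A $$ (0, 0) \<cdot>\<^sub>v \<chi> u"
        using A(1) coords_closed[OF \<chi> u] d by (intro eq_vecI) (auto simp: scalar_prod_def le_Suc_eq)
      then show "\<chi> (g u) = \<chi> (scale (A $$ (0, 0)) u)"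
        using A(2)[OF u] coords_scale[OF \<chi> u] by simp
    qed
    have "E i i (f (E j j v)) = scale (A $$ (0, 0)) (E i j v)" for v
    proof -
      have "E i i (f (E j j v)) = E i 0 (g (E 0 j v))" using EE n ij by (simp add: g_def)
      also have "\<dots> = E i 0 (scale (A $$ (0, 0)) (E 0 j v))" using EE n ij by (subst gc) auto
      also have "\<dots> = scale (A $$ (0, 0)) (E i j v)"
        using EE n ij by (simp add: endo_scaleD[OF Eendo[OF ij(1) n]])
      finally show ?thesis .
    qed
    then show ?thesis by blast
  qed
  then obtain c where c: "\<And>i j v. i < n \<Longrightarrow> j < n \<Longrightarrow> E i i (f (E j j v)) = scale (c i j) (E i j v)" by metis
  have "f v = (\<Sum>i<n. \<Sum>j<n. scale (c i j) (E i j v))" for v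
  proof -
    have "f v = (\<Sum>i<n. E i i (f (\<Sum>j<n. E j j v)))" unfolding Eid ..
    also have "\<dots> = (\<Sum>i<n. \<Sum>j<n. E i i (f (E j j v)))"
      by (auto simp: endo_sum[OF f] endo_sum[OF Eendo] intro!: sum.cong)
    finally show ?thesis by (simp add: c)
  qed
  then have feq: "f = (\<lambda>v. \<Sum>i<n. \<Sum>j<n. scale (c i j) (E i j v))" by (rule ext)
  show ?thesis unfolding feq
    by (intro subalgebra_sum[OF R] subalgebra_scale[OF R] ER) auto
qed

theorem very_simpleI:
  assumes k: "(\<forall>p :: 'k poly. degree p > 0 \<longrightarrow> (\<exists>x. poly p x = 0)) \<or>
      (derived G (carrier G) = carrier G \<and> finite (UNIV :: 'k set))"
    and nz: "\<exists>v :: 'v. v \<noteq> 0"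
    and abs: "absolutely_simple G scale \<rho>"
    and split: "\<not> admits_projective_absolutely_simple_splitting G scale \<rho>"
    and ind: "\<not> induced_from_proper_finite_index G scale \<rho>"
  shows "very_simple G scale \<rho>"
  unfolding very_simple_def normal_subalgebra_iff
proof (intro allI impI, elim conjE)
  fix R assume R: "subalgebra_End scale R" "conj_stable R"
  have simple: simple_module and schur: scalar_commutant
    using absolutely_simple_imp[OF abs] .
  note Rendo = subalgebra_endo[OF R(1)]
  have "stable R UNIV" by (simp add: stable_def)
  moreover have "(UNIV :: 'v set) \<noteq> {0}" using nz by blast
  ultimately obtain W where W: "stable R W" "W \<noteq> {0}"
    and Wmin: "\<And>W'. stable R W' \<Longrightarrow> W' \<noteq> {0} \<Longrightarrow> W' \<subseteq> W \<Longrightarrow> W' = W"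
    using minimal_stable[of "\<lambda>W. stable R W \<and> W \<noteq> {0}" UNIV] stable_subspace by metis
  obtain e where e: "e \<in> cent R" "\<And>v. e v \<in> W" "\<And>w. w \<in> W \<Longrightarrow> e w = w"
    using stable_projection[OF simple nz R(2) Rendo W(1)] by blast
  interpret simple_submodule scale Basis G \<rho> R W e
    by unfold_locales (use R W Wmin e in auto)
  have faithful: "r = (\<lambda>v. 0)" if r: "r \<in> R" and rW: "\<And>w. w \<in> W \<Longrightarrow> r w = 0" for r
  proof -
    \<comment> \<open>The annihilator of \<open>W\<close> in \<open>R\<close> is closed under right
      multiplication by \<open>R\<close>, and its elements commute with \<open>cent R\<close>. Hence
      its common kernel \<open>M\<close> is stable under both, and it contains
      \<open>W\<close>.\<close>
    define A where "A = {r \<in> R. \<forall>w\<in>W. r w = 0}"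
    define M where "M = {v. \<forall>r\<in>A. r v = 0}"
    have "stable (R \<union> cent R) M"
      unfolding stable_def
    proof (intro conjI ballI)
      show "subspace M"
        using Rendo by (auto simp: M_def A_def subspace_def endo_addD endo_scaleD endo_zero)
      fix f v assume f: "f \<in> R \<union> cent R" and v: "v \<in> M"
      show "f v \<in> M"
        unfolding M_def
      proof (intro CollectI ballI)
        fix r assume r: "r \<in> A"
        show "r (f v) = 0"
        proof (cases "f \<in> R")
          case True
          have "(\<lambda>v. r (f v)) \<in> A" using r R_mult[of r f] True R_W[OF True] by (auto simp: A_def)
          then show ?thesis using v by (auto simp: M_def)
        next
          case False
          then have fc: "f \<in> cent R" using f by simp
          have "r v = 0" using v r by (auto simp: M_def)
          have "r \<in> R" using r by (simp add: A_def)
          then have "r (f v) = f (r v)" using centD[OF fc] by simp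
          then show ?thesis using \<open>r v = 0\<close> endo_zero[OF cent_endo[OF fc]] by simp
        qed
      qed
    qed
    moreover have "W \<subseteq> M" by (auto simp: M_def A_def)
    then have "M \<noteq> {0}" using W_nonzero W_subspace by (auto simp: subspace_0)
    ultimately have "M = UNIV"
      by (intro normal_joint_simple[where M = M, OF simple nz schur ind R(2)] Rendo)
    moreover have "r \<in> A" using r rW by (simp add: A_def)
    ultimately show ?thesis by (auto simp: M_def)
  qed
  have scalar: "\<exists>c. \<forall>v. d v = scale c (e v)" if "d \<in> D" for d
    using k
  proof
    assume "\<forall>p :: 'k poly. degree p > 0 \<longrightarrow> (\<exists>x. poly p x = 0)"
    then show ?thesis by (intro D_scalar_closed that) blast
  next
    assume "derived G (carrier G) = carrier G \<and> finite (UNIV :: 'k set)"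
    then show ?thesis
      using D_scalar_finite[OF simple nz schur ind _ _ R(2) faithful that] by blast
  qed
  obtain n E where n: "n > 0" and E: "matrix_unit_system R n E"
    using matrix_units[OF faithful scalar] by blast
  define U where "U = {v. E 0 0 v = v}"
  have E00: "endo (E 0 0)" using E n by (intro Rendo) (simp add: matrix_unit_system_def)
  have "subspace U" using E00 by (auto simp: U_def subspace_def endo_addD endo_scaleD endo_zero)
  then obtain d \<chi> where \<chi>: "coords U d \<chi>" using coords_exist by blast
  \<comment> \<open>\<open>n\<close> and \<open>d\<close> are the dimensions of the two tensor
    factors. A first factor of dimension 1 leaves only scalars in \<open>R\<close>, a second one of
    dimension at most 1 puts every operator into \<open>R\<close>, and otherwise the excluded
    splitting arises.\<close>
  consider "n = 1" | "d \<le> 1" | "n > 1" "d > 1" using n by linarith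
  then show "R = range scale \<or> R = {f. endo f}"
  proof cases
    case 1
    have E1: "E 0 0 v = v" for v using E 1 by (simp add: matrix_unit_system_def)
    have "R = range scale"
    proof (intro equalityI subsetI)
      fix r assume "r \<in> R"
      then obtain c where "\<And>v. E 0 0 (r (E 0 0 v)) = scale c (E 0 0 v)"
        using E 1 unfolding matrix_unit_system_def by (metis less_one)
      then have "r = scale c" by (simp add: E1 fun_eq_iff)
      then show "r \<in> range scale" by blast
    next
      fix r assume "r \<in> range scale"
      then obtain c where "r = scale c" by blast
      then show "r \<in> R" using R_scale[OF R_id, of c] by simp
    qed
    then show ?thesis by simp
  next
    case 2
    have "f \<in> R" if "endo f" for f
      using matrix_units_dim_one[OF R(1) E n \<chi>[unfolded U_def] 2 that] .
    then show ?thesis using Rendo by blast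
  next
    case 3
    have "admits_projective_absolutely_simple_splitting G scale \<rho>"
      by (rule tensor_splitting[OF abs nz R E 3 \<chi>[unfolded U_def]])
    then show ?thesis using split by simp
  qed
qed

section \<open>Necessity of the three conditions\<close>

lemma very_simpleD:
  assumes "very_simple G scale \<rho>" "subalgebra_End scale R" "conj_stable R"
  shows "R = range scale \<or> R = {f. endo f}"
  using assms by (simp add: very_simple_def normal_subalgebra_iff)

text \<open>Conjugation by a Kronecker product cancels in the first factor of
  \<open>kronecker (1\<^sub>m n1) B\<close>, so these operators form a conjugation-stable set
  \<open>S\<close>. Its commutant lies strictly between the scalars and all operators because both
  factors have dimension above 1.\<close>

lemma very_simple_not_splitting:
  assumes vs: "very_simple G scale \<rho>"
  shows "\<not> splitting G scale \<rho> E \<pi> n1 \<rho>1 n2 \<rho>2"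
proof
  assume "splitting G scale \<rho> E \<pi> n1 \<rho>1 n2 \<rho>2"
  then obtain \<phi> where E: "group E" and epi: "\<pi> \<in> epi E G" and n: "n1 > 1" "n2 > 1"
    and r: "matrix_rep E n1 \<rho>1" "matrix_rep E n2 \<rho>2" and \<phi>: "coords UNIV (n1 * n2) \<phi>"
    and eq: "\<And>x v. x \<in> carrier E \<Longrightarrow> \<phi> (\<rho> (\<pi> x) v) = kronecker (\<rho>1 x) (\<rho>2 x) *\<^sub>v \<phi> v"
    by (auto simp: splitting_def central_extension_def affords_matrix_rep_iff)
  interpret E: group E by (rule E)
  have \<phi>c: "\<phi> v \<in> carrier_vec (n1 * n2)" for v using coords_closed[OF \<phi>] by simp
  have inj: "u = v" if "\<phi> u = \<phi> v" for u v using coords_inj[OF \<phi> _ _ that] by simp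
  define op where "op = mat_op \<phi>"
  note op = coords_mat_op[OF \<phi>, folded op_def] and op_endo = mat_op_endo[OF \<phi>, folded op_def]
  have kc: "kronecker A B \<in> carrier_mat (n1 * n2) (n1 * n2)"
    if "A \<in> carrier_mat n1 n1" "B \<in> carrier_mat n2 n2" for A B :: "'k mat"
    using kronecker_carrier[OF that] .
  have op_op: "op (kronecker A B) (op (kronecker A' B') v) = op (kronecker (A * A') (B * B')) v"
    if c: "A \<in> carrier_mat n1 n1" "B \<in> carrier_mat n2 n2" "A' \<in> carrier_mat n1 n1" "B' \<in> carrier_mat n2 n2"
    for A B A' B' v
  proof (rule inj)
    show "\<phi> (op (kronecker A B) (op (kronecker A' B') v)) = \<phi> (op (kronecker (A * A') (B * B')) v)"
      unfolding op[OF kc[OF c(1,2)]] op[OF kc[OF c(3,4)]]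
        op[OF kc[OF mult_carrier_mat[OF c(1,3)] mult_carrier_mat[OF c(2,4)]]]
      using assoc_mult_mat_vec[OF kc[OF c(1,2)] kc[OF c(3,4)] \<phi>c] by (simp add: kronecker_mult[OF c])
  qed
  have op_\<rho>: "\<rho> (\<pi> x) v = op (kronecker (\<rho>1 x) (\<rho>2 x)) v" if "x \<in> carrier E" for x v
    by (rule inj) (simp add: eq[OF that] op[OF kc[OF matrix_rep_carrier[OF r(1) that] matrix_rep_carrier[OF r(2) that]]])
  have op_inj: "N = N'" if "N \<in> carrier_mat (n1 * n2) (n1 * n2)" "N' \<in> carrier_mat (n1 * n2) (n1 * n2)"
    "\<And>v. op N v = op N' v" for N N'
    by (rule coords_mat_eqI[OF \<phi> that(1,2)]) (simp add: op[symmetric] that)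
  define S where "S = {op (kronecker (1\<^sub>m n1) B) |B. B \<in> carrier_mat n2 n2}"
  have Sendo: "endo f" if "f \<in> S" for f using that by (auto simp: S_def intro!: op_endo kc)
  have "conj_stable S"
    unfolding conj_stable_def
  proof (intro ballI)
    fix s f assume "s \<in> carrier G" "f \<in> S"
    then obtain B where B: "B \<in> carrier_mat n2 n2" "f = op (kronecker (1\<^sub>m n1) B)"
      by (auto simp: S_def)
    obtain x where x: "x \<in> carrier E" "s = \<pi> x"
      using epi \<open>s \<in> carrier G\<close> by (auto simp: epi_def)
    have h: "\<pi> \<in> hom E G" using epi by (simp add: epi_def)
    interpret h: group_hom E G \<pi> by unfold_locales (rule h)
    have inv: "inv (\<pi> x) = \<pi> (inv\<^bsub>E\<^esub> x)" using x by simp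
    have ix: "inv\<^bsub>E\<^esub> x \<in> carrier E" using x by simp
    note c = matrix_rep_carrier[OF r(1) x(1)] matrix_rep_carrier[OF r(2) x(1)]
      matrix_rep_carrier[OF r(1) ix] matrix_rep_carrier[OF r(2) ix]
    have "\<rho>1 x * \<rho>1 (inv\<^bsub>E\<^esub> x) = 1\<^sub>m n1"
      using matrix_rep_mult[OF r(1) x(1) ix] matrix_rep_one[OF E r(1)] x(1) by simp
    then have one: "\<rho>1 x * (1\<^sub>m n1 * \<rho>1 (inv\<^bsub>E\<^esub> x)) = 1\<^sub>m n1" using c(3) by simp
    have "conjugate s f v = op (kronecker (1\<^sub>m n1) (\<rho>2 x * (B * \<rho>2 (inv\<^bsub>E\<^esub> x)))) v" for v
      unfolding conjugate_def inv x(2) op_\<rho>[OF x(1)] op_\<rho>[OF ix] B(2)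
      using op_op[OF one_carrier_mat B(1) c(3,4)]
        op_op[OF c(1,2) mult_carrier_mat[OF one_carrier_mat c(3)] mult_carrier_mat[OF B(1) c(4)]]
      by (simp only: one)
    then show "conjugate s f \<in> S"
      unfolding S_def using mult_carrier_mat[OF c(2) mult_carrier_mat[OF B(1) c(4)]] by blast
  qed
  then have cs: "conj_stable (cent S)" by (rule cent_conj_stable)
  let ?e = "\<lambda>m p q. mat m m (\<lambda>ij. if ij = (p, q) then 1 else 0 :: 'k)"
  have "cent S = range scale \<or> cent S = {f. endo f}"
    by (rule very_simpleD[OF vs cent_subalgebra[OF Sendo] cs])
  then show False
  proof
    assume *: "cent S = range scale"
    \<comment> \<open>An elementary projection in the first factor commutes with \<open>S\<close>,
      but its diagonal entries 1 and 0 cannot both equal one scalar.\<close>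
    define f where "f = op (kronecker (?e n1 0 0) (1\<^sub>m n2))"
    have "f \<in> cent S"
      unfolding cent_def f_def
    proof (intro CollectI conjI ballI allI)
      fix g v assume "g \<in> S"
      then obtain B where B: "B \<in> carrier_mat n2 n2" "g = op (kronecker (1\<^sub>m n1) B)" by (auto simp: S_def)
      show "op (kronecker (?e n1 0 0) (1\<^sub>m n2)) (g v) = g (op (kronecker (?e n1 0 0) (1\<^sub>m n2)) v)"
        unfolding B(2) using B(1) by (simp add: op_op)
    qed (auto intro!: op_endo kc)
    then obtain c where c: "f = scale c" using * by auto
    have "op (c \<cdot>\<^sub>m 1\<^sub>m (n1 * n2)) v = scale c v" for v
      by (rule inj) (use \<phi>c in \<open>simp add: op coords_scale[OF \<phi>] smult_one_mult_vec\<close>)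
    then have "kronecker (?e n1 0 0) (1\<^sub>m n2) = c \<cdot>\<^sub>m 1\<^sub>m (n1 * n2)"
      using c by (intro op_inj kc) (auto simp: f_def)
    then have e: "kronecker (?e n1 0 0) (1\<^sub>m n2) $$ (i * n2 + 0, i * n2 + 0) = c" if "i < n1" for i
      using block_less[OF that, of 0 n2] n by simp
    have "?e n1 0 0 $$ (i, i) = c" if "i < n1" for i
      using e[OF that] kronecker_index[of "?e n1 0 0" n1 "1\<^sub>m n2" n2 i i 0 0] that n by simp
    from this[of 0] this[of 1] show False using n by simp
  next
    assume *: "cent S = {f. endo f}"
    \<comment> \<open>If everything commuted with \<open>S\<close>, then \<open>S\<close> would be
      commutative; two elementary matrices of size \<open>n2 > 1\<close> refute this.\<close>
    have B: "?e n2 0 1 \<in> carrier_mat n2 n2" "?e n2 1 0 \<in> carrier_mat n2 n2" by auto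
    have SB: "op (kronecker (1\<^sub>m n1) (?e n2 0 1)) \<in> S" "op (kronecker (1\<^sub>m n1) (?e n2 1 0)) \<in> S"
      using B by (auto simp: S_def)
    then have "op (kronecker (1\<^sub>m n1) (?e n2 0 1)) \<in> cent S" using * Sendo by blast
    from centD[OF this SB(2)]
    have "op (kronecker (1\<^sub>m n1 * 1\<^sub>m n1) (?e n2 0 1 * ?e n2 1 0)) v = op (kronecker (1\<^sub>m n1 * 1\<^sub>m n1) (?e n2 1 0 * ?e n2 0 1)) v" for v
      using op_op[OF one_carrier_mat B(1) one_carrier_mat B(2)] op_op[OF one_carrier_mat B(2) one_carrier_mat B(1)]
      by simp
    then have "kronecker (1\<^sub>m n1 * 1\<^sub>m n1) (?e n2 0 1 * ?e n2 1 0) = kronecker (1\<^sub>m n1 * 1\<^sub>m n1) (?e n2 1 0 * ?e n2 0 1)"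
      using B by (intro op_inj kc mult_carrier_mat one_carrier_mat) auto
    then have eq: "kronecker (1\<^sub>m n1) (?e n2 0 1 * ?e n2 1 0) = kronecker (1\<^sub>m n1) (?e n2 1 0 * ?e n2 0 1)"
      by simp
    have entry: "kronecker (1\<^sub>m n1) N $$ (0, 0) = N $$ (0, 0)" if "N \<in> carrier_mat n2 n2" for N :: "'k mat"
      using kronecker_index[OF one_carrier_mat that, of 0 n1 0 0 0] n by simp
    have "(?e n2 0 1 * ?e n2 1 0) $$ (0, 0) = (?e n2 1 0 * ?e n2 0 1) $$ (0, 0)"
      unfolding entry[OF mult_carrier_mat[OF B], symmetric] entry[OF mult_carrier_mat[OF B(2,1)], symmetric] eq ..
    moreover have "(?e n2 0 1 * ?e n2 1 0) $$ (0, 0) = 1"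
    proof -
      have "(?e n2 0 1 * ?e n2 1 0) $$ (0, 0) =
          (\<Sum>k = 0..<n2. (if k = 1 then 1 else 0) * (if k = 1 then 1 else 0))"
        using n by (simp add: scalar_prod_def)
      also have "\<dots> = (\<Sum>k = 0..<n2. if k = 1 then 1 else 0)" by (rule sum.cong) auto
      finally show ?thesis using n by simp
    qed
    moreover have "(?e n2 1 0 * ?e n2 0 1) $$ (0, 0) = 0"
      using n by (auto simp: scalar_prod_def intro!: sum.neutral)
    ultimately show False using n by simp
  qed
qed


text \<open>In the function model a function constant on the left cosets of \<open>H\<close> acts by
  multiplication. Translations permute these cosets, so conjugates of such operators are of the same
  kind and the operators form a normal subalgebra.\<close>

lemma very_simple_not_induced:
  assumes vs: "very_simple G scale \<rho>" and nz: "\<exists>v :: 'v. v \<noteq> 0"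
  shows "\<not> induced_from_proper_finite_index G scale \<rho>"
proof
  assume "induced_from_proper_finite_index G scale \<rho>"
  then obtain H d and \<sigma> :: "'g \<Rightarrow> 'k mat" where H: "subgroup H G" and index: "card (rcosets H) > 1"
    and \<sigma>: "matrix_rep (G\<lparr>carrier := H\<rparr>) d \<sigma>"
    and iso: "rep_isomorphic G scale \<rho> (induced_module G H d \<sigma>) (induced_action G)"
    unfolding induced_from_proper_finite_index_def by blast
  interpret H: subgroup H G by (rule H)
  obtain \<phi> where bij: "bij_betw \<phi> UNIV (carrier (induced_module G H d \<sigma>))"
    and \<phi>_add: "\<And>v w. \<phi> (v + w) = \<phi> v \<oplus>\<^bsub>induced_module G H d \<sigma>\<^esub> \<phi> w"
    and \<phi>_scale: "\<And>c v. \<phi> (scale c v) = c \<odot>\<^bsub>induced_module G H d \<sigma>\<^esub> \<phi> v"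
    and \<phi>_act: "\<And>g v. g \<in> carrier G \<Longrightarrow> \<phi> (\<rho> g v) = induced_action G g (\<phi> v)"
    using iso unfolding rep_isomorphic_def by blast
  have \<phi>_mem: "\<phi> v \<in> carrier G \<rightarrow>\<^sub>E carrier_vec d"
    "\<And>g h. g \<in> carrier G \<Longrightarrow> h \<in> H \<Longrightarrow> \<phi> v (g \<otimes> h) = \<sigma> (inv h) *\<^sub>v \<phi> v g" for v
    using bij by (auto simp: bij_betw_def induced_module_def)
  have \<phi>c: "\<phi> v g \<in> carrier_vec d" if "g \<in> carrier G" for v g using \<phi>_mem(1) that by auto
  have add: "\<phi> (v + w) g = \<phi> v g + \<phi> w g" if "g \<in> carrier G" for v w g
    using that by (simp add: \<phi>_add induced_module_def)
  have sc: "\<phi> (scale c v) g = c \<cdot>\<^sub>v \<phi> v g" if "g \<in> carrier G" for c v g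
    using that by (simp add: \<phi>_scale induced_module_def)
  have act: "\<phi> (\<rho> s v) g = \<phi> v (inv s \<otimes> g)" if "s \<in> carrier G" "g \<in> carrier G" for s v g
    using that by (simp add: \<phi>_act induced_action_def)
  have inj: "u = v" if "\<And>g. g \<in> carrier G \<Longrightarrow> \<phi> u g = \<phi> v g" for u v
  proof -
    have "\<phi> u = \<phi> v" using \<phi>_mem(1)[of u] \<phi>_mem(1)[of v] that by (rule PiE_ext)
    then show ?thesis using bij by (auto simp: bij_betw_def inj_on_def)
  qed
  define Q where "Q = (\<lambda>f \<gamma>. (\<forall>g\<in>carrier G. \<forall>h\<in>H. \<gamma> (g \<otimes> h) = \<gamma> g) \<and>
    (\<forall>v. \<forall>g\<in>carrier G. \<phi> (f v) g = \<gamma> g \<cdot>\<^sub>v \<phi> v g))"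
  define R where "R = {f. endo f \<and> (\<exists>\<gamma>. Q f \<gamma>)}"
  have RI: "f \<in> R" if "endo f" "Q f \<gamma>" for f \<gamma> using that by (auto simp: R_def)
  have alg: "subalgebra_End scale R"
    unfolding subalgebra_End_def
  proof (intro conjI ballI allI)
    show "R \<subseteq> {f. endo f}" by (auto simp: R_def)
    show "id \<in> R" by (rule RI[OF endo_id, of "\<lambda>_. 1"]) (simp add: Q_def)
    fix f assume f: "f \<in> R"
    then obtain \<gamma> where \<gamma>: "endo f" "Q f \<gamma>" by (auto simp: R_def)
    show "(\<lambda>v. scale c (f v)) \<in> R" for c
      by (rule RI[OF endo_smult[OF \<gamma>(1)], of _ "\<lambda>g. c * \<gamma> g"])
        (use \<gamma>(2) in \<open>auto simp: Q_def sc smult_smult_assoc\<close>)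
    fix f' assume "f' \<in> R"
    then obtain \<gamma>' where \<gamma>': "endo f'" "Q f' \<gamma>'" by (auto simp: R_def)
    show "(\<lambda>v. f v + f' v) \<in> R"
      by (rule RI[OF endo_plus[OF \<gamma>(1) \<gamma>'(1)], of "\<lambda>g. \<gamma> g + \<gamma>' g"])
        (use \<gamma>(2) \<gamma>'(2) in \<open>auto simp: Q_def add add_smult_distrib_vec\<close>)
    show "f \<circ> f' \<in> R"
      by (rule RI[OF endo_comp[OF \<gamma>(1) \<gamma>'(1)], of "\<lambda>g. \<gamma> g * \<gamma>' g"])
        (use \<gamma>(2) \<gamma>'(2) in \<open>auto simp: Q_def smult_smult_assoc\<close>)
  qed
  have "conj_stable R"
    unfolding conj_stable_def
  proof (intro ballI)
    fix s f assume s: "s \<in> carrier G" and "f \<in> R"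
    then obtain \<gamma> where \<gamma>: "endo f" "Q f \<gamma>" by (auto simp: R_def)
    show "conjugate s f \<in> R"
    proof (rule RI[OF conjugate_endo[OF s \<gamma>(1)], of "\<lambda>g. \<gamma> (inv s \<otimes> g)"])
      show "Q (conjugate s f) (\<lambda>g. \<gamma> (inv s \<otimes> g))"
        unfolding Q_def
      proof (intro conjI ballI allI)
        show "\<gamma> (inv s \<otimes> (g \<otimes> h)) = \<gamma> (inv s \<otimes> g)" if "g \<in> carrier G" "h \<in> H" for g h
          using \<gamma>(2) s that H.subset by (auto simp: Q_def m_assoc[symmetric])
        fix v g assume g: "g \<in> carrier G"
        have "\<phi> (conjugate s f v) g = \<gamma> (inv s \<otimes> g) \<cdot>\<^sub>v \<phi> (\<rho> (inv s) v) (inv s \<otimes> g)"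
          using \<gamma>(2) s g by (simp add: conjugate_def act Q_def)
        then show "\<phi> (conjugate s f v) g = \<gamma> (inv s \<otimes> g) \<cdot>\<^sub>v \<phi> v g"
          using s g by (simp add: act m_assoc[symmetric])
      qed
    qed
  qed
  then have R: "R = range scale \<or> R = {f. endo f}" using very_simpleD[OF vs alg] by blast
  have "\<exists>g1\<in>carrier G. g1 \<notin> H"
  proof (rule ccontr)
    assume neg: "\<not> ?thesis"
    have "rcosets H \<subseteq> {H}"
      using neg coset_join2[OF _ H] by (auto simp: RCOSETS_def)
    then have "card (rcosets H) \<le> card {H}" by (intro card_mono) auto
    then show False using index by simp
  qed
  then obtain g1 where g1: "g1 \<in> carrier G" "g1 \<notin> H" by blast
  obtain v0 :: 'v where v0: "v0 \<noteq> 0" using nz by blast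
  have zero_smult: "0 \<cdot>\<^sub>v \<phi> v g = 0\<^sub>v d" if "g \<in> carrier G" for v g
    using \<phi>c[OF that, of v] by (intro eq_vecI) auto
  have zero: "\<phi> 0 g = 0\<^sub>v d" if "g \<in> carrier G" for g
    using sc[OF that, of 0 0] zero_smult[OF that] by simp
  obtain g0 where g0: "g0 \<in> carrier G" "\<phi> v0 g0 \<noteq> 0\<^sub>v d"
    using inj[of v0 0] v0 zero by metis
  \<comment> \<open>The translation carries \<open>g0\<close>, a point where the function of
    \<open>v0\<close> does not vanish, to the point \<open>g\<close>.\<close>
  define pt where "pt = (\<lambda>g. \<rho> (g \<otimes> inv g0) v0)"
  have pt: "\<phi> (pt g) g \<noteq> 0\<^sub>v d" if "g \<in> carrier G" for g
    using that g0 by (simp add: pt_def act inv_mult_group m_assoc)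
  \<comment> \<open>Multiplication by the indicator function of \<open>H\<close>. The value
    \<open>undefined\<close> outside the group is what the extensional functions of the induced
    module require.\<close>
  define cut where "cut = (\<lambda>v g. if g \<in> carrier G then if g \<in> H then \<phi> v g else 0\<^sub>v d else undefined)"
  have H_mult: "g \<otimes> h \<in> H \<longleftrightarrow> g \<in> H" if "g \<in> carrier G" "h \<in> H" for g h
  proof
    assume "g \<otimes> h \<in> H"
    then have "g \<otimes> h \<otimes> inv h \<in> H" using that by simp
    then show "g \<in> H" using that H.subset by (auto simp: m_assoc)
  qed (use that in auto)
  have \<sigma>0: "\<sigma> h *\<^sub>v 0\<^sub>v d = 0\<^sub>v d" if "h \<in> H" for h
    by (rule eq_vecI) (use matrix_rep_carrier[OF \<sigma>, of h] that in auto)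
  have "cut v \<in> carrier (induced_module G H d \<sigma>)" for v
    using \<phi>c \<phi>_mem(2) H_mult \<sigma>0 H.subset
    by (auto simp: induced_module_def cut_def PiE_def extensional_def)
  then have "\<exists>u. \<phi> u = cut v" for v using bij unfolding bij_betw_def by (metis image_iff)
  then obtain f where "\<And>v. \<phi> (f v) = cut v" by metis
  then have f: "\<phi> (f v) g = (if g \<in> H then \<phi> v g else 0\<^sub>v d)" if "g \<in> carrier G" for v g
    using that by (simp add: cut_def)
  have fendo: "endo f"
    unfolding endo_iff
  proof (intro conjI allI)
    show "f (u + v) = f u + f v" for u v by (rule inj) (simp add: f add)
    show "f (scale c v) = scale c (f v)" for c v by (rule inj) (auto simp: f sc intro!: eq_vecI)
  qed
  have "f \<in> R"
    by (rule RI[OF fendo, of "\<lambda>g. if g \<in> H then 1 else 0"])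
      (use H_mult zero_smult in \<open>simp add: Q_def f\<close>)
  show False
    using R
  proof
    assume "R = range scale"
    then obtain c where c: "f = scale c" using \<open>f \<in> R\<close> by blast
    have "\<phi> (pt \<one>) \<one> = c \<cdot>\<^sub>v \<phi> (pt \<one>) \<one>" using f[of \<one> "pt \<one>"] sc[of \<one> c] c by simp
    moreover have "0\<^sub>v d = c \<cdot>\<^sub>v \<phi> (pt g1) g1" using f[OF g1(1), of "pt g1"] sc[OF g1(1), of c] c g1 by simp
    then have "c = 0" using pt[OF g1(1)] \<phi>c[OF g1(1), of "pt g1"]
      by (metis carrier_vecD eq_vecI index_smult_vec(1) index_zero_vec mult_eq_0_iff)
    ultimately have "\<phi> (pt \<one>) \<one> = 0 \<cdot>\<^sub>v \<phi> (pt \<one>) \<one>" by simp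
    also have "\<dots> = 0\<^sub>v d" by (rule zero_smult) simp
    finally show False using pt[OF one_closed] by simp
  next
    assume "R = {f. endo f}"
    \<comment> \<open>Translation by \<open>g1\<close> moves the nonzero value of
      \<open>f (pt \<one>)\<close> from \<open>\<one>\<close> to \<open>g1\<close>, where a
      multiplication operator can only produce 0, because \<open>f (pt \<one>)\<close> vanishes
      outside \<open>H\<close>.\<close>
    then have "\<rho> g1 \<in> R" using rho_endo[OF g1(1)] by simp
    then obtain \<gamma> where "Q (\<rho> g1) \<gamma>" by (auto simp: R_def)
    then have "\<phi> (\<rho> g1 (f (pt \<one>))) g1 = \<gamma> g1 \<cdot>\<^sub>v \<phi> (f (pt \<one>)) g1" using g1 by (simp add: Q_def)
    also have "\<dots> = 0\<^sub>v d" using g1 by (intro eq_vecI) (auto simp: f)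
    finally show False using g1 pt[OF one_closed] by (simp add: act f)
  qed
qed

text \<open>If every operator over \<open>k\<close> preserves \<open>U\<close>, the elementary
  matrices alone force \<open>U\<close> to be zero or everything. If only the scalars do, then
  \<open>G\<close> acts by scalars, \<open>V\<close> turns out to be a line, and the scalars are all
  the operators there are.\<close>

lemma very_simple_imp_absolutely_simple:
  assumes vs: "very_simple G scale \<rho>" and nz: "\<exists>v :: 'v. v \<noteq> 0"
  shows "absolutely_simple G scale \<rho>"
proof -
  obtain n \<phi> where \<phi>: "coords UNIV n \<phi>" using coords_exist[OF subspace_UNIV] by blast
  obtain M where M: "matrix_rep G n M" and eq: "\<And>g v. g \<in> carrier G \<Longrightarrow> \<phi> (\<rho> g v) = M g *\<^sub>v \<phi> v"
    using coords_matrix_rep[OF is_group \<phi>, of \<rho>] rho_endo rho_mult rho_one by auto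
  have aff: "affords_matrix_rep G scale \<rho> n M"
    unfolding affords_matrix_rep_iff using M \<phi> eq by blast
  have \<phi>c: "\<phi> v \<in> carrier_vec n" for v using coords_closed[OF \<phi>] by simp
  let ?h = "map_mat (to_ac :: 'k \<Rightarrow> 'k alg_closure)"
  have n: "n > 0" by (rule coords_UNIV_pos[OF \<phi> nz])
  have Mc: "M g \<in> carrier_mat n n" if "g \<in> carrier G" for g using matrix_rep_carrier[OF M that] .
  have "U = {0\<^sub>v n} \<or> U = carrier_vec n" if inv: "invariant_subspace G n (\<lambda>g. ?h (M g)) U" for U
  proof -
    have Uc: "U \<subseteq> carrier_vec n" and U0: "0\<^sub>v n \<in> U"
      and Uadd: "\<And>x y. x \<in> U \<Longrightarrow> y \<in> U \<Longrightarrow> x + y \<in> U" and Usm: "\<And>c x. x \<in> U \<Longrightarrow> c \<cdot>\<^sub>v x \<in> U"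
      and UM: "\<And>g x. g \<in> carrier G \<Longrightarrow> x \<in> U \<Longrightarrow> ?h (M g) *\<^sub>v x \<in> U"
      using inv by (auto simp: invariant_subspace_def)
    define Q where "Q = (\<lambda>f A. A \<in> carrier_mat n n \<and> (\<forall>v. \<phi> (f v) = A *\<^sub>v \<phi> v) \<and> (\<forall>x\<in>U. ?h A *\<^sub>v x \<in> U))"
    define R where "R = {f. endo f \<and> (\<exists>A. Q f A)}"
    have RI: "f \<in> R" if "endo f" "Q f A" for f A using that by (auto simp: R_def)
    have Q_comp: "Q (\<lambda>v. f (f' v)) (A * A')" if "Q f A" "Q f' A'" for f f' A A'
    proof -
      have A: "A \<in> carrier_mat n n" "A' \<in> carrier_mat n n" using that by (auto simp: Q_def)
      have hA: "?h A \<in> carrier_mat n n" "?h A' \<in> carrier_mat n n" using A by auto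
      show ?thesis
        using that A Uc assoc_mult_mat_vec[OF A \<phi>c] assoc_mult_mat_vec[OF hA]
        by (auto simp: Q_def to_ac.mat_hom_mult[OF A] intro!: mult_carrier_mat)
    qed
    have Q_rho: "Q (\<rho> g) (M g)" if "g \<in> carrier G" for g
      using that Mc eq UM by (simp add: Q_def)
    have alg: "subalgebra_End scale R"
      unfolding subalgebra_End_def
    proof (intro conjI ballI allI)
      show "R \<subseteq> {f. endo f}" by (auto simp: R_def)
      show "id \<in> R"
      proof (rule RI[OF endo_id])
        show "Q id (1\<^sub>m n)" using \<phi>c Uc by (auto simp: Q_def to_ac.mat_hom_one)
      qed
      fix f assume f: "f \<in> R"
      then obtain A where A: "endo f" "Q f A" by (auto simp: R_def)
      then have Ac: "A \<in> carrier_mat n n" by (simp add: Q_def)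
      show "(\<lambda>v. scale c (f v)) \<in> R" for c
      proof (rule RI[OF endo_smult[OF A(1)]])
        have "Q (scale c) (c \<cdot>\<^sub>m 1\<^sub>m n)"
          unfolding Q_def
        proof (intro conjI allI ballI)
          show "\<phi> (scale c v) = c \<cdot>\<^sub>m 1\<^sub>m n *\<^sub>v \<phi> v" for v
            using coords_scale[OF \<phi>] smult_one_mult_vec[OF \<phi>c] by simp
          fix x assume x: "x \<in> U"
          have "?h (c \<cdot>\<^sub>m 1\<^sub>m n) = to_ac c \<cdot>\<^sub>m 1\<^sub>m n" by (intro eq_matI) auto
          then show "?h (c \<cdot>\<^sub>m 1\<^sub>m n) *\<^sub>v x \<in> U" using smult_one_mult_vec[of x n "to_ac c"] Uc Usm[OF x] x by auto
        qed simp
        then show "Q (\<lambda>v. scale c (f v)) (c \<cdot>\<^sub>m 1\<^sub>m n * A)" using Q_comp A(2) by blast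
      qed
      fix f' assume "f' \<in> R"
      then obtain A' where A': "endo f'" "Q f' A'" by (auto simp: R_def)
      then have A'c: "A' \<in> carrier_mat n n" by (simp add: Q_def)
      show "(\<lambda>v. f v + f' v) \<in> R"
      proof (rule RI[OF endo_plus[OF A(1) A'(1)]])
        have "?h (A + A') = ?h A + ?h A'" using Ac A'c by (intro eq_matI) auto
        moreover have "(?h A + ?h A') *\<^sub>v x = ?h A *\<^sub>v x + ?h A' *\<^sub>v x" if "x \<in> U" for x
          using Ac A'c Uc that by (intro add_mult_distrib_mat_vec) auto
        ultimately show "Q (\<lambda>v. f v + f' v) (A + A')"
          using A(2) A'(2) Ac A'c Uadd
          by (auto simp: Q_def coords_add[OF \<phi>] add_mult_distrib_mat_vec[OF Ac A'c \<phi>c])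
      qed
      show "f \<circ> f' \<in> R"
        by (rule RI[OF endo_comp[OF A(1) A'(1)]]) (use Q_comp[OF A(2) A'(2)] in \<open>simp add: comp_def\<close>)
    qed
    have "conj_stable R"
      unfolding conj_stable_def
    proof (intro ballI)
      fix s f assume s: "s \<in> carrier G" and "f \<in> R"
      then obtain A where A: "endo f" "Q f A" by (auto simp: R_def)
      have "Q (\<lambda>v. \<rho> s (f (\<rho> (inv s) v))) (M s * (A * M (inv s)))"
        using Q_comp[OF Q_rho[OF s] Q_comp[OF A(2) Q_rho]] s by simp
      then show "conjugate s f \<in> R"
        using RI[OF conjugate_endo[OF s A(1)]] by (simp add: conjugate_def)
    qed
    then have R: "R = range scale \<or> R = {f. endo f}" using very_simpleD[OF vs alg] by blast
    have "R = {f. endo f}"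
      using R
    proof
      assume Rs: "R = range scale"
      obtain b :: 'v where b: "b \<noteq> 0" using nz by blast
      have \<rho>s: "\<exists>c. \<rho> s = scale c" if "s \<in> carrier G" for s
        using RI[OF rho_endo[OF that] Q_rho[OF that]] Rs by blast
      \<comment> \<open>When \<open>G\<close> acts by scalars, conjugation is trivial and every
        subalgebra is normal. The stabiliser of the line through \<open>b\<close> is such a
        subalgebra, and either value allowed for it forces \<open>V\<close> to be that line.\<close>
      define L where "L = {f. endo f \<and> (\<exists>c. f b = scale c b)}"
      have "subalgebra_End scale L"
        unfolding subalgebra_End_def
      proof (intro conjI ballI allI)
        show "id \<in> L" by (auto simp: L_def endo_id intro: exI[of _ 1])
        fix f assume f: "f \<in> L"
        then obtain c where c: "f b = scale c b" "endo f" by (auto simp: L_def)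
        show "(\<lambda>v. scale a (f v)) \<in> L" for a using c by (auto simp: L_def endo_smult)
        fix f' assume "f' \<in> L"
        then obtain c' where c': "f' b = scale c' b" "endo f'" by (auto simp: L_def)
        show "(\<lambda>v. f v + f' v) \<in> L"
          using c c' by (auto simp: L_def endo_plus simp flip: scale_left_distrib)
        show "f \<circ> f' \<in> L" using c c' by (auto simp: L_def endo_comp endo_scaleD)
      qed (auto simp: L_def)
      moreover have "conj_stable L"
        unfolding conj_stable_def
      proof (intro ballI)
        fix s f assume s: "s \<in> carrier G" and f: "f \<in> L"
        have fe: "endo f" using f by (simp add: L_def)
        obtain c where c: "\<rho> s = scale c" using \<rho>s[OF s] by blast
        have "conjugate s f v = f v" for v
        proof -
          have "conjugate s f v = f (\<rho> s (\<rho> (inv s) v))"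
            unfolding conjugate_def c by (rule endo_scaleD[OF fe, symmetric])
          then show ?thesis using s by simp
        qed
        then have "conjugate s f = f" by (rule ext)
        then show "conjugate s f \<in> L" using f by simp
      qed
      ultimately have L: "L = range scale \<or> L = {f. endo f}" by (rule very_simpleD[OF vs])
      have b_ind: "independent {b}" using b by simp
      obtain C where C: "{b} \<subseteq> C" "C \<subseteq> UNIV" "independent C" "UNIV \<subseteq> span C"
        by (rule maximal_independent_subset_extend[OF subset_UNIV b_ind])
      have span_b: "span {b} = UNIV"
        using L
      proof
        assume Ls: "L = range scale"
        let ?g = "\<lambda>x. if x = b then b else 0"
        obtain f where f: "endo f" "\<forall>x\<in>C. f x = ?g x"
          using linear_extension[OF C(3), of ?g] by blast
        have "f b = scale 1 b" using f(2) C(1) by simp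
        then have "f \<in> L" unfolding L_def using f(1) by blast
        then obtain c where c: "f = scale c" using Ls by blast
        then have "scale c b = scale 1 b" using \<open>f b = scale 1 b\<close> by simp
        then have "c = 1" using b by (metis scale_cancel_right)
        have "x = b" if "x \<in> C" for x
        proof (rule ccontr)
          assume "x \<noteq> b"
          then have "x = 0" using f(2) that c \<open>c = 1\<close> by auto
          then show False using that C(3) dependent_zero by blast
        qed
        then have "C = {b}" using C(1) by blast
        then show ?thesis using C(4) by blast
      next
        assume La: "L = {f. endo f}"
        have "v \<in> span {b}" for v
        proof -
          let ?g = "\<lambda>x. v"
          obtain f where f: "endo f" "\<forall>x\<in>{b}. f x = ?g x"
            using linear_extension[OF b_ind, of ?g] by blast
          then have "f \<in> L" using La by simp
          then obtain c where "f b = scale c b" by (auto simp: L_def)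
          then have "v = scale c b" using f(2) by simp
          then show ?thesis by (simp add: span_base span_scale)
        qed
        then show ?thesis by blast
      qed
      have "f \<in> range scale" if f: "endo f" for f
      proof -
        have "f b \<in> span {b}" using span_b by simp
        then obtain c where c: "f b = scale c b" by (auto simp: span_singleton)
        have "subspace {v. f v = scale c v}"
          using f by (auto simp: subspace_def endo_addD endo_scaleD endo_zero scale_right_distrib mult.commute)
        then have "span {b} \<subseteq> {v. f v = scale c v}" by (rule span_minimal[rotated]) (use c in simp)
        then have "f v = scale c v" for v unfolding span_b by blast
        then have "f = scale c" by (rule ext)
        then show ?thesis by blast
      qed
      then show ?thesis using Rs endo_scale by auto
    qed simp
    then have all: "?h A *\<^sub>v x \<in> U" if A: "A \<in> carrier_mat n n" and x: "x \<in> U" for A x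
    proof -
      define f where "f = mat_op \<phi> A"
      note f = coords_mat_op[OF \<phi> A, folded f_def]
      have "endo f" unfolding f_def by (rule mat_op_endo[OF \<phi> A])
      then have "f \<in> R" using \<open>R = {f. endo f}\<close> by simp
      then obtain B where B: "B \<in> carrier_mat n n" "\<And>v. \<phi> (f v) = B *\<^sub>v \<phi> v" "\<And>x. x \<in> U \<Longrightarrow> ?h B *\<^sub>v x \<in> U"
        by (auto simp: R_def Q_def)
      have "A = B"
        by (rule coords_mat_eqI[OF \<phi> A B(1)]) (simp add: f[symmetric] B(2)[symmetric])
      then show ?thesis using B(3)[OF x] by simp
    qed
    show ?thesis
    proof (cases "U = {0\<^sub>v n}")
      case False
      then obtain x where x: "x \<in> U" "x \<noteq> 0\<^sub>v n" using U0 by blast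
      have xc: "x \<in> carrier_vec n" using x Uc by blast
      have "\<exists>j<n. x $ j \<noteq> 0"
      proof (rule ccontr)
        assume "\<not> ?thesis"
        then have "x = 0\<^sub>v n" using xc by (intro eq_vecI) auto
        then show False using x by simp
      qed
      then obtain j where j: "j < n" "x $ j \<noteq> 0" by blast
      have unit: "unit_vec n i \<in> U" if i: "i < n" for i
      proof -
        \<comment> \<open>The elementary matrix that moves the nonzero coordinate \<open>j\<close>
          of \<open>x\<close> to position \<open>i\<close>.\<close>
        define A where "A = mat n n (\<lambda>(p, q). if p = i \<and> q = j then 1 else 0 :: 'k)"
        have "?h A *\<^sub>v x = x $ j \<cdot>\<^sub>v unit_vec n i"
        proof (rule eq_vecI)
          fix p assume "p < dim_vec (x $ j \<cdot>\<^sub>v unit_vec n i)"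
          then have p: "p < n" by simp
          have "(?h A *\<^sub>v x) $ p = (\<Sum>q = 0..<n. to_ac (A $$ (p, q)) * x $ q)"
            using p xc by (auto simp: A_def scalar_prod_def intro!: sum.cong)
          also have "\<dots> = (\<Sum>q = 0..<n. if q = j then (if p = i then x $ j else 0) else 0)"
            using p by (intro sum.cong) (auto simp: A_def)
          also have "\<dots> = (if p = i then x $ j else 0)" using j by simp
          finally show "(?h A *\<^sub>v x) $ p = (x $ j \<cdot>\<^sub>v unit_vec n i) $ p" using p i by simp
        qed (simp add: A_def)
        moreover have "?h A *\<^sub>v x \<in> U" using x by (intro all) (simp_all add: A_def)
        ultimately have "inverse (x $ j) \<cdot>\<^sub>v (x $ j \<cdot>\<^sub>v unit_vec n i) \<in> U" using Usm by simp
        then show ?thesis using j by (simp add: smult_smult_assoc)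
      qed
      have "y \<in> U" if y: "y \<in> carrier_vec n" for y
      proof -
        have "vec n (\<lambda>i. \<Sum>l<n. y $ l * unit_vec n l $ i) \<in> U"
          by (rule linear_combination_closed[OF U0 Uadd Usm Uc unit])
        moreover have "vec n (\<lambda>i. \<Sum>l<n. y $ l * unit_vec n l $ i) = y"
        proof (rule eq_vecI)
          fix i assume "i < dim_vec y"
          then have i: "i < n" using y by simp
          have "(\<Sum>l<n. y $ l * unit_vec n l $ i) = (\<Sum>l<n. if l = i then y $ l else 0)"
            using i by (intro sum.cong) auto
          then show "vec n (\<lambda>i. \<Sum>l<n. y $ l * unit_vec n l $ i) $ i = y $ i" using i by simp
        qed (use y in simp)
        ultimately show ?thesis by simp
      qed
      then show ?thesis using Uc by blast
    qed simp
  qed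
  then have "absolutely_irreducible_rep G n M"
    using n by (simp add: absolutely_irreducible_rep_def irreducible_rep_def)
  then show ?thesis unfolding absolutely_simple_def using aff by blast
qed

end

theorem corollary4p2:
  fixes G :: "('g, 'b) monoid_scheme"
    and scale :: "'k::field \<Rightarrow> 'v::ab_group_add \<Rightarrow> 'v"
    and Basis :: "'v set"
    and \<rho> :: "'g \<Rightarrow> 'v \<Rightarrow> 'v"
  assumes "group G"
    and "(\<forall>p :: 'k poly. degree p > 0 \<longrightarrow> (\<exists>x. poly p x = 0)) \<or>
         (derived G (carrier G) = carrier G \<and> finite (UNIV :: 'k set))"
    and "finite_dimensional_vector_space scale Basis"
    and "\<exists>v :: 'v. v \<noteq> 0"
    and "linear_rep G scale \<rho>"
  shows "very_simple G scale \<rho> \<longleftrightarrow>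
           absolutely_simple G scale \<rho> \<and>
           \<not> admits_projective_absolutely_simple_splitting G scale \<rho> \<and>
           \<not> induced_from_proper_finite_index G scale \<rho>"
proof -
  interpret finite_dimensional_vector_space scale Basis by (rule assms(3))
  interpret group G by (rule assms(1))
  interpret fin_rep scale Basis G \<rho> by unfold_locales (rule assms(5))
  show ?thesis
  proof (intro iffI conjI)
    assume vs: "very_simple G scale \<rho>"
    show "absolutely_simple G scale \<rho>" using vs assms(4) by (rule very_simple_imp_absolutely_simple)
    show "\<not> admits_projective_absolutely_simple_splitting G scale \<rho>"
      using very_simple_not_splitting[OF vs]
      unfolding admits_projective_absolutely_simple_splitting_def projective_splitting_def by blast
    show "\<not> induced_from_proper_finite_index G scale \<rho>" using vs assms(4) by (rule very_simple_not_induced)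
  next
    assume "absolutely_simple G scale \<rho> \<and>
      \<not> admits_projective_absolutely_simple_splitting G scale \<rho> \<and>
      \<not> induced_from_proper_finite_index G scale \<rho>"
    then show "very_simple G scale \<rho>" using very_simpleI assms(2,4) by blast
  qed
qed

end
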